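(* Let $m,N\ge 1$ and let $\overline U=\overline{\mathrm{Mat}_m}$ be the set of complex $m\times m$ matrices with pairwise different eigenvalues, equipped with a fixed order of the eigenvalues. For $\sigma\in S_{mN}$ and generic $(b_1,\dots,b_N)\in\overline U^N$ put $\sigma(b_1,\dots,b_N)=(b_1',\dots,b_N')$, where $(b_1',\dots,b_N')\in\overline U^N$ is determined by $$(t-b_1)\cdots(t-b_N)=(t-b_1')\cdots(t-b_N')$$ (an identity of matrix polynomials in $t$) together with the condition that the ordered list of $mN$ eigenvalues $(\overline S(b_1'),\dots,\overline S(b_N'))$ is obtained from the ordered list $(\overline S(b_1),\dots,\overline S(b_N))$ by applying the permutation $\sigma$. Then this defines an action of the symmetric group $S_{mN}$ on $\overline U^N$ by birational automorphisms. This action is local in the following sense: for $0\le\alpha\le N-1$ and $\alpha m<i<(\alpha+1)m$ the transposition $(i,i+1)$ acts only inside the $(\alpha+1)$-th factor of $\overline U^N$ (leaving all other factors unchanged), and for $1\le\alpha\le N-1$ the transposition $(\alpha m,\alpha m+1)$ acts only inside the product of the $\alpha$-th and $(\alpha+1)$-th factors (leaving all other factors unchanged). Moreover, for $N=2$, the birational automorphism $\mu:\overline U\times\overline U\to\overline U\times\overline U$ given by the action of the element $(1,m+1)(2,m+2)\cdots(m,2m)\in S_{2m}$ is a twisted transposition.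
   Context: A point of $\overline U$ is a pair consisting of a complex $m\times m$ matrix $b$ with $m$ distinct eigenvalues and an ordering $\overline S(b)=(\lambda_1,\dots,\lambda_m)$ of these eigenvalues. A permutation $\sigma\in S_{mN}$ acts on ordered lists of $mN$ numbers by $(\sigma\lambda)_j=\lambda_{\sigma^{-1}(j)}$; positions $(\alpha-1)m+1,\dots,\alpha m$ of the list belong to the $\alpha$-th matrix. "Generic" means: for all points outside some proper Zariski-closed subset. Twisted transposition: for a complex manifold $X$, a birational automorphism $\mu$ of $X\times X$ is called a twisted transposition if the birational automorphisms $\sigma_1=\mu\times\mathrm{id}$ and $\sigma_2=\mathrm{id}\times\mu$ of $X\times X\times X$ satisfy $\sigma_1^2=\sigma_2^2=\mathrm{id}$ and $\sigma_1\sigma_2\sigma_1=\sigma_2\sigma_1\sigma_2$. *)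

theory Defs
  imports
    "HOL-Analysis.Abstract_Topology"
    "HOL-Combinatorics.Permutations"
    "Jordan_Normal_Form.Spectral_Radius"
begin

section \<open>Quasi-affine varieties and birational automorphisms\<close>

text \<open>
  A variety is given by its set of points together with the ambient affine coordinates, seen as
  complex-valued functions on points.
\<close>

record 'a variety =
  pts :: "'a set"
  coords :: "('a \<Rightarrow> complex) set"

inductive_set polyfun :: "('a \<Rightarrow> complex) set \<Rightarrow> ('a \<Rightarrow> complex) set"
  for C :: "('a \<Rightarrow> complex) set" where
  const: "(\<lambda>_. a) \<in> polyfun C"
| coord: "c \<in> C \<Longrightarrow> c \<in> polyfun C"
| add: "p \<in> polyfun C \<Longrightarrow> q \<in> polyfun C \<Longrightarrow> (\<lambda>x. p x + q x) \<in> polyfun C"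
| mult: "p \<in> polyfun C \<Longrightarrow> q \<in> polyfun C \<Longrightarrow> (\<lambda>x. p x * q x) \<in> polyfun C"

definition zariski :: "'a variety \<Rightarrow> 'a topology" where
  "zariski X =
     topology (\<lambda>V. \<exists>P \<subseteq> polyfun (coords X). V = {x \<in> pts X. \<exists>p\<in>P. p x \<noteq> 0})"

lemma istopology_zariski:
  "istopology (\<lambda>V. \<exists>P \<subseteq> polyfun (coords X). V = {x \<in> pts X. \<exists>p\<in>P. p x \<noteq> 0})"
  (is "istopology ?O")
  unfolding istopology_def
proof (intro conjI allI impI)
  fix S T assume "?O S" "?O T"
  then obtain P Q where
    P: "P \<subseteq> polyfun (coords X)" "S = {x \<in> pts X. \<exists>p\<in>P. p x \<noteq> 0}" and
    Q: "Q \<subseteq> polyfun (coords X)" "T = {x \<in> pts X. \<exists>p\<in>Q. p x \<noteq> 0}"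
    by blast
  let ?R = "(\<lambda>(p, q) x. p x * q x) ` (P \<times> Q)"
  have "?R \<subseteq> polyfun (coords X)"
    using P(1) Q(1) by (auto intro!: polyfun.mult)
  moreover have "S \<inter> T = {x \<in> pts X. \<exists>p\<in>?R. p x \<noteq> 0}"
    unfolding P(2) Q(2) by fastforce
  ultimately show "?O (S \<inter> T)" by blast
next
  fix K assume K: "\<forall>S\<in>K. ?O S"
  let ?R = "{p \<in> polyfun (coords X). {x \<in> pts X. p x \<noteq> 0} \<subseteq> \<Union>K}"
  have "\<Union>K = {x \<in> pts X. \<exists>p\<in>?R. p x \<noteq> 0}"
  proof (intro equalityI subsetI)
    fix x assume "x \<in> \<Union>K"
    then obtain S where S: "S \<in> K" "x \<in> S" by blast
    with K obtain P where P: "P \<subseteq> polyfun (coords X)" "S = {x \<in> pts X. \<exists>p\<in>P. p x \<noteq> 0}"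
      by blast
    then obtain p where p: "p \<in> P" "p x \<noteq> 0" "x \<in> pts X" using S by blast
    have "{x \<in> pts X. p x \<noteq> 0} \<subseteq> \<Union>K" using p(1) P(2) S(1) by blast
    then show "x \<in> {x \<in> pts X. \<exists>p\<in>?R. p x \<noteq> 0}" using p P(1) by auto
  next
    fix x assume "x \<in> {x \<in> pts X. \<exists>p\<in>?R. p x \<noteq> 0}"
    then obtain p where "p \<in> ?R" "x \<in> pts X" "p x \<noteq> 0" by blast
    then show "x \<in> \<Union>K" by (simp add: subset_iff)
  qed
  moreover have "?R \<subseteq> polyfun (coords X)" by simp
  ultimately show "?O (\<Union>K)" by (intro exI[of _ ?R] conjI)
qed

lemma openin_zariski:
  "openin (zariski X) V \<longleftrightarrow>
     (\<exists>P \<subseteq> polyfun (coords X). V = {x \<in> pts X. \<exists>p\<in>P. p x \<noteq> 0})"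
  unfolding zariski_def by (simp add: topology_inverse'[OF istopology_zariski])

lemma topspace_zariski: "topspace (zariski X) = pts X"
proof
  show "topspace (zariski X) \<subseteq> pts X"
    unfolding topspace_def by (auto simp: openin_zariski)
  have "openin (zariski X) (pts X)"
    unfolding openin_zariski
    by (rule exI[of _ "{\<lambda>_. 1}"]) (auto intro: polyfun.const)
  then show "pts X \<subseteq> topspace (zariski X)" by (rule openin_subset)
qed

lemma closedin_zariski:
  "closedin (zariski X) Z \<longleftrightarrow>
     (\<exists>P \<subseteq> polyfun (coords X). Z = {x \<in> pts X. \<forall>p\<in>P. p x = 0})"
proof -
  have eq: "(Z \<subseteq> pts X \<and> pts X - Z = {x \<in> pts X. \<exists>p\<in>P. p x \<noteq> 0}) \<longleftrightarrow>
        Z = {x \<in> pts X. \<forall>p\<in>P. p x = 0}" for P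
    by blast
  show ?thesis
    unfolding closedin_def topspace_zariski openin_zariski eq[symmetric]
    by (rule iffI; elim conjE exE; intro exI conjI; assumption)
qed

definition generic :: "'a variety \<Rightarrow> ('a \<Rightarrow> bool) \<Rightarrow> bool" where
  "generic X Q \<longleftrightarrow>
     (\<exists>Z. closedin (zariski X) Z \<and> Z \<noteq> pts X \<and> (\<forall>x \<in> pts X - Z. Q x))"

definition dense_open :: "'a variety \<Rightarrow> 'a set \<Rightarrow> bool" where
  "dense_open X V \<longleftrightarrow> openin (zariski X) V \<and> zariski X closure_of V = pts X"

definition regular_on :: "'a variety \<Rightarrow> 'a set \<Rightarrow> ('a \<Rightarrow> complex) \<Rightarrow> bool" where
  "regular_on X V f \<longleftrightarrow>
     (\<forall>x\<in>V. \<exists>W p q. openin (zariski X) W \<and> x \<in> W \<and> W \<subseteq> V \<and>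
        p \<in> polyfun (coords X) \<and> q \<in> polyfun (coords X) \<and>
        (\<forall>y\<in>W. q y \<noteq> 0 \<and> f y = p y / q y))"

text \<open>
  A rational map is represented by a partial function that is regular on its whole domain, the
  domain being open and dense; two representatives define the same rational map when they agree on
  a dense open set.  With partial functions, \<open>f \<circ>\<^sub>m g\<close> is defined exactly where
  \<open>g\<close> is defined with value in the domain of \<open>f\<close>.
\<close>

definition rational_map :: "'a variety \<Rightarrow> 'b variety \<Rightarrow> ('a \<rightharpoonup> 'b) \<Rightarrow> bool" where
  "rational_map X Y f \<longleftrightarrow>
     dense_open X (dom f) \<and> ran f \<subseteq> pts Y \<and>
     (\<forall>c \<in> coords Y. regular_on X (dom f) (\<lambda>x. c (the (f x))))"

definition rat_eq :: "'a variety \<Rightarrow> ('a \<rightharpoonup> 'b) \<Rightarrow> ('a \<rightharpoonup> 'b) \<Rightarrow> bool" where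
  "rat_eq X f g \<longleftrightarrow> (\<exists>V. dense_open X V \<and> (\<forall>x\<in>V. f x \<noteq> None \<and> f x = g x))"

definition birational_automorphism :: "'a variety \<Rightarrow> ('a \<rightharpoonup> 'a) \<Rightarrow> bool" where
  "birational_automorphism X f \<longleftrightarrow>
     rational_map X X f \<and>
     (\<exists>g. rational_map X X g \<and> rat_eq X (f \<circ>\<^sub>m g) Some \<and> rat_eq X (g \<circ>\<^sub>m f) Some)"


section \<open>Powers of a variety and twisted transpositions\<close>

text \<open>Points of the \<open>n\<close>-th power are lists of length \<open>n\<close>; factors are indexed from 0.\<close>

definition var_power :: "'a variety \<Rightarrow> nat \<Rightarrow> 'a list variety" where
  "var_power X n =
     \<lparr> pts = {xs. length xs = n \<and> set xs \<subseteq> pts X},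
       coords = {\<lambda>xs. c (xs ! k) | c k. c \<in> coords X \<and> k < n} \<rparr>"

text \<open>
  The map \<open>id \<times> f \<times> id\<close> of \<open>X\<^sup>n\<close>, where \<open>f\<close> is a map of \<open>X\<^sup>r\<close> placed on the factors
  \<open>k, \<dots>, k + r - 1\<close>.
\<close>

definition act_inside ::
  "'a variety \<Rightarrow> nat \<Rightarrow> nat \<Rightarrow> nat \<Rightarrow> ('a list \<rightharpoonup> 'a list) \<Rightarrow> ('a list \<rightharpoonup> 'a list)" where
  "act_inside X n k r f xs =
     (if xs \<in> pts (var_power X n)
      then map_option (\<lambda>ys. take k xs @ ys @ drop (k + r) xs) (f (take r (drop k xs)))
      else None)"

definition twisted_transposition :: "'a variety \<Rightarrow> ('a list \<rightharpoonup> 'a list) \<Rightarrow> bool" where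
  "twisted_transposition X \<mu> \<longleftrightarrow>
     birational_automorphism (var_power X 2) \<mu> \<and>
     (let \<sigma>\<^sub>1 = act_inside X 3 0 2 \<mu>; \<sigma>\<^sub>2 = act_inside X 3 1 2 \<mu> in
        rat_eq (var_power X 3) (\<sigma>\<^sub>1 \<circ>\<^sub>m \<sigma>\<^sub>1) Some \<and>
        rat_eq (var_power X 3) (\<sigma>\<^sub>2 \<circ>\<^sub>m \<sigma>\<^sub>2) Some \<and>
        rat_eq (var_power X 3) (\<sigma>\<^sub>1 \<circ>\<^sub>m \<sigma>\<^sub>2 \<circ>\<^sub>m \<sigma>\<^sub>1) (\<sigma>\<^sub>2 \<circ>\<^sub>m \<sigma>\<^sub>1 \<circ>\<^sub>m \<sigma>\<^sub>2))"


section \<open>Matrices with ordered simple spectrum\<close>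

definition Ubar :: "nat \<Rightarrow> (complex mat \<times> complex list) variety" where
  "Ubar m =
     \<lparr> pts = {(b, l). b \<in> carrier_mat m m \<and> length l = m \<and> distinct l \<and> set l = spectrum b},
       coords = {\<lambda>(b, l). b $$ (i, j) | i j. i < m \<and> j < m} \<union> {\<lambda>(b, l). l ! i | i. i < m} \<rparr>"

text \<open>
  \<open>char_poly_matrix b\<close> is the matrix polynomial \<open>t - b\<close>, as a matrix over \<open>complex poly\<close>.
\<close>

definition factor_product :: "nat \<Rightarrow> (complex mat \<times> complex list) list \<Rightarrow> complex poly mat" where
  "factor_product m bs = foldr (*) (map (\<lambda>(b, l). char_poly_matrix b) bs) (1\<^sub>m m)"

definition eigenvalue_list :: "(complex mat \<times> complex list) list \<Rightarrow> complex list" where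
  "eigenvalue_list bs = concat (map snd bs)"

text \<open>
  List positions are counted from 0, so \<open>S\<^bsub>mN\<^esub>\<close> permutes \<open>{..<m * N}\<close>.
  Entry \<open>j\<close> of \<open>permute_list f l\<close> is \<open>l ! f j\<close>, hence the inverse.
\<close>

definition refactors ::
  "nat \<Rightarrow> nat \<Rightarrow> (nat \<Rightarrow> nat) \<Rightarrow> (complex mat \<times> complex list) list \<Rightarrow>
     (complex mat \<times> complex list) list \<Rightarrow> bool" where
  "refactors m N \<sigma> bs bs' \<longleftrightarrow>
     bs' \<in> pts (var_power (Ubar m) N) \<and>
     factor_product m bs = factor_product m bs' \<and>
     eigenvalue_list bs' = permute_list (inv_into UNIV \<sigma>) (eigenvalue_list bs)"

text \<open>The product of the transpositions of \<open>i\<close> and \<open>m + i\<close> for \<open>i < m\<close>.\<close>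

definition block_swap :: "nat \<Rightarrow> nat \<Rightarrow> nat" where
  "block_swap m = foldr (\<lambda>i \<pi>. Transposition.transpose i (m + i) \<circ> \<pi>) [0..<m] id"

end

theory Submission
  imports Defs
begin

text \<open>
  A matrix with simple spectrum is determined by its eigenvalues and left eigenvectors, and this makes
  the refactorization unique as soon as all \<open>mN\<close> eigenvalues are different
  (\<open>factor_product_determines\<close>): at an eigenvalue \<open>\<lambda>\<close> of the first factor the other factors of
  \<open>(t - b\<^sub>1) \<dots> (t - b\<^sub>N)\<close> are invertible, so a row vector that annihilates \<open>\<lambda> - b\<^sub>1\<close> annihilates
  \<open>\<lambda> - b\<^sub>1'\<close> for every other factorization with the same ordered spectra. Hence \<open>b\<^sub>1' = b\<^sub>1\<close>; the first
  factor is then cancelled, its determinant being a nonzero polynomial. Every identity between rational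
  maps in the theorem follows from this uniqueness: two maps that realize the same permutation of the
  eigenvalues agree wherever both are defined and the eigenvalues are different.

  Existence is needed only for adjacent transpositions. Two eigenvalues of the same matrix are exchanged
  by reordering its list. To exchange the eigenvalue \<open>\<lambda>\<close> of \<open>b\<^sub>1\<close> with the eigenvalue \<open>\<kappa>\<close> of \<open>b\<^sub>2\<close>
  take \<open>b\<^sub>1' = b\<^sub>1 - K\<close> and \<open>b\<^sub>2' = b\<^sub>2 + K\<close>, where \<open>K\<close> is the rank one matrix whose columns are
  \<open>\<lambda>\<close>-eigenvectors of \<open>b\<^sub>1\<close>, whose rows are left \<open>\<kappa>\<close>-eigenvectors of \<open>b\<^sub>2\<close>, and whose trace is
  \<open>\<lambda> - \<kappa>\<close>; then \<open>b\<^sub>1 K - K b\<^sub>2 = (\<lambda> - \<kappa>) K = K\<^sup>2\<close>, which says that the product is unchanged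
  (\<open>cross_swap_correct\<close>). The matrix \<open>K\<close> is a rational function of the data, because
  \<open>\<Prod>\<^sub>\<nu> (b - \<nu>)\<close> over all eigenvalues but one is a multiple of the projector to the remaining
  eigenspace.

  A general permutation is a product of adjacent transpositions, so it remains to compose rational maps.
  The composites stay densely defined since the variety of points \<open>(b\<^sub>1, \<dots>, b\<^sub>N)\<close> with ordered simple
  spectra is irreducible: two points lie on a rational curve, obtained by moving \<open>(S, l)\<close> along a line in
  \<open>b = S diag(l) S\<^sup>-\<^sup>1\<close>. The maps are carried
  along together with exact partial inverses, which makes the domain of a composite nonempty
  (\<open>inverse_pair_comp\<close>). Locality holds by construction of the generators. The twisted transposition is
  the case of three blocks: both sides of the braid relation reverse the order of the three ordered
  spectra and preserve the product.
\<close>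

section \<open>Regular functions and maps\<close>

lemma openin_zariski_subset: "openin (zariski X) U \<Longrightarrow> U \<subseteq> pts X"
  using openin_subset topspace_zariski by metis

lemma openin_zariski_pts: "openin (zariski X) (pts X)"
  by (metis openin_topspace topspace_zariski)

lemma openin_zariski_nonzero:
  "p \<in> polyfun (coords X) \<Longrightarrow> openin (zariski X) {x \<in> pts X. p x \<noteq> 0}"
  unfolding openin_zariski by (rule exI[of _ "{p}"]) auto

lemma regular_onE:
  assumes "regular_on X V f" "x \<in> V"
  obtains W p q where "openin (zariski X) W" "x \<in> W" "W \<subseteq> V"
    "p \<in> polyfun (coords X)" "q \<in> polyfun (coords X)"
    "\<forall>y\<in>W. q y \<noteq> 0 \<and> f y = p y / q y"
  using assms unfolding regular_on_def by auto

lemma regular_onI: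
  assumes "\<And>x. x \<in> V \<Longrightarrow> \<exists>W p q. openin (zariski X) W \<and> x \<in> W \<and> W \<subseteq> V \<and>
        p \<in> polyfun (coords X) \<and> q \<in> polyfun (coords X) \<and>
        (\<forall>y\<in>W. q y \<noteq> 0 \<and> f y = p y / q y)"
  shows "regular_on X V f"
  using assms unfolding regular_on_def by blast

lemma regular_onI_local:
  assumes "\<And>x. x \<in> V \<Longrightarrow> \<exists>W. x \<in> W \<and> W \<subseteq> V \<and> regular_on X W f"
  shows "regular_on X V f"
proof (rule regular_onI)
  fix x assume "x \<in> V"
  then obtain W where W: "x \<in> W" "W \<subseteq> V" "regular_on X W f" using assms by blast
  obtain W' p q where W': "openin (zariski X) W'" "x \<in> W'" "W' \<subseteq> W"
    "p \<in> polyfun (coords X)" "q \<in> polyfun (coords X)"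
    "\<forall>y\<in>W'. q y \<noteq> 0 \<and> f y = p y / q y"
    by (rule regular_onE[OF W(3,1)])
  show "\<exists>W p q. openin (zariski X) W \<and> x \<in> W \<and> W \<subseteq> V \<and>
        p \<in> polyfun (coords X) \<and> q \<in> polyfun (coords X) \<and>
        (\<forall>y\<in>W. q y \<noteq> 0 \<and> f y = p y / q y)"
    by (rule exI[of _ W'], rule exI[of _ p], rule exI[of _ q]) (use W' W(2) in simp)
qed

lemma regular_on_subset:
  assumes "regular_on X V f" "openin (zariski X) U" "U \<subseteq> V"
  shows "regular_on X U f"
proof (rule regular_onI)
  fix x assume x: "x \<in> U"
  obtain W p q where W: "openin (zariski X) W" "x \<in> W" "W \<subseteq> V"
    "p \<in> polyfun (coords X)" "q \<in> polyfun (coords X)"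
    "\<forall>y\<in>W. q y \<noteq> 0 \<and> f y = p y / q y"
    by (rule regular_onE[OF assms(1) subsetD[OF assms(3) x]])
  show "\<exists>W p q. openin (zariski X) W \<and> x \<in> W \<and> W \<subseteq> U \<and>
        p \<in> polyfun (coords X) \<and> q \<in> polyfun (coords X) \<and>
        (\<forall>y\<in>W. q y \<noteq> 0 \<and> f y = p y / q y)"
    by (rule exI[of _ "W \<inter> U"], rule exI[of _ p], rule exI[of _ q])
      (use W x assms(2) in \<open>simp add: openin_Int\<close>)
qed

lemma regular_on_cong:
  assumes "regular_on X V f" "\<And>x. x \<in> V \<Longrightarrow> g x = f x"
  shows "regular_on X V g"
proof (rule regular_onI)
  fix x assume x: "x \<in> V"
  obtain W p q where W: "openin (zariski X) W" "x \<in> W" "W \<subseteq> V"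
    "p \<in> polyfun (coords X)" "q \<in> polyfun (coords X)"
    "\<forall>y\<in>W. q y \<noteq> 0 \<and> f y = p y / q y"
    by (rule regular_onE[OF assms(1) x])
  show "\<exists>W p q. openin (zariski X) W \<and> x \<in> W \<and> W \<subseteq> V \<and>
        p \<in> polyfun (coords X) \<and> q \<in> polyfun (coords X) \<and>
        (\<forall>y\<in>W. q y \<noteq> 0 \<and> g y = p y / q y)"
    by (rule exI[of _ W], rule exI[of _ p], rule exI[of _ q])
      (use W assms(2) subsetD[OF W(3)] in simp)
qed

lemma regular_on_polyfun:
  assumes "p \<in> polyfun (coords X)" "openin (zariski X) V"
  shows "regular_on X V p"
proof (rule regular_onI)
  fix x assume "x \<in> V"
  then show "\<exists>W p' q. openin (zariski X) W \<and> x \<in> W \<and> W \<subseteq> V \<and>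
        p' \<in> polyfun (coords X) \<and> q \<in> polyfun (coords X) \<and>
        (\<forall>y\<in>W. q y \<noteq> 0 \<and> p y = p' y / q y)"
    by (intro exI[of _ V] exI[of _ p] exI[of _ "\<lambda>_. 1"])
      (use assms in \<open>simp add: polyfun.const\<close>)
qed

lemma regular_on_const: "openin (zariski X) V \<Longrightarrow> regular_on X V (\<lambda>_. a)"
  by (intro regular_on_polyfun polyfun.const)

text \<open>
  Sums, products and quotients of regular functions all combine two local fractions into one on the
  intersection of the two neighbourhoods; the last premise is the algebra that differs between them.
\<close>

lemma regular_on_binop:
  assumes "regular_on X V f" "regular_on X V g"
    and "\<And>p q r s. \<lbrakk>p \<in> polyfun (coords X); q \<in> polyfun (coords X);
           r \<in> polyfun (coords X); s \<in> polyfun (coords X)\<rbrakk> \<Longrightarrow>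
         \<exists>P \<in> polyfun (coords X). \<exists>Q \<in> polyfun (coords X).
           \<forall>x \<in> V. q x \<noteq> 0 \<longrightarrow> s x \<noteq> 0 \<longrightarrow> f x = p x / q x \<longrightarrow> g x = r x / s x \<longrightarrow>
             Q x \<noteq> 0 \<and> h x = P x / Q x"
  shows "regular_on X V h"
proof (rule regular_onI)
  fix x assume x: "x \<in> V"
  obtain W p q where W: "openin (zariski X) W" "x \<in> W" "W \<subseteq> V"
    "p \<in> polyfun (coords X)" "q \<in> polyfun (coords X)"
    "\<forall>y\<in>W. q y \<noteq> 0 \<and> f y = p y / q y"
    by (rule regular_onE[OF assms(1) x])
  obtain W' r s where W': "openin (zariski X) W'" "x \<in> W'" "W' \<subseteq> V"
    "r \<in> polyfun (coords X)" "s \<in> polyfun (coords X)"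
    "\<forall>y\<in>W'. s y \<noteq> 0 \<and> g y = r y / s y"
    by (rule regular_onE[OF assms(2) x])
  obtain P Q where PQ: "P \<in> polyfun (coords X)" "Q \<in> polyfun (coords X)"
    "\<forall>x \<in> V. q x \<noteq> 0 \<longrightarrow> s x \<noteq> 0 \<longrightarrow> f x = p x / q x \<longrightarrow> g x = r x / s x \<longrightarrow>
             Q x \<noteq> 0 \<and> h x = P x / Q x"
    using assms(3)[OF W(4,5) W'(4,5)] by blast
  show "\<exists>W p q. openin (zariski X) W \<and> x \<in> W \<and> W \<subseteq> V \<and>
        p \<in> polyfun (coords X) \<and> q \<in> polyfun (coords X) \<and>
        (\<forall>y\<in>W. q y \<noteq> 0 \<and> h y = p y / q y)"
    by (rule exI[of _ "W \<inter> W'"], rule exI[of _ P], rule exI[of _ Q])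
      (use W W' PQ(1,2) PQ(3)[rule_format, OF subsetD[OF W(3)]] in \<open>auto simp: openin_Int\<close>)
qed

lemma regular_on_add:
  assumes "regular_on X V f" "regular_on X V g"
  shows "regular_on X V (\<lambda>x. f x + g x)"
proof (rule regular_on_binop[OF assms])
  fix p q r s
  assume *: "p \<in> polyfun (coords X)" "q \<in> polyfun (coords X)"
    "r \<in> polyfun (coords X)" "s \<in> polyfun (coords X)"
  show "\<exists>P \<in> polyfun (coords X). \<exists>Q \<in> polyfun (coords X).
           \<forall>x \<in> V. q x \<noteq> 0 \<longrightarrow> s x \<noteq> 0 \<longrightarrow> f x = p x / q x \<longrightarrow> g x = r x / s x \<longrightarrow>
             Q x \<noteq> 0 \<and> f x + g x = P x / Q x"
    by (rule bexI[of _ "\<lambda>x. p x * s x + r x * q x"], rule bexI[of _ "\<lambda>x. q x * s x"])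
      (use * in \<open>auto intro!: polyfun.intros(3,4) simp: field_simps\<close>)
qed

lemma regular_on_mult:
  assumes "regular_on X V f" "regular_on X V g"
  shows "regular_on X V (\<lambda>x. f x * g x)"
proof (rule regular_on_binop[OF assms])
  fix p q r s
  assume *: "p \<in> polyfun (coords X)" "q \<in> polyfun (coords X)"
    "r \<in> polyfun (coords X)" "s \<in> polyfun (coords X)"
  show "\<exists>P \<in> polyfun (coords X). \<exists>Q \<in> polyfun (coords X).
           \<forall>x \<in> V. q x \<noteq> 0 \<longrightarrow> s x \<noteq> 0 \<longrightarrow> f x = p x / q x \<longrightarrow> g x = r x / s x \<longrightarrow>
             Q x \<noteq> 0 \<and> f x * g x = P x / Q x"
    by (rule bexI[of _ "\<lambda>x. p x * r x"], rule bexI[of _ "\<lambda>x. q x * s x"])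
      (use * in \<open>auto intro!: polyfun.intros(3,4)\<close>)
qed

lemma regular_on_divide:
  assumes "regular_on X V f" "regular_on X V g" "\<And>x. x \<in> V \<Longrightarrow> g x \<noteq> 0"
  shows "regular_on X V (\<lambda>x. f x / g x)"
proof (rule regular_on_binop[OF assms(1,2)])
  fix p q r s
  assume *: "p \<in> polyfun (coords X)" "q \<in> polyfun (coords X)"
    "r \<in> polyfun (coords X)" "s \<in> polyfun (coords X)"
  show "\<exists>P \<in> polyfun (coords X). \<exists>Q \<in> polyfun (coords X).
           \<forall>x \<in> V. q x \<noteq> 0 \<longrightarrow> s x \<noteq> 0 \<longrightarrow> f x = p x / q x \<longrightarrow> g x = r x / s x \<longrightarrow>
             Q x \<noteq> 0 \<and> f x / g x = P x / Q x"
    by (rule bexI[of _ "\<lambda>x. p x * s x"], rule bexI[of _ "\<lambda>x. q x * r x"])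
      (use * assms(3) in \<open>auto intro!: polyfun.intros(3,4)\<close>)
qed

lemma regular_on_diff:
  assumes "openin (zariski X) V" "regular_on X V f" "regular_on X V g"
  shows "regular_on X V (\<lambda>x. f x - g x)"
  using regular_on_add[OF assms(2) regular_on_mult[OF regular_on_const[OF assms(1), of "-1"] assms(3)]]
  by simp

lemma regular_on_sum:
  assumes "openin (zariski X) V" "\<And>i. i \<in> I \<Longrightarrow> regular_on X V (f i)"
  shows "regular_on X V (\<lambda>x. \<Sum>i\<in>I. f i x)"
  using assms(2)
  by (induction I rule: infinite_finite_induct) (auto intro: regular_on_const[OF assms(1)] regular_on_add)

lemma regular_on_prod:
  assumes "openin (zariski X) V" "\<And>i. i \<in> I \<Longrightarrow> regular_on X V (f i)"
  shows "regular_on X V (\<lambda>x. \<Prod>i\<in>I. f i x)"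
  using assms(2)
  by (induction I rule: infinite_finite_induct) (auto intro: regular_on_const[OF assms(1)] regular_on_mult)

lemma openin_regular_nonzero:
  assumes "openin (zariski X) V" "regular_on X V f"
  shows "openin (zariski X) {x \<in> V. f x \<noteq> 0}"
proof (subst openin_subopen, intro ballI)
  fix x assume "x \<in> {x \<in> V. f x \<noteq> 0}"
  then have x: "x \<in> V" "f x \<noteq> 0" by auto
  obtain W p q where W: "openin (zariski X) W" "x \<in> W" "W \<subseteq> V"
    "p \<in> polyfun (coords X)" "q \<in> polyfun (coords X)"
    "\<forall>y\<in>W. q y \<noteq> 0 \<and> f y = p y / q y"
    by (rule regular_onE[OF assms(2) x(1)])
  show "\<exists>T. openin (zariski X) T \<and> x \<in> T \<and> T \<subseteq> {x \<in> V. f x \<noteq> 0}"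
  proof (intro exI conjI)
    show "openin (zariski X) (W \<inter> {y \<in> pts X. p y \<noteq> 0})"
      by (intro openin_Int W openin_zariski_nonzero)
    show "x \<in> W \<inter> {y \<in> pts X. p y \<noteq> 0}"
      using W(2) bspec[OF W(6) W(2)] x(2) openin_zariski_subset[OF W(1)] by auto
  qed (use W(3,6) in auto)
qed

text \<open>
  Rational maps appear here as total functions together with an open set on which they are regular.
  This treats the underlying function of a partial map and everywhere defined maps, such as projections
  to some of the factors, alike.
\<close>

definition regular_map_on :: "'a variety \<Rightarrow> 'a set \<Rightarrow> 'b variety \<Rightarrow> ('a \<Rightarrow> 'b) \<Rightarrow> bool" where
  "regular_map_on X U Y f \<longleftrightarrow> openin (zariski X) U \<and> f ` U \<subseteq> pts Y \<and>
     (\<forall>c \<in> coords Y. regular_on X U (\<lambda>x. c (f x)))"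

lemma rational_map_iff:
  "rational_map X Y f \<longleftrightarrow>
     dense_open X (dom f) \<and> regular_map_on X (dom f) Y (\<lambda>x. the (f x))"
  unfolding rational_map_def regular_map_on_def dense_open_def ran_def dom_def by force

text \<open>
  Regularity is required of the coordinates only, but spreads to the whole coordinate ring.
\<close>

lemma regular_map_on_polyfun:
  assumes "regular_map_on X U Y f" "p \<in> polyfun (coords Y)"
  shows "regular_on X U (\<lambda>x. p (f x))"
  using assms(2)
proof induction
  case (const a)
  show ?case using assms(1) unfolding regular_map_on_def by (auto intro: regular_on_const)
next
  case (coord c)
  then show ?case using assms(1) unfolding regular_map_on_def by auto
qed (auto intro: regular_on_add regular_on_mult)

lemma regular_map_on_preimage:
  assumes f: "regular_map_on X U Y f" and V: "openin (zariski Y) V"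
  shows "openin (zariski X) {x \<in> U. f x \<in> V}"
proof -
  obtain P where P: "P \<subseteq> polyfun (coords Y)" "V = {x \<in> pts Y. \<exists>p\<in>P. p x \<noteq> 0}"
    using V unfolding openin_zariski by blast
  have "{x \<in> U. f x \<in> V} = (\<Union>p\<in>P. {x \<in> U. p (f x) \<noteq> 0})"
    using f unfolding P(2) regular_map_on_def by auto
  moreover have "openin (zariski X) {x \<in> U. p (f x) \<noteq> 0}" if "p \<in> P" for p
    using that P(1) f
    by (intro openin_regular_nonzero regular_map_on_polyfun[OF f]) (auto simp: regular_map_on_def)
  ultimately show ?thesis by auto
qed

lemma regular_map_on_pullback:
  assumes f: "regular_map_on X U Y f" and V: "openin (zariski Y) V" and h: "regular_on Y V h"
  shows "regular_on X {x \<in> U. f x \<in> V} (\<lambda>x. h (f x))"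
proof (rule regular_onI_local)
  fix x assume x: "x \<in> {x \<in> U. f x \<in> V}"
  then have "f x \<in> V" by simp
  obtain W p q where W: "openin (zariski Y) W" "f x \<in> W" "W \<subseteq> V"
    "p \<in> polyfun (coords Y)" "q \<in> polyfun (coords Y)"
    "\<forall>y\<in>W. q y \<noteq> 0 \<and> h y = p y / q y"
    by (rule regular_onE[OF h \<open>f x \<in> V\<close>])
  let ?W = "{x \<in> U. f x \<in> W}"
  have op: "openin (zariski X) ?W" by (rule regular_map_on_preimage[OF f W(1)])
  have "regular_on X ?W (\<lambda>x. p (f x) / q (f x))"
    by (intro regular_on_divide regular_on_subset[OF regular_map_on_polyfun[OF f] op]) (use W(3-6) in auto)
  then have "regular_on X ?W (\<lambda>x. h (f x))"
    by (rule regular_on_cong) (use W(6) in auto)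
  then show "\<exists>W. x \<in> W \<and> W \<subseteq> {x \<in> U. f x \<in> V} \<and> regular_on X W (\<lambda>x. h (f x))"
    using x W(2,3) by (intro exI[of _ ?W]) auto
qed

lemma regular_map_on_subset:
  assumes "regular_map_on X V Y f" "openin (zariski X) U" "U \<subseteq> V"
  shows "regular_map_on X U Y f"
  using assms unfolding regular_map_on_def by (auto intro: regular_on_subset)

lemma regular_map_on_cong:
  assumes "regular_map_on X U Y f" "\<And>x. x \<in> U \<Longrightarrow> g x = f x"
  shows "regular_map_on X U Y g"
proof -
  have "regular_on X U (\<lambda>x. c (g x))" if "c \<in> coords Y" for c
    by (rule regular_on_cong[of X U "\<lambda>x. c (f x)"])
      (use assms(1) that in \<open>auto simp: regular_map_on_def assms(2)\<close>)
  then show ?thesis using assms unfolding regular_map_on_def by (simp add: image_subset_iff)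
qed

lemma regular_map_on_compose:
  assumes f: "regular_map_on X U Y f" and g: "regular_map_on Y V Z g"
  shows "regular_map_on X {x \<in> U. f x \<in> V} Z (\<lambda>x. g (f x))"
proof -
  have V: "openin (zariski Y) V" using g unfolding regular_map_on_def by blast
  have "regular_on X {x \<in> U. f x \<in> V} (\<lambda>x. c (g (f x)))" if "c \<in> coords Z" for c
    using g that by (intro regular_map_on_pullback[OF f V]) (auto simp: regular_map_on_def)
  then show ?thesis
    using regular_map_on_preimage[OF f V] g unfolding regular_map_on_def by auto
qed

section \<open>Irreducibility from rational curves\<close>

definition irreducible_variety :: "'a variety \<Rightarrow> bool" where
  "irreducible_variety X \<longleftrightarrow>
     (\<forall>U V. openin (zariski X) U \<longrightarrow> openin (zariski X) V \<longrightarrow> U \<noteq> {} \<longrightarrow> V \<noteq> {} \<longrightarrow> U \<inter> V \<noteq> {})"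

text \<open>
  On an irreducible variety density costs nothing beyond a single witness, so each rational map below
  only needs one point in its domain.
\<close>

lemma dense_open_irreducible:
  assumes "irreducible_variety X" "pts X \<noteq> {}"
  shows "dense_open X V \<longleftrightarrow> openin (zariski X) V \<and> V \<noteq> {}"
proof
  assume "dense_open X V"
  then show "openin (zariski X) V \<and> V \<noteq> {}"
    using assms(2) unfolding dense_open_def by auto
next
  assume V: "openin (zariski X) V \<and> V \<noteq> {}"
  have "pts X \<subseteq> zariski X closure_of V"
  proof
    fix x assume "x \<in> pts X"
    then show "x \<in> zariski X closure_of V"
      using assms(1) V unfolding in_closure_of irreducible_variety_def topspace_zariski by blast
  qed
  then show "dense_open X V"
    using V closure_of_subset_topspace[of "zariski X" V] unfolding dense_open_def topspace_zariski by blast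
qed

definition rational_along :: "complex poly \<Rightarrow> (complex \<Rightarrow> complex) \<Rightarrow> bool" where
  "rational_along d f \<longleftrightarrow>
     (\<exists>P Q. \<forall>s. poly d s \<noteq> 0 \<longrightarrow> poly Q s \<noteq> 0 \<and> f s = poly P s / poly Q s)"

lemma rational_along_poly: "rational_along d (\<lambda>s. poly p s)"
  unfolding rational_along_def by (intro exI[of _ p] exI[of _ 1]) auto

lemma rational_along_add:
  assumes "rational_along d f" "rational_along d g"
  shows "rational_along d (\<lambda>s. f s + g s)"
proof -
  obtain P Q R S where *:
    "\<And>s. poly d s \<noteq> 0 \<Longrightarrow> poly Q s \<noteq> 0 \<and> f s = poly P s / poly Q s"
    "\<And>s. poly d s \<noteq> 0 \<Longrightarrow> poly S s \<noteq> 0 \<and> g s = poly R s / poly S s"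
    using assms unfolding rational_along_def by metis
  show ?thesis unfolding rational_along_def
    by (intro exI[of _ "P * S + R * Q"] exI[of _ "Q * S"])
      (use * in \<open>auto simp: field_simps\<close>)
qed

lemma rational_along_mult:
  assumes "rational_along d f" "rational_along d g"
  shows "rational_along d (\<lambda>s. f s * g s)"
proof -
  obtain P Q R S where *:
    "\<And>s. poly d s \<noteq> 0 \<Longrightarrow> poly Q s \<noteq> 0 \<and> f s = poly P s / poly Q s"
    "\<And>s. poly d s \<noteq> 0 \<Longrightarrow> poly S s \<noteq> 0 \<and> g s = poly R s / poly S s"
    using assms unfolding rational_along_def by metis
  show ?thesis unfolding rational_along_def
    by (intro exI[of _ "P * R"] exI[of _ "Q * S"]) (use * in auto)
qed

lemma rational_along_dvd:
  assumes "rational_along d f" "d dvd e"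
  shows "rational_along e f"
  using assms unfolding rational_along_def by (metis dvd_trans poly_eq_0_iff_dvd)

definition curve_in :: "'a variety \<Rightarrow> complex poly \<Rightarrow> (complex \<Rightarrow> 'a) \<Rightarrow> bool" where
  "curve_in X d z \<longleftrightarrow> (\<forall>s. poly d s \<noteq> 0 \<longrightarrow> z s \<in> pts X) \<and>
     (\<forall>c \<in> coords X. rational_along d (\<lambda>s. c (z s)))"

definition rationally_connected :: "'a variety \<Rightarrow> bool" where
  "rationally_connected X \<longleftrightarrow>
     (\<forall>x \<in> pts X. \<forall>y \<in> pts X. \<exists>d z. curve_in X d z \<and>
        poly d 0 \<noteq> 0 \<and> z 0 = x \<and> poly d 1 \<noteq> 0 \<and> z 1 = y)"

lemma curve_in_polyfun:
  assumes "curve_in X d z" "p \<in> polyfun (coords X)"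
  shows "rational_along d (\<lambda>s. p (z s))"
  using assms(2)
proof induction
  case (const a)
  show ?case using rational_along_poly[of d "[:a:]"] by simp
next
  case (coord c)
  then show ?case using assms(1) unfolding curve_in_def by auto
qed (auto intro: rational_along_add rational_along_mult)

lemma openin_zariski_witness:
  assumes "openin (zariski X) U" "x \<in> U"
  obtains p where "p \<in> polyfun (coords X)" "p x \<noteq> 0" "\<And>z. z \<in> pts X \<Longrightarrow> p z \<noteq> 0 \<Longrightarrow> z \<in> U"
proof -
  obtain P where P: "P \<subseteq> polyfun (coords X)" "U = {x \<in> pts X. \<exists>p\<in>P. p x \<noteq> 0}"
    using assms(1) unfolding openin_zariski by blast
  then obtain p where "p \<in> P" "p x \<noteq> 0" using assms(2) by blast
  then show thesis using that[of p] P by blast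
qed

text \<open>
  Two nonempty open sets contain points joined by a rational curve. The two polynomials that separate
  these points from the complements restrict to nonzero rational functions of the parameter, so only
  finitely many parameters have to be avoided to find a point of the curve in both sets.
\<close>

lemma rationally_connected_imp_irreducible:
  assumes "rationally_connected X"
  shows "irreducible_variety X"
  unfolding irreducible_variety_def
proof (intro allI impI)
  fix U V assume UV: "openin (zariski X) U" "openin (zariski X) V" "U \<noteq> {}" "V \<noteq> {}"
  then obtain x y where xy: "x \<in> U" "y \<in> V" by blast
  obtain p where p: "p \<in> polyfun (coords X)" "p x \<noteq> 0" "\<And>z. z \<in> pts X \<Longrightarrow> p z \<noteq> 0 \<Longrightarrow> z \<in> U"
    using openin_zariski_witness[OF UV(1) xy(1)] by blast
  obtain q where q: "q \<in> polyfun (coords X)" "q y \<noteq> 0" "\<And>z. z \<in> pts X \<Longrightarrow> q z \<noteq> 0 \<Longrightarrow> z \<in> V"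
    using openin_zariski_witness[OF UV(2) xy(2)] by blast
  have "x \<in> pts X" "y \<in> pts X" using UV xy openin_zariski_subset by blast+
  then obtain d z where z: "curve_in X d z" "poly d 0 \<noteq> 0" "z 0 = x" "poly d 1 \<noteq> 0" "z 1 = y"
    using assms unfolding rationally_connected_def by blast
  obtain P Q where P: "\<And>s. poly d s \<noteq> 0 \<Longrightarrow> poly Q s \<noteq> 0 \<and> p (z s) = poly P s / poly Q s"
    using curve_in_polyfun[OF z(1) p(1)] unfolding rational_along_def by metis
  obtain R S where R: "\<And>s. poly d s \<noteq> 0 \<Longrightarrow> poly S s \<noteq> 0 \<and> q (z s) = poly R s / poly S s"
    using curve_in_polyfun[OF z(1) q(1)] unfolding rational_along_def by metis
  have "poly P 0 \<noteq> 0" "poly R 1 \<noteq> 0"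
    using P[of 0] R[of 1] z p(2) q(2) by auto
  then have "d * P * R \<noteq> 0" using z(2) by auto
  then have "finite {s. poly (d * P * R) s = 0}" by (rule poly_roots_finite)
  then obtain s where "poly (d * P * R) s \<noteq> 0"
    using ex_new_if_finite[OF infinite_UNIV_char_0] by blast
  then have s: "poly d s \<noteq> 0" "poly P s \<noteq> 0" "poly R s \<noteq> 0" by auto
  then have "z s \<in> U \<inter> V"
    using p(3)[of "z s"] q(3)[of "z s"] P[of s] R[of s] z(1) unfolding curve_in_def by auto
  then show "U \<inter> V \<noteq> {}" by blast
qed

lemma pts_var_power: "xs \<in> pts (var_power X n) \<longleftrightarrow> length xs = n \<and> (\<forall>k<n. xs ! k \<in> pts X)"
  unfolding var_power_def by (auto simp: in_set_conv_nth subset_iff)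

lemma coords_var_power: "coords (var_power X n) = {\<lambda>xs. c (xs ! k) | c k. c \<in> coords X \<and> k < n}"
  unfolding var_power_def by simp

lemma coord_var_power:
  assumes "c \<in> coords X" "k < n"
  shows "(\<lambda>xs. c (xs ! k)) \<in> coords (var_power X n)"
  unfolding coords_var_power using assms by blast

text \<open>
  The curves in the factors share one parameter, and the denominators are multiplied.
\<close>

lemma rationally_connected_var_power:
  assumes "rationally_connected X"
  shows "rationally_connected (var_power X n)"
  unfolding rationally_connected_def
proof (intro ballI)
  fix xs ys assume xs: "xs \<in> pts (var_power X n)" and ys: "ys \<in> pts (var_power X n)"
  have "\<forall>k\<in>{..<n}. \<exists>dz. curve_in X (fst dz) (snd dz) \<and> poly (fst dz) 0 \<noteq> 0 \<and> snd dz 0 = xs ! k \<and>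
     poly (fst dz) 1 \<noteq> 0 \<and> snd dz 1 = ys ! k"
    using assms xs ys unfolding rationally_connected_def pts_var_power by simp
  then obtain dz where dz: "\<And>k. k < n \<Longrightarrow> curve_in X (fst (dz k)) (snd (dz k)) \<and>
     poly (fst (dz k)) 0 \<noteq> 0 \<and> snd (dz k) 0 = xs ! k \<and>
     poly (fst (dz k)) 1 \<noteq> 0 \<and> snd (dz k) 1 = ys ! k"
    by (metis lessThan_iff)
  define d where "d = (\<Prod>k<n. fst (dz k))"
  define z where "z s = map (\<lambda>k. snd (dz k) s) [0..<n]" for s
  have dvd: "fst (dz k) dvd d" if "k < n" for k
    unfolding d_def using that by (intro dvd_prodI) auto
  have "curve_in (var_power X n) d z"
    unfolding curve_in_def
  proof (intro conjI allI impI ballI)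
    fix s assume "poly d s \<noteq> 0"
    then have "poly (fst (dz k)) s \<noteq> 0" if "k < n" for k
      using that unfolding d_def poly_prod by simp
    then show "z s \<in> pts (var_power X n)"
      using dz unfolding pts_var_power z_def curve_in_def by simp
  next
    fix c assume "c \<in> coords (var_power X n)"
    then obtain c' k where c: "c' \<in> coords X" "k < n" "c = (\<lambda>xs. c' (xs ! k))"
      unfolding coords_var_power by blast
    have "rational_along (fst (dz k)) (\<lambda>s. c' (snd (dz k) s))"
      using dz[OF c(2)] c(1) unfolding curve_in_def by blast
    then show "rational_along d (\<lambda>s. c (z s))"
      using c dvd rational_along_dvd unfolding z_def by simp
  qed
  moreover have "poly d 0 \<noteq> 0" "poly d 1 \<noteq> 0"
    unfolding d_def poly_prod using dz by auto
  moreover have "z 0 = xs" "z 1 = ys"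
    unfolding z_def using dz xs ys by (auto intro!: nth_equalityI simp: pts_var_power)
  ultimately show "\<exists>d z. curve_in (var_power X n) d z \<and>
        poly d 0 \<noteq> 0 \<and> z 0 = xs \<and> poly d 1 \<noteq> 0 \<and> z 1 = ys"
    by blast
qed

section \<open>Pairs of mutually inverse rational maps\<close>

text \<open>
  Exact inverses, rather than inverses up to a dense open set, keep the domains of composites under
  control.
\<close>

definition mutually_inverse :: "('a \<rightharpoonup> 'b) \<Rightarrow> ('b \<rightharpoonup> 'a) \<Rightarrow> bool" where
  "mutually_inverse f g \<longleftrightarrow> (\<forall>x y. f x = Some y \<longleftrightarrow> g y = Some x)"

definition inverse_pair :: "'a variety \<Rightarrow> ('a \<rightharpoonup> 'a) \<Rightarrow> ('a \<rightharpoonup> 'a) \<Rightarrow> bool" where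
  "inverse_pair X f g \<longleftrightarrow> rational_map X X f \<and> rational_map X X g \<and> mutually_inverse f g"

lemma inverse_pair_sym: "inverse_pair X f g \<Longrightarrow> inverse_pair X g f"
  unfolding inverse_pair_def mutually_inverse_def by auto

lemma inverse_pair_birational:
  assumes "inverse_pair X f g"
  shows "birational_automorphism X f"
proof -
  have "rat_eq X (g \<circ>\<^sub>m f) Some"
    if "inverse_pair X f g" for f g :: "'a \<rightharpoonup> 'a"
    unfolding rat_eq_def
    by (intro exI[of _ "dom f"])
      (use that in \<open>auto simp: inverse_pair_def mutually_inverse_def rational_map_def map_comp_def
          split: option.splits\<close>)
  from this[OF assms] this[OF inverse_pair_sym[OF assms]] show ?thesis
    using assms unfolding birational_automorphism_def inverse_pair_def by blast
qed

lemma dom_map_comp: "dom (g \<circ>\<^sub>m f) = {x \<in> dom f. the (f x) \<in> dom g}"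
  by (auto simp: map_comp_def split: option.splits)

lemma rational_map_comp:
  assumes irr: "irreducible_variety X" and ne: "pts X \<noteq> {}"
    and f: "rational_map X Y f" and g: "rational_map Y Z g"
    and meet: "dom (g \<circ>\<^sub>m f) \<noteq> {}"
  shows "rational_map X Z (g \<circ>\<^sub>m f)"
proof -
  have "regular_map_on X {x \<in> dom f. the (f x) \<in> dom g} Z (\<lambda>x. the (g (the (f x))))"
    using f g unfolding rational_map_iff by (intro regular_map_on_compose) auto
  then have *: "regular_map_on X (dom (g \<circ>\<^sub>m f)) Z (\<lambda>x. the (g (the (f x))))"
    unfolding dom_map_comp .
  then have "regular_map_on X (dom (g \<circ>\<^sub>m f)) Z (\<lambda>x. the ((g \<circ>\<^sub>m f) x))"
    by (rule regular_map_on_cong) (auto simp: map_comp_Some_iff)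
  then show ?thesis
    unfolding rational_map_iff dense_open_irreducible[OF irr ne] using meet
    by (simp add: regular_map_on_def)
qed

text \<open>
  The domain of \<open>g \<circ>\<^sub>m f\<close> is nonempty without any argument about dominance: the dense sets
  \<open>dom f'\<close> and \<open>dom g\<close> share a point, and its image under \<open>f'\<close> lies in the domain of the composite.
\<close>

lemma inverse_pair_comp:
  assumes irr: "irreducible_variety X" and ne: "pts X \<noteq> {}"
    and f: "inverse_pair X f f'" and g: "inverse_pair X g g'"
  shows "inverse_pair X (g \<circ>\<^sub>m f) (f' \<circ>\<^sub>m g')"
proof -
  have dom: "dom (g \<circ>\<^sub>m f) \<noteq> {}"
    if f: "inverse_pair X f f'" and g: "inverse_pair X g g'" for f f' g g'
  proof -
    have "dom f' \<inter> dom g \<noteq> {}"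
      using irr f g unfolding inverse_pair_def rational_map_def dense_open_irreducible[OF irr ne]
        irreducible_variety_def by auto
    then obtain y x z where "f' y = Some x" "g y = Some z" by blast
    moreover then have "f x = Some y"
      using f unfolding inverse_pair_def mutually_inverse_def by auto
    ultimately have "x \<in> dom (g \<circ>\<^sub>m f)" by (auto simp: map_comp_def)
    then show ?thesis by blast
  qed
  have "mutually_inverse (g \<circ>\<^sub>m f) (f' \<circ>\<^sub>m g')"
    using f g unfolding inverse_pair_def mutually_inverse_def map_comp_Some_iff by blast
  then show ?thesis
    using f g dom[OF f g] dom[OF inverse_pair_sym[OF g] inverse_pair_sym[OF f]]
      rational_map_comp[OF irr ne] unfolding inverse_pair_def by blast
qed

text \<open>
  Composition with such a restricted identity cuts down the domain of another pair.
\<close>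

lemma inverse_pair_open_id:
  assumes "irreducible_variety X" "pts X \<noteq> {}" "openin (zariski X) W" "W \<noteq> {}"
  shows "inverse_pair X (Some |` W) (Some |` W)"
proof -
  have d: "dom (Some |` W) = W" by auto
  have "regular_on X W (\<lambda>x. c (the ((Some |` W) x)))" if "c \<in> coords X" for c
    using that assms(3)
    by (intro regular_on_cong[OF regular_on_polyfun[of c]] polyfun.coord) auto
  moreover have "ran (Some |` W) \<subseteq> pts X"
    using openin_zariski_subset[OF assms(3)] by (auto simp: ran_def restrict_map_def split: if_splits)
  ultimately have "rational_map X X (Some |` W)"
    unfolding rational_map_def d dense_open_irreducible[OF assms(1,2)] using assms(3,4) by auto
  then show ?thesis
    unfolding inverse_pair_def mutually_inverse_def by (auto simp: restrict_map_def split: if_splits)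
qed

text \<open>
  The points of \<open>U\<close> whose image lies in \<open>U\<close> again form an open set that \<open>f\<close> maps onto itself, which
  turns an involution with an unknown range into an exactly self-inverse partial map.
\<close>

lemma partial_involution_inverse_pair:
  assumes irr: "irreducible_variety X" "pts X \<noteq> {}" and f: "regular_map_on X U X f"
    and inv: "\<And>x. x \<in> U \<Longrightarrow> f x \<in> U \<Longrightarrow> f (f x) = x"
    and x0: "x0 \<in> U" "f x0 \<in> U"
  defines "F \<equiv> (Some \<circ> f) |` {x \<in> U. f x \<in> U}"
  shows "inverse_pair X F F"
proof -
  let ?D = "{x \<in> U. f x \<in> U}"
  have U: "openin (zariski X) U" using f unfolding regular_map_on_def by blast
  have D: "openin (zariski X) ?D" by (rule regular_map_on_preimage[OF f U])
  have dom: "dom F = ?D" unfolding F_def by auto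
  have "regular_map_on X ?D X (\<lambda>x. the (F x))"
    by (rule regular_map_on_cong[OF regular_map_on_subset[OF f D]]) (auto simp: F_def)
  then have "rational_map X X F"
    unfolding rational_map_iff dom dense_open_irreducible[OF irr] using D x0 by auto
  moreover have "mutually_inverse F F"
    unfolding mutually_inverse_def F_def using inv by (auto simp: restrict_map_def)
  ultimately show ?thesis unfolding inverse_pair_def by blast
qed

section \<open>Maps acting inside consecutive factors\<close>

lemma act_inside_eq_Some:
  assumes "k + r \<le> n"
  shows "act_inside X n k r f xs = Some ys \<longleftrightarrow>
    xs \<in> pts (var_power X n) \<and>
    (\<exists>zs. f (take r (drop k xs)) = Some zs \<and> ys = take k xs @ zs @ drop (k + r) xs)"
  unfolding act_inside_def by auto

text \<open>
  Selecting consecutive factors is a morphism, and every map acting inside them is regular because it is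
  a pullback along it.
\<close>

lemma window_regular:
  assumes "k + r \<le> n"
  shows "regular_map_on (var_power X n) (pts (var_power X n)) (var_power X r) (\<lambda>xs. take r (drop k xs))"
  unfolding regular_map_on_def
proof (intro conjI ballI)
  fix c assume "c \<in> coords (var_power X r)"
  then obtain c' j where c: "c' \<in> coords X" "j < r" "c = (\<lambda>xs. c' (xs ! j))"
    unfolding coords_var_power by blast
  show "regular_on (var_power X n) (pts (var_power X n)) (\<lambda>xs. c (take r (drop k xs)))"
  proof (rule regular_on_cong)
    show "regular_on (var_power X n) (pts (var_power X n)) (\<lambda>xs. c' (xs ! (k + j)))"
      using c assms
      by (intro regular_on_polyfun polyfun.coord openin_zariski_pts coord_var_power) auto
    fix xs assume "xs \<in> pts (var_power X n)"
    then show "c (take r (drop k xs)) = c' (xs ! (k + j))"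
      using c assms by (simp add: pts_var_power)
  qed
qed (use assms in \<open>auto simp: openin_zariski_pts pts_var_power\<close>)

lemma regular_on_factor_coord:
  assumes "c \<in> coords X" "k < n" "openin (zariski (var_power X n)) U"
  shows "regular_on (var_power X n) U (\<lambda>xs. c (xs ! k))"
  using assms by (intro regular_on_polyfun polyfun.coord coord_var_power)

lemma rational_map_act_inside:
  assumes irr: "irreducible_variety (var_power X n)" "pts X \<noteq> {}" and kr: "k + r \<le> n"
    and f: "rational_map (var_power X r) (var_power X r) f" and nef: "dom f \<noteq> {}"
  shows "rational_map (var_power X n) (var_power X n) (act_inside X n k r f)"
proof -
  let ?Xn = "var_power X n" and ?Xr = "var_power X r" and ?F = "act_inside X n k r f"
  obtain a where a: "a \<in> pts X" using irr(2) by blast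
  have dom: "dom ?F = {xs \<in> pts ?Xn. take r (drop k xs) \<in> dom f}"
    unfolding act_inside_def dom_def by (simp add: set_eq_iff)
  have fop: "openin (zariski ?Xr) (dom f)" "ran f \<subseteq> pts ?Xr"
    using f unfolding rational_map_def dense_open_def by auto
  have op: "openin (zariski ?Xn) (dom ?F)"
    unfolding dom by (rule regular_map_on_preimage[OF window_regular[OF kr] fop(1)])
  have val: "length (the (f (take r (drop k xs)))) = r \<and> (\<forall>j<r. the (f (take r (drop k xs))) ! j \<in> pts X)"
    if "xs \<in> dom ?F" for xs
  proof -
    obtain zs where "f (take r (drop k xs)) = Some zs" using \<open>xs \<in> dom ?F\<close> unfolding dom by blast
    moreover from this have "zs \<in> pts ?Xr" using fop(2) by (meson ranI subsetD)
    ultimately show ?thesis unfolding pts_var_power by simp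
  qed
  have len: "length xs = n" and inX: "\<And>j. j < n \<Longrightarrow> xs ! j \<in> pts X" if "xs \<in> dom ?F" for xs
    using that unfolding dom pts_var_power by blast+
  have Fval: "the (?F xs) = take k xs @ the (f (take r (drop k xs))) @ drop (k + r) xs"
    if "xs \<in> dom ?F" for xs
  proof -
    have "xs \<in> pts ?Xn" "f (take r (drop k xs)) \<noteq> None" using that unfolding dom by auto
    then show ?thesis by (auto simp: act_inside_def)
  qed
  have Fnth: "the (?F xs) ! j =
      (if j < k then xs ! j else if j < k + r then the (f (take r (drop k xs))) ! (j - k) else xs ! j)"
    if "xs \<in> dom ?F" "j < n" for xs j
    using that kr Fval[OF that(1)] len[OF that(1)] val[OF that(1)] by (auto simp: nth_append min_def)
  have Flen: "length (the (?F xs)) = n" if "xs \<in> dom ?F" for xs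
    using that kr Fval[OF that(1)] len[OF that(1)] val[OF that(1)] by (auto simp: min_def)
  obtain ys where ys: "ys \<in> dom f" using nef by blast
  then have ysX: "length ys = r" "\<forall>j<r. ys ! j \<in> pts X"
    using openin_zariski_subset[OF fop(1)] pts_var_power by blast+
  let ?xs = "replicate k a @ ys @ replicate (n - (k + r)) a"
  have "?xs \<in> dom ?F"
  proof -
    have "?xs \<in> pts ?Xn" using ysX a kr by (auto simp: pts_var_power nth_append)
    moreover have "take r (drop k ?xs) = ys" using ysX by simp
    ultimately show ?thesis unfolding dom using ys by simp
  qed
  then have ne: "dom ?F \<noteq> {}" by blast
  have neX: "pts ?Xn \<noteq> {}" using ne openin_zariski_subset[OF op] by blast
  have reg: "regular_on ?Xn (dom ?F) (\<lambda>xs. c (the (?F xs)))" if cX: "c \<in> coords ?Xn" for c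
  proof -
    obtain c' j where c: "c' \<in> coords X" "j < n" "c = (\<lambda>xs. c' (xs ! j))"
      using cX unfolding coords_var_power by blast
    show ?thesis
    proof (cases "j < k \<or> k + r \<le> j")
      case True
      then show ?thesis
        by (intro regular_on_cong[OF regular_on_factor_coord[OF c(1,2) op]]) (use c Fnth in auto)
    next
      case False
      have "(\<lambda>ys. c' (ys ! (j - k))) \<in> coords ?Xr"
        using False c by (intro coord_var_power) auto
      moreover have "\<forall>c \<in> coords ?Xr. regular_on ?Xr (dom f) (\<lambda>ys. c (the (f ys)))"
        using f unfolding rational_map_def by blast
      ultimately have "regular_on ?Xr (dom f) (\<lambda>ys. c' (the (f ys) ! (j - k)))"
        by (drule_tac bspec) auto
      then have "regular_on ?Xn (dom ?F) (\<lambda>xs. c' (the (f (take r (drop k xs))) ! (j - k)))"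
        unfolding dom by (rule regular_map_on_pullback[OF window_regular[OF kr] fop(1)])
      then show ?thesis
        by (rule regular_on_cong) (use c False Fnth in auto)
    qed
  qed
  have "ran ?F \<subseteq> pts ?Xn"
  proof
    fix ys assume "ys \<in> ran ?F"
    then obtain xs where xs: "?F xs = Some ys" by (auto simp: ran_def)
    then have d: "xs \<in> dom ?F" by auto
    show "ys \<in> pts ?Xn"
      using Fnth[OF d] Flen[OF d] inX[OF d] val[OF d] xs by (auto simp: pts_var_power)
  qed
  then show ?thesis
    unfolding rational_map_def dense_open_irreducible[OF irr(1) neX] using op ne reg by auto
qed

lemma inverse_pair_act_inside:
  assumes irr: "irreducible_variety (var_power X n)" "irreducible_variety (var_power X r)" "pts X \<noteq> {}"
    and kr: "k + r \<le> n" and f: "inverse_pair (var_power X r) f g"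
  shows "inverse_pair (var_power X n) (act_inside X n k r f) (act_inside X n k r g)"
proof -
  have neX: "pts (var_power X r) \<noteq> {}"
  proof -
    obtain a where "a \<in> pts X" using irr(3) by blast
    then have "replicate r a \<in> pts (var_power X r)" by (auto simp: pts_var_power)
    then show ?thesis by blast
  qed
  have dom: "dom f \<noteq> {}" "dom g \<noteq> {}"
    using f unfolding inverse_pair_def rational_map_def dense_open_irreducible[OF irr(2) neX] by auto
  have one: "act_inside X n k r g ys = Some xs"
    if inv: "inverse_pair (var_power X r) f g" and xs: "act_inside X n k r f xs = Some ys" for f g xs ys
  proof -
    obtain zs where zs: "xs \<in> pts (var_power X n)" "f (take r (drop k xs)) = Some zs"
      "ys = take k xs @ zs @ drop (k + r) xs"
      using xs unfolding act_inside_eq_Some[OF kr] by blast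
    have "zs \<in> pts (var_power X r)"
      using zs(2) inv unfolding inverse_pair_def rational_map_def by (auto simp: ran_def)
    then have len: "length zs = r" "\<forall>j<r. zs ! j \<in> pts X" "length xs = n"
      using zs(1) by (auto simp: pts_var_power)
    have "ys \<in> pts (var_power X n)"
      using zs(1,3) len kr by (auto simp: pts_var_power nth_append)
    moreover have "take r (drop k ys) = zs"
      using zs(3) len kr by simp
    moreover have "g zs = Some (take r (drop k xs))"
      using inv zs(2) unfolding inverse_pair_def mutually_inverse_def by auto
    moreover have "xs = take k ys @ take r (drop k xs) @ drop (k + r) ys"
      using zs(3) len kr by simp (metis append_take_drop_id drop_drop add.commute)
    ultimately show ?thesis unfolding act_inside_eq_Some[OF kr] by blast
  qed
  have "mutually_inverse (act_inside X n k r f) (act_inside X n k r g)"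
    unfolding mutually_inverse_def using one[OF f] one[OF inverse_pair_sym[OF f]] by blast
  then show ?thesis
    using f rational_map_act_inside[OF irr(1,3) kr] dom unfolding inverse_pair_def by blast
qed

section \<open>Matrices with simple spectrum\<close>

text \<open>
  Multiplying by the adjugate instead of an inverse makes this valid over any integral domain, in
  particular for matrices of polynomials, where it cancels a factor \<open>t - b\<close>.
\<close>

lemma det_nonzero_mult_left_zero:
  fixes C M :: "'a::idom mat"
  assumes C: "C \<in> carrier_mat n n" and M: "M \<in> carrier_mat n n"
    and CM: "C * M = 0\<^sub>m n n" and det: "det C \<noteq> 0"
  shows "M = 0\<^sub>m n n"
proof -
  have "det C \<cdot>\<^sub>m M = (adj_mat C * C) * M"
    using adj_mat[OF C] M by (simp add: mult_smult_assoc_mat[of _ n n])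
  also have "\<dots> = 0\<^sub>m n n"
    using adj_mat(1)[OF C] C M CM by (simp add: assoc_mult_mat[of _ n n _ n _ n])
  finally have eq: "det C \<cdot>\<^sub>m M = 0\<^sub>m n n" .
  show ?thesis
  proof (rule eq_matI)
    fix i j assume ij: "i < dim_row (0\<^sub>m n n :: 'a mat)" "j < dim_col (0\<^sub>m n n :: 'a mat)"
    then have "(det C \<cdot>\<^sub>m M) $$ (i, j) = 0" unfolding eq by simp
    then show "M $$ (i, j) = 0\<^sub>m n n $$ (i, j)" using ij M det by simp
  qed (use M in auto)
qed

lemma det_nonzero_mult_right_zero:
  fixes C M :: "'a::idom mat"
  assumes C: "C \<in> carrier_mat n n" and M: "M \<in> carrier_mat n n"
    and MC: "M * C = 0\<^sub>m n n" and det: "det C \<noteq> 0"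
  shows "M = 0\<^sub>m n n"
proof -
  have "C\<^sup>T * M\<^sup>T = 0\<^sub>m n n"
    using transpose_mult[OF M C] MC C M by simp
  then have "M\<^sup>T = 0\<^sub>m n n"
    using det_nonzero_mult_left_zero[of "C\<^sup>T" n "M\<^sup>T"] C M det by (simp add: det_transpose)
  then have "M = (0\<^sub>m n n)\<^sup>T" using transpose_transpose[of M] by simp
  then show ?thesis by (auto intro!: eq_matI)
qed

text \<open>
  Nonzero matrices take the role of eigenvectors, since the eigenvectors of interest come as columns or
  rows of spectral projectors.
\<close>

lemma eigenvalueI_left:
  fixes A M :: "complex mat"
  assumes A: "A \<in> carrier_mat n n" and M: "M \<in> carrier_mat n n" "M \<noteq> 0\<^sub>m n n"
    and eq: "A * M = k \<cdot>\<^sub>m M"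
  shows "eigenvalue A k"
proof (rule ccontr)
  assume "\<not> eigenvalue A k"
  then have d: "det (char_matrix A k) \<noteq> 0" using eigenvalue_det[OF A] by simp
  have "char_matrix A k * M = A * M + (- k) \<cdot>\<^sub>m M"
    using A M unfolding char_matrix_def
    by (simp add: add_mult_distrib_mat[of _ n n] mult_smult_assoc_mat[of _ n n])
  also have "\<dots> = 0\<^sub>m n n" unfolding eq using M by (intro eq_matI) auto
  finally show False
    using det_nonzero_mult_left_zero[OF _ M(1) _ d] A M(2) by simp
qed

lemma eigenvalueI_right:
  fixes A M :: "complex mat"
  assumes A: "A \<in> carrier_mat n n" and M: "M \<in> carrier_mat n n" "M \<noteq> 0\<^sub>m n n"
    and eq: "M * A = k \<cdot>\<^sub>m M"
  shows "eigenvalue A k"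
proof (rule ccontr)
  assume "\<not> eigenvalue A k"
  then have d: "det (char_matrix A k) \<noteq> 0" using eigenvalue_det[OF A] by simp
  have "M * char_matrix A k = M * A + (- k) \<cdot>\<^sub>m M"
    using A M unfolding char_matrix_def
    by (simp add: mult_add_distrib_mat[of _ n n] mult_smult_distrib[of _ n n _ n])
  also have "\<dots> = 0\<^sub>m n n" unfolding eq using M by (intro eq_matI) auto
  finally show False
    using det_nonzero_mult_right_zero[OF _ M(1) _ d] A M(2) by simp
qed

lemma pts_Ubar:
  "(b, l) \<in> pts (Ubar m) \<longleftrightarrow>
     b \<in> carrier_mat m m \<and> length l = m \<and> distinct l \<and> set l = spectrum b"
  unfolding Ubar_def by simp

text \<open>
  An \<open>m \<times> m\<close> matrix has at most \<open>m\<close> eigenvalues, so \<open>m\<close> different ones are all of them.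
\<close>

lemma in_UbarI:
  assumes "b \<in> carrier_mat m m" "length l = m" "distinct l" "\<And>\<nu>. \<nu> \<in> set l \<Longrightarrow> eigenvalue b \<nu>"
  shows "(b, l) \<in> pts (Ubar m)"
proof -
  have "set l \<subseteq> spectrum b" using assms(4) unfolding spectrum_def by auto
  then have "set l = spectrum b"
    using card_finite_spectrum[OF assms(1)] distinct_card[OF assms(3)] assms(2)
    by (intro card_seteq) auto
  then show ?thesis using assms unfolding pts_Ubar by simp
qed

text \<open>
  If \<open>ns\<close> lists all eigenvalues of \<open>A\<close> but one, then this is a nonzero multiple of the projector to
  the eigenspace of the missing one. It is left without its normalizing factor in order to be polynomial
  in \<open>A\<close> and \<open>ns\<close>.
\<close>

definition shifted_prod :: "complex mat \<Rightarrow> complex list \<Rightarrow> complex mat" where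
  "shifted_prod A ns = foldr (\<lambda>\<nu> M. (A - \<nu> \<cdot>\<^sub>m 1\<^sub>m (dim_row A)) * M) ns (1\<^sub>m (dim_row A))"

lemma shifted_prod_carrier: "A \<in> carrier_mat m m \<Longrightarrow> shifted_prod A ns \<in> carrier_mat m m"
  unfolding shifted_prod_def by (induction ns) (auto intro!: mult_carrier_mat[of _ m m])

lemma shifted_prod_Cons:
  "A \<in> carrier_mat m m \<Longrightarrow> shifted_prod A (\<nu> # ns) = (A - \<nu> \<cdot>\<^sub>m 1\<^sub>m m) * shifted_prod A ns"
  unfolding shifted_prod_def by simp

lemma shifted_prod_Nil: "A \<in> carrier_mat m m \<Longrightarrow> shifted_prod A [] = 1\<^sub>m m"
  unfolding shifted_prod_def by simp

lemma shifted_prod_intertwine: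
  assumes A: "A \<in> carrier_mat m m" and B: "B \<in> carrier_mat m m" and S: "S \<in> carrier_mat m m"
    and eq: "A * S = S * B"
  shows "shifted_prod A ns * S = S * shifted_prod B ns"
proof (induction ns)
  case Nil
  then show ?case using A B S by (simp add: shifted_prod_Nil)
next
  case (Cons \<nu> ns)
  note c = shifted_prod_carrier[OF A, of ns] shifted_prod_carrier[OF B, of ns]
  have sh: "(A - \<nu> \<cdot>\<^sub>m 1\<^sub>m m) * S = S * (B - \<nu> \<cdot>\<^sub>m 1\<^sub>m m)"
    using A B S eq by (simp add: minus_mult_distrib_mat[of _ m m] mult_minus_distrib_mat[of _ m m]
        mult_smult_assoc_mat[of _ m m] mult_smult_distrib[of _ m m _ m])
  have cA: "A - \<nu> \<cdot>\<^sub>m 1\<^sub>m m \<in> carrier_mat m m" and cB: "B - \<nu> \<cdot>\<^sub>m 1\<^sub>m m \<in> carrier_mat m m"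
    using A B by auto
  have "shifted_prod A (\<nu> # ns) * S = (A - \<nu> \<cdot>\<^sub>m 1\<^sub>m m) * (shifted_prod A ns * S)"
    unfolding shifted_prod_Cons[OF A] by (rule assoc_mult_mat[OF cA c(1) S])
  also have "\<dots> = ((A - \<nu> \<cdot>\<^sub>m 1\<^sub>m m) * S) * shifted_prod B ns"
    unfolding Cons by (rule assoc_mult_mat[OF cA S c(2), symmetric])
  also have "\<dots> = S * shifted_prod B (\<nu> # ns)"
    unfolding sh shifted_prod_Cons[OF B] by (rule assoc_mult_mat[OF S cB c(2)])
  finally show ?case .
qed

lemma shifted_prod_diag:
  "shifted_prod (mat_diag m f) ns = mat_diag m (\<lambda>i. \<Prod>\<nu>\<leftarrow>ns. f i - \<nu>)"
proof (induction ns)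
  case Nil
  then show ?case by (simp add: shifted_prod_Nil[of _ m])
next
  case (Cons \<nu> ns)
  have "mat_diag m f - \<nu> \<cdot>\<^sub>m 1\<^sub>m m = mat_diag m (\<lambda>i. f i - \<nu>)"
    by (intro eq_matI) (auto simp: mat_diag_def)
  then show ?case using Cons by (simp add: shifted_prod_Cons[of _ m])
qed

lemma prod_list_shift_eq_0: "(\<Prod>\<nu>\<leftarrow>ns. x - \<nu>) = 0 \<longleftrightarrow> (x :: complex) \<in> set ns"
  by (induction ns) auto

text \<open>
  The columns of \<open>S\<close> are eigenvectors in the given order. They are independent: if \<open>S c = 0\<close>, then
  applying the product of \<open>b - \<nu>\<close> over the eigenvalues \<open>\<nu>\<close> other than the \<open>k\<close>-th one annihilates
  every column but the \<open>k\<close>-th, so that \<open>c\<^sub>k\<close> times this column vanishes.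
\<close>

lemma Ubar_diagonalize:
  assumes bl: "(b, l) \<in> pts (Ubar m)"
  obtains S T where "S \<in> carrier_mat m m" "T \<in> carrier_mat m m" "S * T = 1\<^sub>m m" "T * S = 1\<^sub>m m"
    "b = S * mat_diag m ((!) l) * T"
proof -
  have b: "b \<in> carrier_mat m m" and l: "length l = m" "distinct l" "set l = spectrum b"
    using bl unfolding pts_Ubar by auto
  have "\<exists>v. eigenvector b v (l ! i)" if "i < m" for i
    using that l nth_mem unfolding spectrum_def eigenvalue_def by blast
  then obtain v where v: "\<And>i. i < m \<Longrightarrow> eigenvector b (v i) (l ! i)" by metis
  define S where "S = Matrix.mat m m (\<lambda>(i, j). v j $ i)"
  let ?D = "mat_diag m ((!) l)"
  have S: "S \<in> carrier_mat m m" unfolding S_def by simp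
  have vc: "v j \<in> carrier_vec m" "v j \<noteq> 0\<^sub>v m" "b *\<^sub>v v j = l ! j \<cdot>\<^sub>v v j" if "j < m" for j
    using v[OF that] b unfolding eigenvector_def by auto
  have colS: "col S j = v j" if "j < m" for j
    using vc(1)[OF that] that unfolding S_def by (intro eq_vecI) auto
  have bS: "b * S = S * ?D"
  proof (rule eq_matI)
    fix i j assume "i < dim_row (S * ?D)" "j < dim_col (S * ?D)"
    then have ij: "i < m" "j < m" using S by (auto simp: mat_diag_def)
    have "(b * S) $$ (i, j) = (b *\<^sub>v v j) $ i" using ij b S colS by simp
    also have "\<dots> = S $$ (i, j) * l ! j"
      using ij vc[OF ij(2)] unfolding S_def by simp
    finally show "(b * S) $$ (i, j) = (S * ?D) $$ (i, j)"
      using ij unfolding mat_diag_mult_right[OF S] by simp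
  qed (use b S in \<open>auto simp: mat_diag_def\<close>)
  have "det S \<noteq> 0"
  proof
    assume "det S = 0"
    then obtain c where c: "c \<in> carrier_vec m" "c \<noteq> 0\<^sub>v m" "S *\<^sub>v c = 0\<^sub>v m"
      using det_0_iff_vec_prod_zero[OF S] by blast
    then obtain k where k: "k < m" "c $ k \<noteq> 0" by (metis carrier_vecD eq_vecI index_zero_vec)
    define ns where "ns = remove1 (l ! k) l"
    define h where "h i = (\<Prod>\<nu>\<leftarrow>ns. l ! i - \<nu>)" for i
    have h: "h i = 0 \<longleftrightarrow> i \<noteq> k" if "i < m" for i
      using that k l(1,2) unfolding h_def prod_list_shift_eq_0 ns_def
      by (simp add: set_remove1_eq nth_eq_iff_index_eq)
    have "(S * mat_diag m h) *\<^sub>v c = (shifted_prod b ns * S) *\<^sub>v c"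
      using shifted_prod_intertwine[OF b mat_diag_dim S bS, of ns]
      unfolding shifted_prod_diag h_def by simp
    also have "\<dots> = shifted_prod b ns *\<^sub>v (S *\<^sub>v c)"
      by (rule assoc_mult_mat_vec[OF shifted_prod_carrier[OF b] S c(1)])
    also have "\<dots> = 0\<^sub>v m"
      unfolding c(3) using shifted_prod_carrier[OF b, of ns] by (intro eq_vecI) auto
    finally have z: "(S * mat_diag m h) *\<^sub>v c = 0\<^sub>v m" .
    have "v k $ i = 0" if i: "i < m" for i
    proof -
      have "0 = ((S * mat_diag m h) *\<^sub>v c) $ i" unfolding z using i by simp
      also have "\<dots> = (\<Sum>j\<in>{0..<m}. v j $ i * h j * c $ j)"
        unfolding mat_diag_mult_right[OF S] using i c(1)
        by (auto simp: scalar_prod_def S_def intro!: sum.cong)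
      also have "\<dots> = (\<Sum>j\<in>{0..<m}. if j = k then v k $ i * h k * c $ k else 0)"
        using h by (intro sum.cong) auto
      also have "\<dots> = v k $ i * h k * c $ k" using k by simp
      finally show ?thesis using h[OF k(1)] k by simp
    qed
    then have "v k = 0\<^sub>v m" using vc(1)[OF k(1)] by (intro eq_vecI) auto
    then show False using vc(2)[OF k(1)] by blast
  qed
  define T where "T = (1 / det S) \<cdot>\<^sub>m adj_mat S"
  have T: "T \<in> carrier_mat m m" unfolding T_def using adj_mat(1)[OF S] by simp
  have ST: "S * T = 1\<^sub>m m" "T * S = 1\<^sub>m m"
    unfolding T_def using adj_mat[OF S] S \<open>det S \<noteq> 0\<close>
    by (simp_all add: mult_smult_assoc_mat[of _ m m] mult_smult_distrib[of _ m m _ m])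
      (auto intro!: eq_matI)
  have "b = b * (S * T)" using ST b by simp
  also have "\<dots> = S * ?D * T"
    unfolding bS[symmetric] using b S T by (simp add: assoc_mult_mat[of _ m m _ m _ m])
  finally show thesis using that S T ST by blast
qed

lemma conj_mult:
  fixes S T A B :: "'a::comm_ring_1 mat"
  assumes "S \<in> carrier_mat m m" "T \<in> carrier_mat m m" "A \<in> carrier_mat m m" "B \<in> carrier_mat m m"
    and "T * S = 1\<^sub>m m"
  shows "(S * A * T) * (S * B * T) = S * (A * B) * T"
proof -
  have "(S * A * T) * (S * B * T) = S * A * ((T * S) * (B * T))"
    using assms(1-4) by (simp add: assoc_mult_mat[of _ m m _ m _ m])
  also have "\<dots> = S * (A * B) * T"
    unfolding assms(5) using assms(1-4) by (simp add: assoc_mult_mat[of _ m m _ m _ m])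
  finally show ?thesis .
qed

lemma conj_cancel:
  fixes S T A :: "'a::comm_ring_1 mat"
  assumes "S \<in> carrier_mat m m" "T \<in> carrier_mat m m" "A \<in> carrier_mat m m" "T * S = 1\<^sub>m m"
  shows "T * (S * A * T) * S = A"
proof -
  have "T * (S * A * T) * S = (T * S) * A * (T * S)"
    using assms(1-3) by (simp add: assoc_mult_mat[of _ m m _ m _ m])
  then show ?thesis using assms by simp
qed

lemma conj_intertwine:
  fixes S T A :: "'a::comm_ring_1 mat"
  assumes "S \<in> carrier_mat m m" "T \<in> carrier_mat m m" "A \<in> carrier_mat m m" "T * S = 1\<^sub>m m"
  shows "(S * A * T) * S = S * A"
proof -
  have "(S * A * T) * S = S * A * (T * S)"
    using assms(1-3) by (simp add: assoc_mult_mat[of _ m m _ m _ m])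
  also have "\<dots> = S * A"
    unfolding assms(4) by (rule right_mult_one_mat[OF mult_carrier_mat[OF assms(1,3)]])
  finally show ?thesis .
qed

lemma diag_conj_in_Ubar:
  assumes S: "S \<in> carrier_mat m m" and T: "T \<in> carrier_mat m m"
    and ST: "S * T = 1\<^sub>m m" "T * S = 1\<^sub>m m" and l: "length l = m" "distinct l"
  shows "(S * mat_diag m ((!) l) * T, l) \<in> pts (Ubar m)"
proof (rule in_UbarI)
  let ?b = "S * mat_diag m ((!) l) * T"
  show b: "?b \<in> carrier_mat m m"
    using S T by (intro mult_carrier_mat[of _ m m] mat_diag_dim)
  fix \<nu> assume "\<nu> \<in> set l"
  then obtain k where k: "k < m" "l ! k = \<nu>" using l by (auto simp: in_set_conv_nth)
  let ?E = "mat_diag m (\<lambda>i. if i = k then 1 else (0 :: complex))"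
  have "mat_diag m ((!) l) * ?E = \<nu> \<cdot>\<^sub>m ?E"
    using k unfolding mat_diag_diag by (intro eq_matI) (auto simp: mat_diag_def)
  then have "?b * (S * ?E * T) = \<nu> \<cdot>\<^sub>m (S * ?E * T)"
    using S T unfolding conj_mult[OF S T mat_diag_dim mat_diag_dim ST(2)]
    by (simp add: mult_smult_assoc_mat[of _ m m] mult_smult_distrib[of _ m m _ m])
  moreover have "S * ?E * T \<noteq> 0\<^sub>m m m"
  proof
    assume "S * ?E * T = 0\<^sub>m m m"
    then have "?E = 0\<^sub>m m m" using conj_cancel[OF S T mat_diag_dim ST(2), of "\<lambda>i. if i = k then 1 else 0"] S T by simp
    then have "?E $$ (k, k) = 0" using k by simp
    then show False using k by (simp add: mat_diag_def)
  qed
  moreover have "S * ?E * T \<in> carrier_mat m m"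
    using S T by (intro mult_carrier_mat[of _ m m] mat_diag_dim)
  ultimately show "eigenvalue ?b \<nu>" using eigenvalueI_left[OF b] by blast
qed (use l in auto)

lemma shifted_prod_conj:
  assumes S: "S \<in> carrier_mat m m" and T: "T \<in> carrier_mat m m"
    and ST: "S * T = 1\<^sub>m m" "T * S = 1\<^sub>m m" and b: "b = S * mat_diag m f * T"
  shows "shifted_prod b ns = S * mat_diag m (\<lambda>i. \<Prod>\<nu>\<leftarrow>ns. f i - \<nu>) * T"
proof -
  have bc: "b \<in> carrier_mat m m" unfolding b
    using S T by (intro mult_carrier_mat[of _ m m] mat_diag_dim)
  note P = shifted_prod_carrier[OF bc, of ns]
  have "b * S = S * mat_diag m f"
    unfolding b by (rule conj_intertwine[OF S T mat_diag_dim ST(2)])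
  then have *: "shifted_prod b ns * S = S * mat_diag m (\<lambda>i. \<Prod>\<nu>\<leftarrow>ns. f i - \<nu>)"
    using shifted_prod_intertwine[OF bc mat_diag_dim S] unfolding shifted_prod_diag by blast
  have "shifted_prod b ns = shifted_prod b ns * (S * T)" using P ST by simp
  also have "\<dots> = S * mat_diag m (\<lambda>i. \<Prod>\<nu>\<leftarrow>ns. f i - \<nu>) * T"
    unfolding *[symmetric] using P S T by (simp add: assoc_mult_mat[of _ m m _ m _ m])
  finally show ?thesis .
qed

text \<open>
  In an eigenbasis \<open>P\<close> is diagonal with a single nonzero entry, at position \<open>k\<close>. Rank one is
  expressed by the factorization of the entries.
\<close>

lemma shifted_prod_projector:
  assumes bl: "(b, l) \<in> pts (Ubar m)" and k: "k < m" and ns: "set ns = set l - {l ! k}"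
  defines "P \<equiv> shifted_prod b ns"
  shows "b * P = l ! k \<cdot>\<^sub>m P" "P * b = l ! k \<cdot>\<^sub>m P" "P \<noteq> 0\<^sub>m m m"
    "\<exists>u w. \<forall>i<m. \<forall>j<m. P $$ (i, j) = u i * w j"
proof -
  have b: "b \<in> carrier_mat m m" and l: "length l = m" "distinct l" "set l = spectrum b"
    using bl unfolding pts_Ubar by auto
  obtain S T where S: "S \<in> carrier_mat m m" and T: "T \<in> carrier_mat m m"
    and ST: "S * T = 1\<^sub>m m" "T * S = 1\<^sub>m m" and bST: "b = S * mat_diag m ((!) l) * T"
    using Ubar_diagonalize[OF bl] by blast
  define h where "h i = (\<Prod>\<nu>\<leftarrow>ns. l ! i - \<nu>)" for i
  have h: "h i = 0 \<longleftrightarrow> i \<noteq> k" if "i < m" for i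
    using that k l(1,2) ns unfolding h_def prod_list_shift_eq_0
    by (simp add: nth_eq_iff_index_eq)
  have P: "P = S * mat_diag m h * T"
    unfolding P_def h_def by (rule shifted_prod_conj[OF S T ST bST])
  have "mat_diag m ((!) l) * mat_diag m h = l ! k \<cdot>\<^sub>m mat_diag m h"
    "mat_diag m h * mat_diag m ((!) l) = l ! k \<cdot>\<^sub>m mat_diag m h"
    using h unfolding mat_diag_diag by (auto intro!: eq_matI simp: mat_diag_def)
  then show "b * P = l ! k \<cdot>\<^sub>m P" "P * b = l ! k \<cdot>\<^sub>m P"
    using S T unfolding P bST conj_mult[OF S T mat_diag_dim mat_diag_dim ST(2)]
    by (simp_all add: mult_smult_assoc_mat[of _ m m] mult_smult_distrib[of _ m m _ m])
  show "P \<noteq> 0\<^sub>m m m"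
  proof
    assume "P = 0\<^sub>m m m"
    then have "mat_diag m h = 0\<^sub>m m m" using conj_cancel[OF S T mat_diag_dim ST(2), of h] S T P by simp
    then have "mat_diag m h $$ (k, k) = 0" using k by simp
    then show False using k h by (simp add: mat_diag_def)
  qed
  have "P $$ (i, j) = S $$ (i, k) * (h k * T $$ (k, j))" if ij: "i < m" "j < m" for i j
  proof -
    have "P $$ (i, j) = (\<Sum>a\<in>{0..<m}. S $$ (i, a) * h a * T $$ (a, j))"
      unfolding P mat_diag_mult_right[OF S] using ij S T
      by (auto simp: scalar_prod_def intro!: sum.cong)
    also have "\<dots> = (\<Sum>a\<in>{0..<m}. if a = k then S $$ (i, k) * h k * T $$ (k, j) else 0)"
      using h by (intro sum.cong) auto
    finally show ?thesis using k by simp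
  qed
  then show "\<exists>u w. \<forall>i<m. \<forall>j<m. P $$ (i, j) = u i * w j"
    by (intro exI[of _ "\<lambda>i. S $$ (i, k)"] exI[of _ "\<lambda>j. h k * T $$ (k, j)"]) simp
qed

text \<open>
  Together the two products contain every factor of the characteristic polynomial, so this is the
  Cayley-Hamilton theorem for simple spectrum.
\<close>

lemma shifted_prod_orthogonal:
  assumes bl: "(b, l) \<in> pts (Ubar m)"
    and ns: "set l \<subseteq> set ns \<union> set ns'"
  shows "shifted_prod b ns * shifted_prod b ns' = 0\<^sub>m m m"
proof -
  have l: "length l = m" using bl unfolding pts_Ubar by auto
  obtain S T where S: "S \<in> carrier_mat m m" and T: "T \<in> carrier_mat m m"
    and ST: "S * T = 1\<^sub>m m" "T * S = 1\<^sub>m m" and bST: "b = S * mat_diag m ((!) l) * T"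
    using Ubar_diagonalize[OF bl] by blast
  have "(\<Prod>\<nu>\<leftarrow>ns. l ! i - \<nu>) = 0 \<or> (\<Prod>\<nu>\<leftarrow>ns'. l ! i - \<nu>) = 0" if "i < m" for i
    using ns that l nth_mem[of i l] unfolding prod_list_shift_eq_0 by blast
  then have "mat_diag m (\<lambda>i. (\<Prod>\<nu>\<leftarrow>ns. l ! i - \<nu>)) * mat_diag m (\<lambda>i. (\<Prod>\<nu>\<leftarrow>ns'. l ! i - \<nu>)) = 0\<^sub>m m m"
    unfolding mat_diag_diag by (intro eq_matI) (auto simp: mat_diag_def)
  then show ?thesis
    unfolding shifted_prod_conj[OF S T ST bST] conj_mult[OF S T mat_diag_dim mat_diag_dim ST(2)]
    using S T by simp
qed

lemma inverse_mat_unique: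
  fixes S T T' :: "'a::comm_ring_1 mat"
  assumes "S \<in> carrier_mat m m" "T \<in> carrier_mat m m" "T' \<in> carrier_mat m m"
    and "T * S = 1\<^sub>m m" "S * T' = 1\<^sub>m m"
  shows "T = T'"
proof -
  have "T = T * (S * T')" using assms by simp
  also have "\<dots> = (T * S) * T'" using assms(1-3) by (simp add: assoc_mult_mat[of _ m m _ m _ m])
  finally show ?thesis using assms by simp
qed

definition eval_mat :: "complex \<Rightarrow> complex poly mat \<Rightarrow> complex mat" where
  "eval_mat s = map_mat (\<lambda>p. poly p s)"

lemma eval_mat_carrier: "A \<in> carrier_mat n m \<Longrightarrow> eval_mat s A \<in> carrier_mat n m"
  unfolding eval_mat_def by simp

lemma eval_mat_mult:
  assumes "A \<in> carrier_mat n m" "B \<in> carrier_mat m k"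
  shows "eval_mat s (A * B) = eval_mat s A * eval_mat s B"
proof -
  have "semiring_hom (\<lambda>p :: complex poly. poly p s)" by unfold_locales auto
  from semiring_hom.mat_hom_mult[OF this assms] show ?thesis unfolding eval_mat_def .
qed

lemma det_eval_mat: "det (eval_mat s A) = poly (det A) s"
proof -
  have "comm_ring_hom (\<lambda>p :: complex poly. poly p s)" by unfold_locales auto
  from comm_ring_hom.hom_det[OF this] show ?thesis unfolding eval_mat_def .
qed

text \<open>
  The map \<open>(S, l) \<mapsto> (S diag(l) S\<^sup>-\<^sup>1, l)\<close> is onto, and its source is open in an affine space, where
  points are joined by lines. Along the line the inverse of \<open>S\<close> is the adjugate divided by the
  determinant, so the entries of the matrix are quotients of polynomials in the parameter.
\<close>

lemma rationally_connected_Ubar: "rationally_connected (Ubar m)"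
  unfolding rationally_connected_def
proof (intro ballI)
  fix x y assume xy: "x \<in> pts (Ubar m)" "y \<in> pts (Ubar m)"
  obtain b l b' l' where x: "x = (b, l)" and y: "y = (b', l')" by fastforce
  have bl: "(b, l) \<in> pts (Ubar m)" "(b', l') \<in> pts (Ubar m)" using xy x y by auto
  then have l: "length l = m" "distinct l" "length l' = m" "distinct l'" unfolding pts_Ubar by auto
  obtain S T where S: "S \<in> carrier_mat m m" and T: "T \<in> carrier_mat m m"
    and ST: "S * T = 1\<^sub>m m" "T * S = 1\<^sub>m m" and bST: "b = S * mat_diag m ((!) l) * T"
    using Ubar_diagonalize[OF bl(1)] by blast
  obtain S' T' where S': "S' \<in> carrier_mat m m" and T': "T' \<in> carrier_mat m m"
    and ST': "S' * T' = 1\<^sub>m m" "T' * S' = 1\<^sub>m m" and bST': "b' = S' * mat_diag m ((!) l') * T'"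
    using Ubar_diagonalize[OF bl(2)] by blast
  define G where "G = Matrix.mat m m (\<lambda>(i, j). [:S $$ (i, j), S' $$ (i, j) - S $$ (i, j):])"
  define r where "r i = [:l ! i, l' ! i - l ! i:]" for i
  define N where "N = G * mat_diag m r * adj_mat G"
  define I where "I = {(i, j). i < m \<and> j < m \<and> i \<noteq> j}"
  \<comment> \<open>Its zeros are the parameters at which \<open>G\<close> is singular or two eigenvalues collide.\<close>
  define d where "d = det G * (\<Prod>(i, j)\<in>I. r i - r j)"
  define L where "L s = map (\<lambda>i. poly (r i) s) [0..<m]" for s
  define B where "B s = (1 / poly (det G) s) \<cdot>\<^sub>m eval_mat s N" for s
  define z where "z s = (B s, L s)" for s
  have I: "finite I" by (rule finite_subset[of _ "{..<m} \<times> {..<m}"]) (auto simp: I_def)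
  have G: "G \<in> carrier_mat m m" unfolding G_def by simp
  note aG = adj_mat[OF G]
  note evc = eval_mat_carrier and ev_mult = eval_mat_mult and ev_det = det_eval_mat
  have Ns: "eval_mat s N = eval_mat s G * mat_diag m (\<lambda>i. poly (r i) s) * eval_mat s (adj_mat G)" for s
  proof -
    have "eval_mat s (mat_diag m r) = mat_diag m (\<lambda>i. poly (r i) s)"
      unfolding eval_mat_def by (intro eq_matI) (auto simp: mat_diag_def)
    then show ?thesis
      unfolding N_def ev_mult[OF mult_carrier_mat[OF G mat_diag_dim] aG(1)] ev_mult[OF G mat_diag_dim]
      by simp
  qed
  have aGs: "eval_mat s G * eval_mat s (adj_mat G) = poly (det G) s \<cdot>\<^sub>m 1\<^sub>m m"
    "eval_mat s (adj_mat G) * eval_mat s G = poly (det G) s \<cdot>\<^sub>m 1\<^sub>m m" for s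
  proof -
    have "eval_mat s (det G \<cdot>\<^sub>m 1\<^sub>m m) = poly (det G) s \<cdot>\<^sub>m 1\<^sub>m m"
      unfolding eval_mat_def by (intro eq_matI) auto
    then show "eval_mat s G * eval_mat s (adj_mat G) = poly (det G) s \<cdot>\<^sub>m 1\<^sub>m m"
      "eval_mat s (adj_mat G) * eval_mat s G = poly (det G) s \<cdot>\<^sub>m 1\<^sub>m m"
      using aG G by (simp_all add: ev_mult[OF G aG(1), symmetric] ev_mult[OF aG(1) G, symmetric])
  qed
  define U where "U s = (1 / poly (det G) s) \<cdot>\<^sub>m eval_mat s (adj_mat G)" for s
  have U: "U s \<in> carrier_mat m m" for s unfolding U_def using evc[OF aG(1)] by simp
  have GU: "eval_mat s G * U s = 1\<^sub>m m" "U s * eval_mat s G = 1\<^sub>m m" if "poly (det G) s \<noteq> 0" for s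
    unfolding U_def using that evc[OF aG(1), of s] evc[OF G, of s] aGs[of s]
    by (simp_all add: mult_smult_assoc_mat[of _ m m] mult_smult_distrib[of _ m m _ m])
      (auto intro!: eq_matI)
  have BU: "B s = eval_mat s G * mat_diag m ((!) (L s)) * U s" for s
  proof -
    have "mat_diag m ((!) (L s)) = mat_diag m (\<lambda>i. poly (r i) s)"
      unfolding L_def by (intro eq_matI) (auto simp: mat_diag_def)
    moreover have "eval_mat s G * mat_diag m (\<lambda>i. poly (r i) s) \<in> carrier_mat m m"
      using evc[OF G, of s] by (intro mult_carrier_mat[of _ m m] mat_diag_dim)
    ultimately show ?thesis unfolding B_def Ns U_def using evc[OF aG(1), of s]
      by (simp add: mult_smult_distrib[of _ m m _ m])
  qed
  have "curve_in (Ubar m) d z"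
    unfolding curve_in_def
  proof (intro conjI allI impI ballI)
    fix s assume "poly d s \<noteq> 0"
    then have ds: "poly (det G) s \<noteq> 0" "\<And>i j. i < m \<Longrightarrow> j < m \<Longrightarrow> i \<noteq> j \<Longrightarrow> poly (r i) s \<noteq> poly (r j) s"
      using I unfolding d_def by (auto simp: poly_prod I_def)
    have "distinct (L s)" unfolding L_def distinct_conv_nth using ds(2) by simp
    then show "z s \<in> pts (Ubar m)"
      unfolding z_def BU using GU[OF ds(1)] U evc[OF G] by (intro diag_conj_in_Ubar) (auto simp: L_def)
  next
    fix c assume "c \<in> coords (Ubar m)"
    then consider (mat) i j where "i < m" "j < m" "c = (\<lambda>(b, l). b $$ (i, j))"
      | (eig) i where "i < m" "c = (\<lambda>(b, l). l ! i)"
      unfolding Ubar_def by auto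
    then show "rational_along d (\<lambda>s. c (z s))"
    proof cases
      case mat
      have "N \<in> carrier_mat m m"
        unfolding N_def using G aG(1) by (intro mult_carrier_mat[of _ m m] mat_diag_dim)
      then have "c (z s) = poly (N $$ (i, j)) s / poly (det G) s" for s
        using mat unfolding z_def B_def eval_mat_def by simp
      then show ?thesis unfolding rational_along_def
        by (intro exI[of _ "N $$ (i, j)"] exI[of _ "det G"]) (auto simp: d_def)
    next
      case eig
      then have "(\<lambda>s. c (z s)) = poly (r i)" unfolding z_def L_def by auto
      then show ?thesis using rational_along_poly[of d "r i"] by simp
    qed
  qed
  moreover have ends: "eval_mat 0 G = S" "eval_mat 1 G = S'" "L 0 = l" "L 1 = l'"
    unfolding eval_mat_def G_def L_def r_def using S S' l
    by (auto intro!: eq_matI nth_equalityI)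
  have dets: "poly (det G) 0 \<noteq> 0" "poly (det G) 1 \<noteq> 0"
    using det_mult[OF S T] det_mult[OF S' T'] ST ST' unfolding ev_det[symmetric] ends by auto
  have "poly d 0 \<noteq> 0" "poly d 1 \<noteq> 0"
    using dets I l unfolding d_def r_def by (auto simp: poly_prod I_def nth_eq_iff_index_eq)
  moreover have "z 0 = x" "z 1 = y"
  proof -
    have "T = U 0" by (rule inverse_mat_unique[OF S T U ST(2)]) (use GU[OF dets(1)] ends in simp)
    moreover have "T' = U 1" by (rule inverse_mat_unique[OF S' T' U ST'(2)]) (use GU[OF dets(2)] ends in simp)
    ultimately show "z 0 = x" "z 1 = y"
      unfolding z_def BU ends x y bST bST' by simp_all
  qed
  ultimately show "\<exists>d z. curve_in (Ubar m) d z \<and> poly d 0 \<noteq> 0 \<and> z 0 = x \<and> poly d 1 \<noteq> 0 \<and> z 1 = y"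
    by blast
qed

section \<open>Uniqueness of refactorizations\<close>

lemma factor_product_Nil: "factor_product m [] = 1\<^sub>m m"
  unfolding factor_product_def by simp

lemma factor_product_Cons:
  "factor_product m (x # xs) = char_poly_matrix (fst x) * factor_product m xs"
  unfolding factor_product_def by (simp add: case_prod_beta)

lemma Ubar_carrier: "x \<in> pts (Ubar m) \<Longrightarrow> fst x \<in> carrier_mat m m"
  by (cases x) (simp add: pts_Ubar)

lemma factor_product_carrier:
  assumes "\<And>x. x \<in> set xs \<Longrightarrow> x \<in> pts (Ubar m)"
  shows "factor_product m xs \<in> carrier_mat m m"
  using assms
  by (induction xs)
    (auto simp: factor_product_Nil factor_product_Cons
      intro!: mult_carrier_mat[of _ m m] char_poly_matrix_closed Ubar_carrier)

lemma factor_product_append: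
  assumes "\<And>x. x \<in> set xs \<Longrightarrow> x \<in> pts (Ubar m)" "\<And>x. x \<in> set ys \<Longrightarrow> x \<in> pts (Ubar m)"
  shows "factor_product m (xs @ ys) = factor_product m xs * factor_product m ys"
  using assms(1)
proof (induction xs)
  case Nil
  have "factor_product m ys \<in> carrier_mat m m" by (rule factor_product_carrier[OF assms(2)])
  then show ?case by (simp add: factor_product_Nil)
next
  case (Cons x xs)
  have "char_poly_matrix (fst x) \<in> carrier_mat m m"
    using Cons.prems by (intro char_poly_matrix_closed Ubar_carrier) auto
  moreover have "factor_product m xs \<in> carrier_mat m m"
    using Cons.prems by (intro factor_product_carrier) auto
  moreover have "factor_product m ys \<in> carrier_mat m m"
    using assms(2) by (intro factor_product_carrier) auto
  ultimately show ?case
    using Cons by (simp add: factor_product_Cons assoc_mult_mat[of _ m m _ m _ m])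
qed

lemma eval_char_poly_matrix:
  "b \<in> carrier_mat m m \<Longrightarrow> eval_mat s (char_poly_matrix b) = s \<cdot>\<^sub>m 1\<^sub>m m - b"
  unfolding eval_mat_def char_poly_matrix_def by (intro eq_matI) auto

text \<open>
  Identities between matrix polynomials are checked at each value of \<open>t\<close>, where they become identities
  between complex matrices.
\<close>

lemma eval_mat_eqI:
  assumes A: "A \<in> carrier_mat n m" and B: "B \<in> carrier_mat n m"
    and eq: "\<And>s. eval_mat s A = eval_mat s B"
  shows "A = B"
proof (rule eq_matI)
  fix i j assume "i < dim_row B" "j < dim_col B"
  then have ij: "i < n" "j < m" using B by auto
  have "poly (A $$ (i, j)) s = poly (B $$ (i, j)) s" for s
  proof -
    have "eval_mat s A $$ (i, j) = eval_mat s B $$ (i, j)" using eq by simp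
    then show ?thesis using ij A B unfolding eval_mat_def by simp
  qed
  then show "A $$ (i, j) = B $$ (i, j)" by (simp add: poly_eq_poly_eq_iff[symmetric] fun_eq_iff)
qed (use A B in auto)

lemma eigenvalue_list_Cons: "eigenvalue_list (x # xs) = snd x @ eigenvalue_list xs"
  unfolding eigenvalue_list_def by simp

lemma det_factor_product_nonzero:
  assumes "\<And>x. x \<in> set xs \<Longrightarrow> x \<in> pts (Ubar m)" "s \<notin> set (eigenvalue_list xs)"
  shows "det (eval_mat s (factor_product m xs)) \<noteq> 0"
  using assms
proof (induction xs)
  case Nil
  then show ?case by (simp add: factor_product_Nil det_eval_mat)
next
  case (Cons x xs)
  have x: "(fst x, snd x) \<in> pts (Ubar m)" using Cons.prems by simp
  then have b: "fst x \<in> carrier_mat m m" "set (snd x) = spectrum (fst x)" unfolding pts_Ubar by auto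
  have F: "factor_product m xs \<in> carrier_mat m m"
    using Cons.prems by (intro factor_product_carrier) auto
  have "s \<notin> spectrum (fst x)" using Cons.prems(2) b(2) by (simp add: eigenvalue_list_Cons)
  then have "poly (char_poly (fst x)) s \<noteq> 0" using spectrum_root_char_poly[OF b(1)] by simp
  moreover have "det (eval_mat s (factor_product m xs)) \<noteq> 0"
    using Cons by (simp add: eigenvalue_list_Cons)
  ultimately show ?case
    using F b(1) by (simp add: det_eval_mat factor_product_Cons det_mult[of _ m] char_poly_def)
qed

lemma minus_eq_0_mat:
  fixes A B :: "'a::ring mat"
  assumes A: "A \<in> carrier_mat n m" and B: "B \<in> carrier_mat n m" and eq: "A - B = 0\<^sub>m n m"
  shows "A = B"
proof (rule eq_matI)
  fix i j assume "i < dim_row B" "j < dim_col B"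
  moreover from this have "(A - B) $$ (i, j) = 0" unfolding eq using B by auto
  ultimately show "A $$ (i, j) = B $$ (i, j)" using A B by auto
qed (use A B in auto)

text \<open>
  Let \<open>\<lambda>\<close> be the \<open>k\<close>-th eigenvalue of the first factors \<open>b\<close> and \<open>b'\<close>. Since \<open>\<lambda>\<close> is not an
  eigenvalue of any later factor, the remaining product is invertible at \<open>t = \<lambda>\<close>. The \<open>k\<close>-th left
  eigenvector of \<open>b\<close>, a row of \<open>T\<close>, annihilates the whole product at \<open>\<lambda>\<close> and therefore also
  \<open>\<lambda> - b'\<close>. So \<open>b\<close> and \<open>b'\<close> have the same left eigenvectors with the same eigenvalues, hence are
  equal, and \<open>t - b\<close> cancels because its determinant is monic.
\<close>

lemma factor_product_determines:
  assumes "\<And>x. x \<in> set xs \<Longrightarrow> x \<in> pts (Ubar m)" "\<And>y. y \<in> set ys \<Longrightarrow> y \<in> pts (Ubar m)"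
    and "map snd xs = map snd ys" "factor_product m xs = factor_product m ys"
    and "distinct (eigenvalue_list xs)"
  shows "xs = ys"
  using assms
proof (induction xs arbitrary: ys)
  case Nil
  then show ?case by simp
next
  case (Cons x xs ys0)
  obtain y ys where ys0: "ys0 = y # ys" using Cons.prems(3) by (cases ys0) auto
  obtain b l where x: "x = (b, l)" by fastforce
  obtain b' where y: "y = (b', l)" using Cons.prems(3) ys0 x by (cases y) auto
  let ?F = "factor_product m xs" and ?G = "factor_product m ys"
  have xX: "(b, l) \<in> pts (Ubar m)" and yX: "(b', l) \<in> pts (Ubar m)"
    and xsX: "\<And>x. x \<in> set xs \<Longrightarrow> x \<in> pts (Ubar m)" and ysX: "\<And>y. y \<in> set ys \<Longrightarrow> y \<in> pts (Ubar m)"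
    using Cons.prems(1,2) x y ys0 by auto
  have b: "b \<in> carrier_mat m m" "b' \<in> carrier_mat m m" and l: "length l = m" "distinct l"
    using xX yX unfolding pts_Ubar by auto
  have snds: "map snd xs = map snd ys" using Cons.prems(3) ys0 by simp
  then have eigs: "eigenvalue_list xs = eigenvalue_list ys" unfolding eigenvalue_list_def by simp
  have F: "?F \<in> carrier_mat m m" and G: "?G \<in> carrier_mat m m"
    using factor_product_carrier xsX ysX by blast+
  have eq: "char_poly_matrix b * ?F = char_poly_matrix b' * ?G"
    using Cons.prems(4) x y ys0 by (simp add: factor_product_Cons)
  note cb = char_poly_matrix_closed[OF b(1)] and cb' = char_poly_matrix_closed[OF b(2)]
  obtain S T where S: "S \<in> carrier_mat m m" and T: "T \<in> carrier_mat m m"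
    and ST: "S * T = 1\<^sub>m m" "T * S = 1\<^sub>m m" and bST: "b = S * mat_diag m ((!) l) * T"
    using Ubar_diagonalize[OF xX] by blast
  have Tb: "T * b = mat_diag m ((!) l) * T"
  proof -
    have "T * b = T * (S * (mat_diag m ((!) l) * T))"
      unfolding bST by (simp add: assoc_mult_mat[OF S mat_diag_dim T])
    also have "\<dots> = T * S * (mat_diag m ((!) l) * T)"
      by (rule assoc_mult_mat[OF T S mult_carrier_mat[OF mat_diag_dim T], symmetric])
    also have "\<dots> = mat_diag m ((!) l) * T"
      unfolding ST(2) by (rule left_mult_one_mat[OF mult_carrier_mat[OF mat_diag_dim T]])
    finally show ?thesis .
  qed
  have "T * b' = T * b"
  proof (rule eq_matI)
    fix k j assume "k < dim_row (T * b)" "j < dim_col (T * b)"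
    then have k: "k < m" and j: "j < m" using T b by auto
    let ?E = "mat_diag m (\<lambda>i. if i = k then 1 else (0 :: complex))"
    let ?s = "l ! k"
    have s: "?s \<notin> set (eigenvalue_list ys)"
    proof -
      have "set l \<inter> set (eigenvalue_list ys) = {}"
        using Cons.prems(5) x unfolding eigs[symmetric] by (simp add: eigenvalue_list_Cons)
      moreover have "?s \<in> set l" using k l by simp
      ultimately show ?thesis by blast
    qed
    have ET: "?E * T \<in> carrier_mat m m" by (rule mult_carrier_mat[OF mat_diag_dim T])
    \<comment> \<open>\<open>?E * T\<close> is the \<open>k\<close>-th row of \<open>T\<close>, padded by zeros to a square matrix\<close>
    have row: "(?E * T * A) $$ (k, j) = (T * A) $$ (k, j)" if A: "A \<in> carrier_mat m m" for A
    proof -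
      have "(?E * T * A) $$ (k, j) = (?E * (T * A)) $$ (k, j)"
        by (simp add: assoc_mult_mat[OF mat_diag_dim T A])
      then show ?thesis
        unfolding mat_diag_mult_left[OF mult_carrier_mat[OF T A]] using k j T A by simp
    qed
    have ETb: "?E * T * b = ?s \<cdot>\<^sub>m (?E * T)"
    proof -
      have "?E * mat_diag m ((!) l) = ?s \<cdot>\<^sub>m ?E"
        unfolding mat_diag_diag by (intro eq_matI) (auto simp: mat_diag_def)
      moreover have "?E * T * b = ?E * mat_diag m ((!) l) * T"
        unfolding assoc_mult_mat[OF mat_diag_dim T b(1)] Tb
        by (rule assoc_mult_mat[OF mat_diag_dim mat_diag_dim T, symmetric])
      ultimately show ?thesis by (simp add: mult_smult_assoc_mat[OF mat_diag_dim T])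
    qed
    have sub: "?E * T * (?s \<cdot>\<^sub>m 1\<^sub>m m - A) = ?s \<cdot>\<^sub>m (?E * T) - ?E * T * A" if A: "A \<in> carrier_mat m m" for A
      using mult_minus_distrib_mat[OF ET _ A, of "?s \<cdot>\<^sub>m 1\<^sub>m m"] mult_smult_distrib[OF ET one_carrier_mat, of ?s]
        right_mult_one_mat[OF ET] by simp
    have cs: "?s \<cdot>\<^sub>m 1\<^sub>m m - A \<in> carrier_mat m m" if "A \<in> carrier_mat m m" for A
      using that by (rule minus_carrier_mat)
    note Fs = eval_mat_carrier[OF F, of ?s] and Gs = eval_mat_carrier[OF G, of ?s]
    have "(?s \<cdot>\<^sub>m 1\<^sub>m m - b) * eval_mat ?s ?F = (?s \<cdot>\<^sub>m 1\<^sub>m m - b') * eval_mat ?s ?G"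
      using arg_cong[OF eq, of "eval_mat ?s"]
      unfolding eval_mat_mult[OF cb F] eval_mat_mult[OF cb' G] eval_char_poly_matrix[OF b(1)] eval_char_poly_matrix[OF b(2)] .
    then have "?E * T * (?s \<cdot>\<^sub>m 1\<^sub>m m - b) * eval_mat ?s ?F = ?E * T * (?s \<cdot>\<^sub>m 1\<^sub>m m - b') * eval_mat ?s ?G"
      by (simp only: assoc_mult_mat[OF ET cs[OF b(1)] Fs] assoc_mult_mat[OF ET cs[OF b(2)] Gs])
    moreover have "?E * T * (?s \<cdot>\<^sub>m 1\<^sub>m m - b) = 0\<^sub>m m m"
      unfolding sub[OF b(1)] ETb using ET by simp
    ultimately have "?E * T * (?s \<cdot>\<^sub>m 1\<^sub>m m - b') * eval_mat ?s ?G = 0\<^sub>m m m"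
      using Fs by simp
    then have "?E * T * (?s \<cdot>\<^sub>m 1\<^sub>m m - b') = 0\<^sub>m m m"
      by (rule det_nonzero_mult_right_zero[OF Gs mult_carrier_mat[OF ET cs[OF b(2)]]])
        (rule det_factor_product_nonzero[OF ysX s])
    then have "?s \<cdot>\<^sub>m (?E * T) - ?E * T * b' = 0\<^sub>m m m" unfolding sub[OF b(2)] .
    then have "?s \<cdot>\<^sub>m (?E * T) = ?E * T * b'"
      by (rule minus_eq_0_mat[OF smult_carrier_mat[OF ET] mult_carrier_mat[OF ET b(2)]])
    then show "(T * b') $$ (k, j) = (T * b) $$ (k, j)"
      using row[OF b(1)] row[OF b(2)] unfolding ETb by simp
  qed (use T b in auto)
  then have "S * T * b' = S * T * b" using S T b by (simp add: assoc_mult_mat[of _ m m _ m _ m])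
  then have bb: "b' = b" using ST b by simp
  have "char_poly_matrix b * (?F - ?G) = 0\<^sub>m m m"
    using eq bb cb F G by (simp add: mult_minus_distrib_mat[of _ m m])
  moreover have "det (char_poly_matrix b) \<noteq> 0"
    using degree_monic_char_poly[OF b(1)] unfolding char_poly_def by auto
  ultimately have FG: "?F - ?G = 0\<^sub>m m m"
    by (rule det_nonzero_mult_left_zero[OF cb minus_carrier_mat[OF G]])
  have "?F = ?G" by (rule minus_eq_0_mat[OF F G FG])
  moreover have "distinct (eigenvalue_list xs)"
    using Cons.prems(5) by (simp add: eigenvalue_list_Cons)
  ultimately have "xs = ys" using Cons.IH[OF xsX ysX snds] by blast
  then show ?case using x y ys0 bb by simp
qed

section \<open>Powers of the variety of matrices with ordered spectrum\<close>

abbreviation (input) Ubar_power :: "nat \<Rightarrow> nat \<Rightarrow> (complex mat \<times> complex list) list variety" where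
  "Ubar_power m N \<equiv> var_power (Ubar m) N"

lemma Ubar_power_nth:
  assumes "xs \<in> pts (Ubar_power m N)" "k < N"
  shows "fst (xs ! k) \<in> carrier_mat m m" "length (snd (xs ! k)) = m" "distinct (snd (xs ! k))"
    "xs ! k \<in> pts (Ubar m)"
proof -
  show *: "xs ! k \<in> pts (Ubar m)" using assms unfolding pts_var_power by blast
  then have "(fst (xs ! k), snd (xs ! k)) \<in> pts (Ubar m)" by simp
  then show "fst (xs ! k) \<in> carrier_mat m m" "length (snd (xs ! k)) = m" "distinct (snd (xs ! k))"
    unfolding pts_Ubar by auto
qed

lemma Ubar_power_set: "xs \<in> pts (Ubar_power m N) \<Longrightarrow> x \<in> set xs \<Longrightarrow> x \<in> pts (Ubar m)"
  unfolding pts_var_power by (auto simp: in_set_conv_nth)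

lemma regular_on_entry:
  assumes "openin (zariski (Ubar_power m N)) U" "k < N" "i < m" "j < m"
  shows "regular_on (Ubar_power m N) U (\<lambda>xs. fst (xs ! k) $$ (i, j))"
proof -
  have "(\<lambda>(b, l). b $$ (i, j)) \<in> coords (Ubar m)" using assms unfolding Ubar_def by auto
  from regular_on_factor_coord[OF this assms(2,1)] show ?thesis by (simp add: case_prod_beta)
qed

lemma regular_on_eigenvalue:
  assumes "openin (zariski (Ubar_power m N)) U" "k < N" "i < m"
  shows "regular_on (Ubar_power m N) U (\<lambda>xs. snd (xs ! k) ! i)"
proof -
  have "(\<lambda>(b, l). l ! i) \<in> coords (Ubar m)" using assms unfolding Ubar_def by auto
  from regular_on_factor_coord[OF this assms(2,1)] show ?thesis by (simp add: case_prod_beta)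
qed

lemma regular_map_on_UbarI:
  assumes U: "openin (zariski X) U" and im: "\<And>x. x \<in> U \<Longrightarrow> f x \<in> pts (Ubar_power m N)"
    and mat: "\<And>k i j. k < N \<Longrightarrow> i < m \<Longrightarrow> j < m \<Longrightarrow> regular_on X U (\<lambda>x. fst (f x ! k) $$ (i, j))"
    and eig: "\<And>k i. k < N \<Longrightarrow> i < m \<Longrightarrow> regular_on X U (\<lambda>x. snd (f x ! k) ! i)"
  shows "regular_map_on X U (Ubar_power m N) f"
  unfolding regular_map_on_def
proof (intro conjI ballI)
  fix c assume "c \<in> coords (Ubar_power m N)"
  then obtain c' k where c: "c' \<in> coords (Ubar m)" "k < N" "c = (\<lambda>xs. c' (xs ! k))"
    unfolding coords_var_power by blast
  from c(1) consider (m) i j where "i < m" "j < m" "c' = (\<lambda>(b, l). b $$ (i, j))"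
    | (e) i where "i < m" "c' = (\<lambda>(b, l). l ! i)"
    unfolding Ubar_def by auto
  then show "regular_on X U (\<lambda>x. c (f x))"
  proof cases
    case m
    then show ?thesis using mat[OF c(2) m(1,2)] unfolding c(3) by (simp add: case_prod_beta)
  next
    case e
    then show ?thesis using eig[OF c(2) e(1)] unfolding c(3) by (simp add: case_prod_beta)
  qed
qed (use U im in auto)

lemma nth_concat_uniform:
  assumes "\<And>x. x \<in> set xss \<Longrightarrow> length x = m" "k < length xss" "j < m"
  shows "concat xss ! (k * m + j) = xss ! k ! j"
  using assms
proof (induction xss arbitrary: k)
  case (Cons x xss)
  show ?case
  proof (cases k)
    case 0
    then show ?thesis using Cons.prems by (simp add: nth_append)
  next
    case (Suc k')
    then have "concat xss ! (k' * m + j) = xss ! k' ! j"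
      using Cons.prems by (intro Cons.IH) auto
    then show ?thesis using Suc Cons.prems by (simp add: nth_append add.assoc)
  qed
qed simp

lemma length_eigenvalue_list:
  assumes "xs \<in> pts (Ubar_power m N)"
  shows "length (eigenvalue_list xs) = m * N"
proof -
  have "map (length \<circ> snd) xs = replicate N m"
    using assms Ubar_power_nth(2)[OF assms] by (intro nth_equalityI) (auto simp: pts_var_power)
  then have "length (eigenvalue_list xs) = sum_list (replicate N m)"
    unfolding eigenvalue_list_def length_concat map_map by simp
  then show ?thesis by (simp add: sum_list_replicate)
qed

lemma eigenvalue_list_nth:
  assumes xs: "xs \<in> pts (Ubar_power m N)" and "k < N" "j < m"
  shows "eigenvalue_list xs ! (k * m + j) = snd (xs ! k) ! j"
proof -
  have len: "length xs = N" using xs unfolding pts_var_power by blast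
  have "length x = m" if x: "x \<in> set (map snd xs)" for x
  proof -
    obtain i where "i < length (map snd xs)" "map snd xs ! i = x"
      using x unfolding in_set_conv_nth by blast
    then have "i < N" "x = snd (xs ! i)" using len by auto
    then show ?thesis using Ubar_power_nth(2)[OF xs] by simp
  qed
  then show ?thesis unfolding eigenvalue_list_def using assms(2,3) len
    by (subst nth_concat_uniform) auto
qed

text \<open>
  The set is the nonvanishing locus of the product of all differences of two entries.
\<close>

lemma openin_distinct_eigenvalues:
  "openin (zariski (Ubar_power m N)) {xs \<in> pts (Ubar_power m N). distinct (eigenvalue_list xs)}"
proof -
  let ?X = "Ubar_power m N"
  define e where "e i xs = snd (xs ! (i div m)) ! (i mod m)" for i and xs :: "(complex mat \<times> complex list) list"
  define I where "I = {(i, j). i < m * N \<and> j < m * N \<and> i \<noteq> j}"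
  have I: "finite I" by (rule finite_subset[of _ "{..<m * N} \<times> {..<m * N}"]) (auto simp: I_def)
  have dm: "i div m < N" "i mod m < m" if "i < m * N" for i
  proof -
    have "m > 0" using that by (cases m) auto
    then show "i div m < N" "i mod m < m" using that by (auto simp: less_mult_imp_div_less mult.commute)
  qed
  have e: "eigenvalue_list xs ! i = e i xs" if "xs \<in> pts ?X" "i < m * N" for i xs
    using eigenvalue_list_nth[OF that(1) dm[OF that(2)]] unfolding e_def by (simp add: mult.commute)
  have "regular_on ?X (pts ?X) (\<lambda>xs. \<Prod>p\<in>I. e (fst p) xs - e (snd p) xs)"
    unfolding e_def
    by (intro regular_on_prod regular_on_diff regular_on_eigenvalue openin_zariski_pts)
      (auto simp: I_def dm)
  then have "openin (zariski ?X) {xs \<in> pts ?X. (\<Prod>p\<in>I. e (fst p) xs - e (snd p) xs) \<noteq> 0}"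
    by (rule openin_regular_nonzero[OF openin_zariski_pts])
  also have "{xs \<in> pts ?X. (\<Prod>p\<in>I. e (fst p) xs - e (snd p) xs) \<noteq> 0} =
      {xs \<in> pts ?X. distinct (eigenvalue_list xs)}"
  proof -
    have "(\<Prod>p\<in>I. e (fst p) xs - e (snd p) xs) \<noteq> 0 \<longleftrightarrow> distinct (eigenvalue_list xs)"
      if xs: "xs \<in> pts ?X" for xs
      unfolding distinct_conv_nth length_eigenvalue_list[OF xs] prod_zero_iff[OF I]
      using e[OF xs] by (auto simp: I_def)
    then show ?thesis by blast
  qed
  finally show ?thesis .
qed

lemma diag_in_Ubar:
  assumes "length l = m" "distinct l" "length l' = m" "distinct l'" "set l = set l'"
  shows "(mat_diag m ((!) l), l') \<in> pts (Ubar m)"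
proof -
  have "1\<^sub>m m * mat_diag m ((!) l) * 1\<^sub>m m = mat_diag m ((!) l)"
    unfolding left_mult_one_mat[OF mat_diag_dim] right_mult_one_mat[OF mat_diag_dim] ..
  then have "(mat_diag m ((!) l), l) \<in> pts (Ubar m)"
    using diag_conj_in_Ubar[of "1\<^sub>m m" m "1\<^sub>m m" l] assms by simp
  then show ?thesis using assms unfolding pts_Ubar by simp
qed

lemma irreducible_Ubar_power: "irreducible_variety (Ubar_power m N)"
  by (intro rationally_connected_imp_irreducible rationally_connected_var_power rationally_connected_Ubar)

lemma distinct_point:
  "\<exists>xs \<in> pts (Ubar_power m N). distinct (eigenvalue_list xs)"
proof -
  define l where "l k = map (\<lambda>j. of_nat (k * m + j) :: complex) [0..<m]" for k
  define xs where "xs = map (\<lambda>k. (mat_diag m ((!) (l k)), l k)) [0..<N]"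
  have l: "length (l k) = m" "distinct (l k)" for k
    unfolding l_def by (auto simp: distinct_map inj_on_def)
  have xs: "xs \<in> pts (Ubar_power m N)"
    unfolding pts_var_power xs_def using l by (auto intro!: diag_in_Ubar)
  have "eigenvalue_list xs ! i = of_nat i" if i: "i < m * N" for i
  proof -
    have "m > 0" using i by (cases m) auto
    then have dm: "i div m < N" "i mod m < m"
      using i by (auto simp: less_mult_imp_div_less mult.commute)
    have "eigenvalue_list xs ! (i div m * m + i mod m) = snd (xs ! (i div m)) ! (i mod m)"
      by (rule eigenvalue_list_nth[OF xs dm])
    also have "\<dots> = of_nat (i div m * m + i mod m)"
      using dm unfolding xs_def l_def by (simp del: of_nat_add of_nat_mult)
    finally show ?thesis by simp
  qed
  then have "distinct (eigenvalue_list xs)"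
    unfolding distinct_conv_nth length_eigenvalue_list[OF xs] by simp
  then show ?thesis using xs by blast
qed

lemma pts_Ubar_power_nonempty: "pts (Ubar_power m N) \<noteq> {}"
  using distinct_point by blast

lemma pts_Ubar_nonempty: "pts (Ubar m) \<noteq> {}"
proof -
  obtain xs where "xs \<in> pts (Ubar_power m 1)" using pts_Ubar_power_nonempty by blast
  then show ?thesis unfolding pts_var_power by auto
qed

section \<open>Exchanging one eigenvalue between two neighbours\<close>

lemma shifted_mult_expand:
  fixes A B :: "complex mat"
  assumes A: "A \<in> carrier_mat m m" and B: "B \<in> carrier_mat m m"
  shows "(s \<cdot>\<^sub>m 1\<^sub>m m - A) * (s \<cdot>\<^sub>m 1\<^sub>m m - B) = s \<cdot>\<^sub>m (s \<cdot>\<^sub>m 1\<^sub>m m - (A + B)) + A * B"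
proof -
  have c: "s \<cdot>\<^sub>m 1\<^sub>m m \<in> carrier_mat m m" "s \<cdot>\<^sub>m 1\<^sub>m m - B \<in> carrier_mat m m" using B by auto
  have "(s \<cdot>\<^sub>m 1\<^sub>m m - A) * (s \<cdot>\<^sub>m 1\<^sub>m m - B) = s \<cdot>\<^sub>m (s \<cdot>\<^sub>m 1\<^sub>m m - B) - (s \<cdot>\<^sub>m A - A * B)"
    unfolding minus_mult_distrib_mat[OF c(1) A c(2)] mult_minus_distrib_mat[OF A c(1) B]
      mult_smult_assoc_mat[OF one_carrier_mat c(2)] mult_smult_distrib[OF A one_carrier_mat]
      left_mult_one_mat[OF c(2)] right_mult_one_mat[OF A] ..
  also have "\<dots> = s \<cdot>\<^sub>m (s \<cdot>\<^sub>m 1\<^sub>m m - (A + B)) + A * B"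
  proof -
    define C where "C = A * B"
    have "C \<in> carrier_mat m m" unfolding C_def by (rule mult_carrier_mat[OF A B])
    then show ?thesis unfolding C_def[symmetric] using A B
      by (intro eq_matI) (auto simp: algebra_simps)
  qed
  finally show ?thesis .
qed

lemma factor_product_pair_eqI:
  assumes "A \<in> carrier_mat m m" "B \<in> carrier_mat m m" "A' \<in> carrier_mat m m" "B' \<in> carrier_mat m m"
    and "A + B = A' + B'" "A * B = A' * B'"
  shows "factor_product m [(A, l1), (B, l2)] = factor_product m [(A', l3), (B', l4)]"
proof -
  have one: "factor_product m [(A, l), (B, l')] = char_poly_matrix A * char_poly_matrix B"
    if "A \<in> carrier_mat m m" "B \<in> carrier_mat m m" for A B l l'
    using right_mult_one_mat[OF char_poly_matrix_closed[OF that(2)]]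
    by (simp add: factor_product_Cons factor_product_Nil)
  have "char_poly_matrix A * char_poly_matrix B = char_poly_matrix A' * char_poly_matrix B'"
  proof (rule eval_mat_eqI[of _ m m])
    show "eval_mat s (char_poly_matrix A * char_poly_matrix B) =
        eval_mat s (char_poly_matrix A' * char_poly_matrix B')" for s
      unfolding eval_mat_mult[OF char_poly_matrix_closed[OF assms(1)] char_poly_matrix_closed[OF assms(2)]]
        eval_mat_mult[OF char_poly_matrix_closed[OF assms(3)] char_poly_matrix_closed[OF assms(4)]]
        eval_char_poly_matrix[OF assms(1)] eval_char_poly_matrix[OF assms(2)]
        eval_char_poly_matrix[OF assms(3)] eval_char_poly_matrix[OF assms(4)]
        shifted_mult_expand[OF assms(1,2)] shifted_mult_expand[OF assms(3,4)] assms(5,6) ..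
  qed (use assms in \<open>auto intro!: mult_carrier_mat[of _ m m] char_poly_matrix_closed\<close>)
  then show ?thesis using one assms(1-4) by simp
qed

text \<open>
  The exchanged eigenvalues are \<open>\<lambda>\<close>, the last one of the first matrix, and \<open>\<kappa>\<close>, the first one of the
  second matrix: they are adjacent in the list of all eigenvalues. This matrix is \<open>u w\<^sup>T\<close> up to a scalar,
  with \<open>u\<close> a \<open>\<lambda>\<close>-eigenvector of the first and \<open>w\<^sup>T\<close> a left \<open>\<kappa>\<close>-eigenvector of the second matrix.
\<close>

definition cross_prod :: "(complex mat \<times> complex list) list \<Rightarrow> complex mat" where
  "cross_prod xs = shifted_prod (fst (xs ! 0)) (butlast (snd (xs ! 0))) *
     shifted_prod (fst (xs ! 1)) (tl (snd (xs ! 1)))"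

definition cross_trace :: "nat \<Rightarrow> (complex mat \<times> complex list) list \<Rightarrow> complex" where
  "cross_trace m xs = (\<Sum>i<m. cross_prod xs $$ (i, i))"

text \<open>
  The scalar makes the trace equal to \<open>\<lambda> - \<kappa>\<close>. Since a matrix of rank one satisfies
  \<open>K\<^sup>2 = tr(K) K\<close>, this is what turns \<open>b\<^sub>1 K - K b\<^sub>2 = (\<lambda> - \<kappa>) K\<close> into
  \<open>(b\<^sub>1 - K) (b\<^sub>2 + K) = b\<^sub>1 b\<^sub>2\<close>.
\<close>

definition cross_shift :: "nat \<Rightarrow> (complex mat \<times> complex list) list \<Rightarrow> complex mat" where
  "cross_shift m xs =
     ((last (snd (xs ! 0)) - hd (snd (xs ! 1))) / cross_trace m xs) \<cdot>\<^sub>m cross_prod xs"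

definition cross_swap ::
  "nat \<Rightarrow> (complex mat \<times> complex list) list \<Rightarrow> (complex mat \<times> complex list) list" where
  "cross_swap m xs =
     [(fst (xs ! 0) - cross_shift m xs, butlast (snd (xs ! 0)) @ [hd (snd (xs ! 1))]),
      (fst (xs ! 1) + cross_shift m xs, last (snd (xs ! 0)) # tl (snd (xs ! 1)))]"

definition cross_domain :: "nat \<Rightarrow> (complex mat \<times> complex list) list set" where
  "cross_domain m =
     {xs \<in> pts (var_power (Ubar m) 2). distinct (eigenvalue_list xs) \<and> cross_trace m xs \<noteq> 0}"

lemma set_butlast: "distinct l \<Longrightarrow> l \<noteq> [] \<Longrightarrow> set (butlast l) = set l - {last l}"
  by (induction l rule: rev_induct) auto

lemma set_tl: "distinct l \<Longrightarrow> l \<noteq> [] \<Longrightarrow> set (tl l) = set l - {hd l}"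
  by (cases l) auto

text \<open>
  Sum and product of the two matrices are unchanged. For the spectra, the columns of \<open>R\<close> remain
  eigenvectors of the first matrix and its rows remain left eigenvectors of the second, with \<open>\<lambda>\<close> and
  \<open>\<kappa>\<close> exchanged. Any other eigenvalue survives because its projector \<open>E\<close> satisfies \<open>E K = 0\<close> for the
  first matrix and \<open>K E = 0\<close> for the second.
\<close>

lemma cross_swap_correct:
  assumes m: "m \<ge> 1" and xs: "xs \<in> cross_domain m"
  shows "cross_swap m xs \<in> pts (var_power (Ubar m) 2)"
    and "factor_product m (cross_swap m xs) = factor_product m xs"
proof -
  obtain b1 l1 b2 l2 where xs_eq: "xs = [(b1, l1), (b2, l2)]"
  proof -
    have "length xs = 2" using xs unfolding cross_domain_def pts_var_power by simp
    then obtain x y where "xs = [x, y]" by (auto simp: length_Suc_conv numeral_2_eq_2)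
    then show thesis using that by (cases x, cases y) auto
  qed
  have X: "(b1, l1) \<in> pts (Ubar m)" "(b2, l2) \<in> pts (Ubar m)"
  proof -
    have "\<forall>k<2. xs ! k \<in> pts (Ubar m)" using xs unfolding cross_domain_def pts_var_power by blast
    from this[rule_format, of 0] this[rule_format, of 1]
    show "(b1, l1) \<in> pts (Ubar m)" "(b2, l2) \<in> pts (Ubar m)" by (simp_all add: xs_eq)
  qed
  then have b: "b1 \<in> carrier_mat m m" "b2 \<in> carrier_mat m m"
    and l: "length l1 = m" "distinct l1" "length l2 = m" "distinct l2"
    unfolding pts_Ubar by auto
  have ne: "l1 \<noteq> []" "l2 \<noteq> []" using m l by auto
  have dis: "distinct (l1 @ l2)" and tr: "cross_trace m xs \<noteq> 0"
    using xs unfolding cross_domain_def by (auto simp: xs_eq eigenvalue_list_def)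
  define lam kap where "lam = last l1" and "kap = hd l2"
  define P Q where "P = shifted_prod b1 (butlast l1)" and "Q = shifted_prod b2 (tl l2)"
  define R where "R = P * Q"
  define t where "t = (\<Sum>i<m. R $$ (i, i))"
  define c where "c = (lam - kap) / t"
  define K where "K = c \<cdot>\<^sub>m R"
  have Rdef: "cross_prod xs = R" unfolding cross_prod_def xs_eq R_def P_def Q_def by simp
  have t: "cross_trace m xs = t" "t \<noteq> 0" using tr unfolding cross_trace_def t_def Rdef by auto
  have K: "cross_shift m xs = K"
    unfolding cross_shift_def K_def c_def Rdef t lam_def kap_def by (simp add: xs_eq)
  have lam: "lam = l1 ! (m - 1)" "kap = l2 ! 0"
    using l ne by (simp_all add: lam_def kap_def last_conv_nth hd_conv_nth)
  have setP: "set (butlast l1) = set l1 - {l1 ! (m - 1)}" and setQ: "set (tl l2) = set l2 - {l2 ! 0}"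
    using set_butlast[OF l(2) ne(1)] set_tl[OF l(4) ne(2)] lam unfolding lam_def kap_def by auto
  have m1: "m - 1 < m" "0 < m" using m by auto
  note Pp = shifted_prod_projector[OF X(1) m1(1) setP, folded P_def lam(1)]
  note Qp = shifted_prod_projector[OF X(2) m1(2) setQ, folded Q_def lam(2)]
  have P: "P \<in> carrier_mat m m" and Q: "Q \<in> carrier_mat m m"
    unfolding P_def Q_def using shifted_prod_carrier b by auto
  have R: "R \<in> carrier_mat m m" unfolding R_def by (rule mult_carrier_mat[OF P Q])
  have Kc: "K \<in> carrier_mat m m" unfolding K_def using R by simp
  have bR: "b1 * R = lam \<cdot>\<^sub>m R"
    unfolding R_def by (simp add: assoc_mult_mat[OF b(1) P Q, symmetric] Pp mult_smult_assoc_mat[OF P Q])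
  have Rb: "R * b2 = kap \<cdot>\<^sub>m R"
    unfolding R_def by (simp add: assoc_mult_mat[OF P Q b(2)] Qp mult_smult_distrib[OF P Q])
  have RR: "R * R = t \<cdot>\<^sub>m R"
  proof -
    obtain u w where uw: "\<And>i j. i < m \<Longrightarrow> j < m \<Longrightarrow> P $$ (i, j) = u i * w j" using Pp(4) by blast
    define w' where "w' j = (\<Sum>a\<in>{0..<m}. w a * Q $$ (a, j))" for j
    have Rij: "R $$ (i, j) = u i * w' j" if "i < m" "j < m" for i j
      unfolding R_def w'_def using that P Q uw
      by (auto simp: scalar_prod_def sum_distrib_left mult.assoc intro!: sum.cong)
    show ?thesis
    proof (rule eq_matI)
      fix i j assume "i < dim_row (t \<cdot>\<^sub>m R)" "j < dim_col (t \<cdot>\<^sub>m R)"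
      then have ij: "i < m" "j < m" using R by auto
      have "(R * R) $$ (i, j) = (\<Sum>a\<in>{0..<m}. R $$ (i, a) * R $$ (a, j))"
        using ij R by (auto simp: scalar_prod_def intro!: sum.cong)
      also have "\<dots> = (\<Sum>a\<in>{0..<m}. R $$ (a, a) * R $$ (i, j))"
        using ij by (intro sum.cong) (auto simp: Rij)
      finally show "(R * R) $$ (i, j) = (t \<cdot>\<^sub>m R) $$ (i, j)"
        using ij R by (simp add: t_def sum_distrib_right atLeast0LessThan)
    qed (use R in auto)
  qed
  have R0: "R \<noteq> 0\<^sub>m m m" using t(2) unfolding t_def by auto
  have ct: "c * t = lam - kap" unfolding c_def using t by simp
  define b1' b2' where "b1' = b1 - K" and "b2' = b2 + K"
  have b': "b1' \<in> carrier_mat m m" "b2' \<in> carrier_mat m m" unfolding b1'_def b2'_def using b Kc by auto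
  have bK: "b1 * K = lam \<cdot>\<^sub>m K" "K * b2 = kap \<cdot>\<^sub>m K" "K * K = (lam - kap) \<cdot>\<^sub>m K"
    "K * R = (lam - kap) \<cdot>\<^sub>m R" "R * K = (lam - kap) \<cdot>\<^sub>m R"
    unfolding K_def ct[symmetric] using b R
    by (simp_all add: mult_smult_distrib[of _ m m _ m] mult_smult_assoc_mat[of _ m m _ m] bR Rb RR)
      (auto intro!: eq_matI)
  let ?l1 = "butlast l1 @ [kap]" and ?l2 = "lam # tl l2"
  have swap: "cross_swap m xs = [(b1', ?l1), (b2', ?l2)]"
    unfolding cross_swap_def K b1'_def b2'_def lam_def kap_def by (simp add: xs_eq)
  have "(b1', ?l1) \<in> pts (Ubar m)"
  proof (rule in_UbarI[OF b'(1)])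
    show "length ?l1 = m" using l m by simp
    show "distinct ?l1"
      using dis l ne unfolding kap_def by (auto simp: distinct_butlast dest: in_set_butlastD)
    fix \<nu> assume "\<nu> \<in> set ?l1"
    then consider "\<nu> = kap" | "\<nu> \<in> set (butlast l1)" by auto
    then show "eigenvalue b1' \<nu>"
    proof cases
      case 1
      have "b1' * R = kap \<cdot>\<^sub>m R"
        unfolding b1'_def minus_mult_distrib_mat[OF b(1) Kc R] bR bK using R
        by (intro eq_matI) (auto simp: algebra_simps)
      then show ?thesis using eigenvalueI_left[OF b'(1) R R0] 1 by simp
    next
      case 2
      then obtain k where k: "k < m" "l1 ! k = \<nu>"
        using l by (metis in_set_butlastD in_set_conv_nth)
      define E where "E = shifted_prod b1 (remove1 \<nu> l1)"
      have setE: "set (remove1 \<nu> l1) = set l1 - {l1 ! k}" using l k by (simp add: set_remove1_eq)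
      note Ep = shifted_prod_projector[OF X(1) k(1) setE, folded E_def, unfolded k(2)]
      have E: "E \<in> carrier_mat m m" unfolding E_def by (rule shifted_prod_carrier[OF b(1)])
      have "E * P = 0\<^sub>m m m"
        unfolding E_def P_def by (rule shifted_prod_orthogonal[OF X(1)]) (use 2 setE k in auto)
      then have "E * R = 0\<^sub>m m m"
        unfolding R_def using Q by (simp add: assoc_mult_mat[OF E P Q, symmetric])
      then have "E * K = 0\<^sub>m m m"
        unfolding K_def by (simp add: mult_smult_distrib[OF E R])
      then have "E * b1' = \<nu> \<cdot>\<^sub>m E"
        unfolding b1'_def mult_minus_distrib_mat[OF E b(1) Kc] Ep(2) using E
        by (intro eq_matI) auto
      then show ?thesis using eigenvalueI_right[OF b'(1) E Ep(3)] by simp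
    qed
  qed
  moreover have "(b2', ?l2) \<in> pts (Ubar m)"
  proof (rule in_UbarI[OF b'(2)])
    show "length ?l2 = m" using l m by simp
    have "lam \<notin> set l2" using dis last_in_set[OF ne(1)] unfolding lam_def by auto
    then show "distinct ?l2"
      using l setQ by (auto simp: distinct_tl)
    fix \<nu> assume "\<nu> \<in> set ?l2"
    then consider "\<nu> = lam" | "\<nu> \<in> set (tl l2)" by auto
    then show "eigenvalue b2' \<nu>"
    proof cases
      case 1
      have "R * b2' = lam \<cdot>\<^sub>m R"
        unfolding b2'_def mult_add_distrib_mat[OF R b(2) Kc] Rb bK using R
        by (intro eq_matI) (auto simp: algebra_simps)
      then show ?thesis using eigenvalueI_right[OF b'(2) R R0] 1 by simp
    next
      case 2
      then obtain k where k: "k < m" "l2 ! k = \<nu>"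
        using l ne by (metis list.set_sel(2) in_set_conv_nth)
      define E where "E = shifted_prod b2 (remove1 \<nu> l2)"
      have setE: "set (remove1 \<nu> l2) = set l2 - {l2 ! k}" using l k by (simp add: set_remove1_eq)
      note Ep = shifted_prod_projector[OF X(2) k(1) setE, folded E_def, unfolded k(2)]
      have E: "E \<in> carrier_mat m m" unfolding E_def by (rule shifted_prod_carrier[OF b(2)])
      have "Q * E = 0\<^sub>m m m"
        unfolding E_def Q_def by (rule shifted_prod_orthogonal[OF X(2)]) (use 2 setE k in auto)
      then have "R * E = 0\<^sub>m m m"
        unfolding R_def using P by (simp add: assoc_mult_mat[OF P Q E])
      then have "K * E = 0\<^sub>m m m"
        unfolding K_def by (simp add: mult_smult_assoc_mat[OF R E])
      then have "b2' * E = \<nu> \<cdot>\<^sub>m E"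
        unfolding b2'_def add_mult_distrib_mat[OF b(2) Kc E] Ep(1) using E
        by (intro eq_matI) auto
      then show ?thesis using eigenvalueI_left[OF b'(2) E Ep(3)] by simp
    qed
  qed
  ultimately show "cross_swap m xs \<in> pts (var_power (Ubar m) 2)"
    unfolding swap pts_var_power by (auto simp: less_2_cases_iff)
  have "b1' + b2' = b1 + b2"
    unfolding b1'_def b2'_def using b Kc by (intro eq_matI) auto
  moreover have "b1' * b2' = b1 * b2"
  proof -
    define Z where "Z = b1 * b2"
    have Z: "Z \<in> carrier_mat m m" unfolding Z_def by (rule mult_carrier_mat[OF b])
    have "b1' * b2' = (Z + lam \<cdot>\<^sub>m K) - (kap \<cdot>\<^sub>m K + (lam - kap) \<cdot>\<^sub>m K)"
      unfolding b1'_def minus_mult_distrib_mat[OF b(1) Kc b'(2)]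
      unfolding b2'_def mult_add_distrib_mat[OF b(1,2) Kc] mult_add_distrib_mat[OF Kc b(2) Kc] bK Z_def ..
    also have "\<dots> = Z" using Z Kc by (intro eq_matI) (auto simp: algebra_simps)
    finally show ?thesis unfolding Z_def .
  qed
  ultimately show "factor_product m (cross_swap m xs) = factor_product m xs"
    unfolding swap unfolding xs_eq using b b' by (intro factor_product_pair_eqI) auto
qed

lemma regular_on_shifted_prod:
  assumes U: "openin (zariski (Ubar_power m N)) U" and k: "k < N" and js: "set js \<subseteq> {..<m}"
    and ij: "i < m" "j < m"
  shows "regular_on (Ubar_power m N) U
    (\<lambda>xs. shifted_prod (fst (xs ! k)) (map ((!) (snd (xs ! k))) js) $$ (i, j))"
  using js ij(1)
proof (induction js arbitrary: i)
  case Nil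
  show ?case
  proof (rule regular_on_cong[OF regular_on_const[OF U]])
    fix xs assume "xs \<in> U"
    then have "fst (xs ! k) \<in> carrier_mat m m"
      by (rule Ubar_power_nth(1)[OF subsetD[OF openin_zariski_subset[OF U]] k])
    then show "shifted_prod (fst (xs ! k)) (map ((!) (snd (xs ! k))) []) $$ (i, j) = 1\<^sub>m m $$ (i, j)"
      by (simp add: shifted_prod_Nil)
  qed
next
  case (Cons a as)
  let ?M = "\<lambda>xs. shifted_prod (fst (xs ! k)) (map ((!) (snd (xs ! k))) as)"
  show ?case
  proof (rule regular_on_cong)
    show "regular_on (Ubar_power m N) U
       (\<lambda>xs. \<Sum>p\<in>{0..<m}. (fst (xs ! k) $$ (i, p) - snd (xs ! k) ! a * (if i = p then 1 else 0)) * ?M xs $$ (p, j))"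
      using Cons k
      by (intro regular_on_sum regular_on_mult regular_on_diff regular_on_entry regular_on_eigenvalue
          regular_on_const U) auto
    fix xs assume "xs \<in> U"
    then have b: "fst (xs ! k) \<in> carrier_mat m m"
      by (rule Ubar_power_nth(1)[OF subsetD[OF openin_zariski_subset[OF U]] k])
    show "shifted_prod (fst (xs ! k)) (map ((!) (snd (xs ! k))) (a # as)) $$ (i, j) =
        (\<Sum>p\<in>{0..<m}. (fst (xs ! k) $$ (i, p) - snd (xs ! k) ! a * (if i = p then 1 else 0)) * ?M xs $$ (p, j))"
      using b shifted_prod_carrier[OF b, of "map ((!) (snd (xs ! k))) as"] Cons.prems ij(2)
      by (auto simp: shifted_prod_Cons[OF b] scalar_prod_def intro!: sum.cong)
  qed
qed

lemma butlast_conv_map: "butlast l = map ((!) l) [0..<length l - 1]"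
  by (intro nth_equalityI) (auto simp: nth_butlast)

lemma tl_conv_map: "tl l = map ((!) l) [1..<length l]"
  by (intro nth_equalityI) (auto simp: nth_tl)

lemma regular_on_cross_prod:
  assumes U: "openin (zariski (Ubar_power m 2)) U" and ij: "i < m" "j < m"
  shows "regular_on (Ubar_power m 2) U (\<lambda>xs. cross_prod xs $$ (i, j))"
proof (rule regular_on_cong)
  let ?P = "\<lambda>k js xs. shifted_prod (fst (xs ! k)) (map ((!) (snd (xs ! k))) js)"
  show "regular_on (Ubar_power m 2) U
      (\<lambda>xs. \<Sum>a\<in>{0..<m}. ?P 0 [0..<m - 1] xs $$ (i, a) * ?P 1 [1..<m] xs $$ (a, j))"
    using ij by (intro regular_on_sum regular_on_mult regular_on_shifted_prod U) auto
  fix xs assume "xs \<in> U"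
  then have xs: "xs \<in> pts (Ubar_power m 2)" using openin_zariski_subset[OF U] by auto
  have b: "fst (xs ! 0) \<in> carrier_mat m m" "fst (xs ! 1) \<in> carrier_mat m m"
    and l: "length (snd (xs ! 0)) = m" "length (snd (xs ! 1)) = m"
    using Ubar_power_nth(1,2)[OF xs] by auto
  have eq: "cross_prod xs = ?P 0 [0..<m - 1] xs * ?P 1 [1..<m] xs"
    unfolding cross_prod_def butlast_conv_map tl_conv_map l ..
  show "cross_prod xs $$ (i, j) =
      (\<Sum>a\<in>{0..<m}. ?P 0 [0..<m - 1] xs $$ (i, a) * ?P 1 [1..<m] xs $$ (a, j))"
    unfolding eq
    using ij shifted_prod_carrier[OF b(1), of "map ((!) (snd (xs ! 0))) [0..<m - 1]"]
      shifted_prod_carrier[OF b(2), of "map ((!) (snd (xs ! 1))) [1..<m]"]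
    by (auto simp: scalar_prod_def intro!: sum.cong)
qed

lemma openin_cross_domain: "openin (zariski (Ubar_power m 2)) (cross_domain m)"
proof -
  let ?X = "Ubar_power m 2"
  have "regular_on ?X (pts ?X) (cross_trace m)"
    unfolding cross_trace_def by (intro regular_on_sum regular_on_cross_prod openin_zariski_pts) auto
  then have "openin (zariski ?X) {xs \<in> pts ?X. cross_trace m xs \<noteq> 0}"
    by (rule openin_regular_nonzero[OF openin_zariski_pts])
  from openin_Int[OF this openin_distinct_eigenvalues] show ?thesis
    unfolding cross_domain_def by (auto elim!: back_subst[of "openin (zariski ?X)"])
qed

lemma swapped_ends_nth:
  assumes l: "length l1 = m" "length l2 = m" and m: "m \<ge> 1" and i: "i < m"
  shows "(butlast l1 @ [hd l2]) ! i = (if i = m - 1 then l2 ! 0 else l1 ! i)"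
    and "(last l1 # tl l2) ! i = (if i = 0 then l1 ! (m - 1) else l2 ! i)"
proof -
  have ne: "l1 \<noteq> []" "l2 \<noteq> []" using l m by auto
  have ends: "last l1 = l1 ! (m - 1)" "hd l2 = l2 ! 0"
    unfolding last_conv_nth[OF ne(1)] hd_conv_nth[OF ne(2)] l by simp_all
  show "(butlast l1 @ [hd l2]) ! i = (if i = m - 1 then l2 ! 0 else l1 ! i)"
    unfolding ends nth_append using i l by (auto simp: nth_butlast)
  show "(last l1 # tl l2) ! i = (if i = 0 then l1 ! (m - 1) else l2 ! i)"
    unfolding ends using i l by (cases i) (simp_all add: nth_tl)
qed

lemma regular_map_on_cross_swap:
  assumes m: "m \<ge> 1"
  shows "regular_map_on (Ubar_power m 2) (cross_domain m) (Ubar_power m 2) (cross_swap m)"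
proof (rule regular_map_on_UbarI[OF openin_cross_domain cross_swap_correct(1)[OF m]])
  let ?X = "Ubar_power m 2" and ?U = "cross_domain m"
  note U = openin_cross_domain[of m]
  have XU: "xs \<in> pts ?X" if "xs \<in> ?U" for xs using that unfolding cross_domain_def by auto
  have shift: "regular_on ?X ?U (\<lambda>xs. cross_shift m xs $$ (i, j))" if ij: "i < m" "j < m" for i j
  proof (rule regular_on_cong)
    show "regular_on ?X ?U (\<lambda>xs. (snd (xs ! 0) ! (m - 1) - snd (xs ! 1) ! 0) / cross_trace m xs *
        cross_prod xs $$ (i, j))"
      using m ij unfolding cross_trace_def
      by (intro regular_on_mult regular_on_divide regular_on_diff regular_on_eigenvalue regular_on_sum
          regular_on_cross_prod U) (auto simp: cross_domain_def cross_trace_def)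
    fix xs assume "xs \<in> ?U"
    note xs = XU[OF this]
    have b: "fst (xs ! 0) \<in> carrier_mat m m" "fst (xs ! 1) \<in> carrier_mat m m"
      and l: "length (snd (xs ! 0)) = m" "length (snd (xs ! 1)) = m"
      using Ubar_power_nth(1,2)[OF xs] by auto
    have "snd (xs ! 0) \<noteq> []" "snd (xs ! 1) \<noteq> []" using l m by auto
    then have "last (snd (xs ! 0)) = snd (xs ! 0) ! (m - 1)" "hd (snd (xs ! 1)) = snd (xs ! 1) ! 0"
      using l by (simp_all add: last_conv_nth hd_conv_nth)
    moreover have "cross_prod xs \<in> carrier_mat m m"
      unfolding cross_prod_def by (intro mult_carrier_mat[of _ m m] shifted_prod_carrier b)
    ultimately show "cross_shift m xs $$ (i, j) =
        (snd (xs ! 0) ! (m - 1) - snd (xs ! 1) ! 0) / cross_trace m xs * cross_prod xs $$ (i, j)"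
      unfolding cross_shift_def using ij by simp
  qed
  have cs: "cross_shift m xs \<in> carrier_mat m m" if "xs \<in> ?U" for xs
    unfolding cross_shift_def cross_prod_def
    using Ubar_power_nth(1)[OF XU[OF that]]
    by (intro smult_carrier_mat mult_carrier_mat[of _ m m] shifted_prod_carrier) auto
  show "regular_on ?X ?U (\<lambda>xs. fst (cross_swap m xs ! k) $$ (i, j))" if kij: "k < 2" "i < m" "j < m" for k i j
  proof -
    consider "k = 0" | "k = 1" using kij by linarith
    then show ?thesis
    proof cases
      case 1
      show ?thesis
      proof (rule regular_on_cong)
        show "regular_on ?X ?U (\<lambda>xs. fst (xs ! 0) $$ (i, j) - cross_shift m xs $$ (i, j))"
          using kij by (intro regular_on_diff regular_on_entry shift U) auto
        show "fst (cross_swap m xs ! k) $$ (i, j) = fst (xs ! 0) $$ (i, j) - cross_shift m xs $$ (i, j)"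
          if "xs \<in> ?U" for xs
          using cs[OF that] \<open>i < m\<close> \<open>j < m\<close> 1 by (simp add: cross_swap_def)
      qed
    next
      case 2
      show ?thesis
      proof (rule regular_on_cong)
        show "regular_on ?X ?U (\<lambda>xs. fst (xs ! 1) $$ (i, j) + cross_shift m xs $$ (i, j))"
          using kij by (intro regular_on_add regular_on_entry shift U) auto
        show "fst (cross_swap m xs ! k) $$ (i, j) = fst (xs ! 1) $$ (i, j) + cross_shift m xs $$ (i, j)"
          if "xs \<in> ?U" for xs
          using cs[OF that] \<open>i < m\<close> \<open>j < m\<close> 2 by (simp add: cross_swap_def)
      qed
    qed
  qed
  show "regular_on ?X ?U (\<lambda>xs. snd (cross_swap m xs ! k) ! i)" if "k < 2" "i < m" for k i
  proof -
    have nth: "snd (cross_swap m xs ! k) ! i =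
      (if k = 0 then if i = m - 1 then snd (xs ! 1) ! 0 else snd (xs ! 0) ! i
       else if i = 0 then snd (xs ! 0) ! (m - 1) else snd (xs ! 1) ! i)" if "xs \<in> ?U" for xs
    proof -
      have l: "length (snd (xs ! 0)) = m" "length (snd (xs ! 1)) = m"
        using Ubar_power_nth(2)[OF XU[OF that]] by auto
      consider "k = 0" | "k = 1" using \<open>k < 2\<close> by linarith
      then show ?thesis
      proof cases
        case 1
        then have eq: "snd (cross_swap m xs ! k) = butlast (snd (xs ! 0)) @ [hd (snd (xs ! 1))]"
          by (simp add: cross_swap_def)
        show ?thesis unfolding eq swapped_ends_nth(1)[OF l m \<open>i < m\<close>] using 1 by simp
      next
        case 2
        then have eq: "snd (cross_swap m xs ! k) = last (snd (xs ! 0)) # tl (snd (xs ! 1))"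
          by (simp add: cross_swap_def)
        show ?thesis unfolding eq swapped_ends_nth(2)[OF l m \<open>i < m\<close>] using 2 by simp
      qed
    qed
    have "regular_on ?X ?U (\<lambda>xs. if k = 0 then if i = m - 1 then snd (xs ! 1) ! 0 else snd (xs ! 0) ! i
       else if i = 0 then snd (xs ! 0) ! (m - 1) else snd (xs ! 1) ! i)"
      using that m
      by (cases "k = 0"; cases "i = m - 1"; cases "i = 0"; simp add: regular_on_eigenvalue[OF U])
    then show ?thesis by (rule regular_on_cong) (rule nth)
  qed
qed

lemma map_snd_cross_swap:
  "map snd (cross_swap m xs) =
    [butlast (snd (xs ! 0)) @ [hd (snd (xs ! 1))], last (snd (xs ! 0)) # tl (snd (xs ! 1))]"
  by (simp add: cross_swap_def)

text \<open>
  Both sides are factorizations of the same product with the same ordered spectra.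
\<close>

lemma cross_swap_involution:
  assumes m: "m \<ge> 1" and xs: "xs \<in> cross_domain m" and xs': "cross_swap m xs \<in> cross_domain m"
  shows "cross_swap m (cross_swap m xs) = xs"
proof -
  have X: "xs \<in> pts (Ubar_power m 2)" using xs unfolding cross_domain_def by auto
  have "length (snd (xs ! 0)) = m" "length (snd (xs ! 1)) = m"
    using Ubar_power_nth(2)[OF X] by auto
  then have ne: "snd (xs ! 0) \<noteq> []" "snd (xs ! 1) \<noteq> []" using m by auto
  have "length xs = 2" using X unfolding pts_var_power by blast
  then have "map snd xs = [snd (xs ! 0), snd (xs ! 1)]"
    by (intro nth_equalityI) (auto simp: less_2_cases_iff)
  also have "\<dots> = map snd (cross_swap m (cross_swap m xs))"
    using ne unfolding map_snd_cross_swap[of m "cross_swap m xs"] by (simp add: cross_swap_def)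
  finally have "xs = cross_swap m (cross_swap m xs)"
    using factor_product_determines[of xs m "cross_swap m (cross_swap m xs)"]
      Ubar_power_set[OF X] Ubar_power_set[OF cross_swap_correct(1)[OF m xs']]
      cross_swap_correct(2)[OF m xs] cross_swap_correct(2)[OF m xs'] xs
    unfolding cross_domain_def by auto
  then show ?thesis by simp
qed

text \<open>
  Commuting matrices show that the exchange is somewhere defined. The second list is reversed on the
  diagonal to let the two exchanged eigenvalues share the last position; at different positions the product
  of the two projectors would be zero.
\<close>

definition diag_pair :: "nat \<Rightarrow> complex list \<Rightarrow> complex list \<Rightarrow> (complex mat \<times> complex list) list" where
  "diag_pair m l1 l2 = [(mat_diag m ((!) l1), l1), (mat_diag m ((!) (rev l2)), l2)]"

lemma diag_pair_in_cross_domain: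
  assumes m: "m \<ge> 1" and l: "length l1 = m" "length l2 = m" "distinct (l1 @ l2)"
  shows "diag_pair m l1 l2 \<in> cross_domain m"
proof -
  have "diag_pair m l1 l2 \<in> pts (Ubar_power m 2)"
    unfolding pts_var_power diag_pair_def using l by (auto simp: less_2_cases_iff intro!: diag_in_Ubar)
  moreover have "distinct (eigenvalue_list (diag_pair m l1 l2))"
    using l(3) by (simp add: eigenvalue_list_def diag_pair_def)
  moreover have "cross_trace m (diag_pair m l1 l2) \<noteq> 0"
  proof -
    have ne: "l1 \<noteq> []" "l2 \<noteq> []" using l m by auto
    define p q where "p i = (\<Prod>\<nu>\<leftarrow>butlast l1. l1 ! i - \<nu>)" and "q i = (\<Prod>\<nu>\<leftarrow>tl l2. rev l2 ! i - \<nu>)" for i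
    have "cross_prod (diag_pair m l1 l2) = mat_diag m (\<lambda>i. p i * q i)"
      unfolding cross_prod_def diag_pair_def p_def q_def by (simp add: shifted_prod_diag)
    then have "cross_trace m (diag_pair m l1 l2) = (\<Sum>i<m. p i * q i)"
      unfolding cross_trace_def by (simp add: mat_diag_def)
    also have "\<dots> = (\<Sum>i<m. if i = m - 1 then p (m - 1) * q (m - 1) else 0)"
    proof (intro sum.cong refl)
      fix i assume "i \<in> {..<m}"
      moreover have "p i = 0" if "i < m - 1"
        using that l unfolding p_def prod_list_shift_eq_0 by (auto simp: in_set_conv_nth nth_butlast)
      ultimately show "p i * q i = (if i = m - 1 then p (m - 1) * q (m - 1) else 0)" by auto
    qed
    also have "\<dots> = p (m - 1) * q (m - 1)" using m by simp
    also have "\<dots> \<noteq> 0"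
    proof -
      have "l1 ! (m - 1) = last l1" "rev l2 ! (m - 1) = hd l2"
        using l ne m by (simp_all add: last_conv_nth rev_nth hd_conv_nth)
      moreover have "last l1 \<notin> set (butlast l1)" "hd l2 \<notin> set (tl l2)"
        using l ne by (simp_all add: set_butlast set_tl)
      ultimately show ?thesis unfolding p_def q_def mult_eq_0_iff prod_list_shift_eq_0 by simp
    qed
    finally show ?thesis .
  qed
  ultimately show ?thesis unfolding cross_domain_def by auto
qed

text \<open>
  The exchange of the two last diagonal entries preserves sum and product, so by uniqueness it is the
  image; thus the image lies in the domain again.
\<close>

lemma cross_swap_diag_pair:
  assumes m: "m \<ge> 1" and l: "length l1 = m" "length l2 = m" "distinct (l1 @ l2)"
  shows "cross_swap m (diag_pair m l1 l2) =
    diag_pair m (butlast l1 @ [hd l2]) (last l1 # tl l2)"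
proof -
  let ?l1 = "butlast l1 @ [hd l2]" and ?l2 = "last l1 # tl l2"
  have ne: "l1 \<noteq> []" "l2 \<noteq> []" using l m by auto
  have l': "length ?l1 = m" "length ?l2 = m" "distinct (?l1 @ ?l2)"
  proof -
    show "length ?l1 = m" "length ?l2 = m" using l m by auto
    have "mset (?l1 @ ?l2) = mset (l1 @ l2)"
      using ne by (cases l1 rule: rev_cases; cases l2) auto
    then show "distinct (?l1 @ ?l2)" using l(3) mset_eq_imp_distinct_iff by blast
  qed
  note dom = diag_pair_in_cross_domain[OF m l]
  have nth: "?l1 ! i = (if i = m - 1 then rev l2 ! i else l1 ! i)"
    "rev ?l2 ! i = (if i = m - 1 then l1 ! i else rev l2 ! i)" if "i < m" for i
  proof -
    show "?l1 ! i = (if i = m - 1 then rev l2 ! i else l1 ! i)"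
      using that l ne by (auto simp: nth_append nth_butlast rev_nth hd_conv_nth)
    show "rev ?l2 ! i = (if i = m - 1 then l1 ! i else rev l2 ! i)"
      using that l ne by (auto simp: nth_append last_conv_nth rev_nth nth_tl Suc_diff_Suc)
  qed
  have nth': "(rev (tl l2) @ [last l1]) ! i = (if i = m - 1 then l1 ! i else rev l2 ! i)" if "i < m" for i
    using nth(2)[OF that] by simp
  have "factor_product m (diag_pair m ?l1 ?l2) = factor_product m (diag_pair m l1 l2)"
    unfolding diag_pair_def
  proof (rule factor_product_pair_eqI)
    show "mat_diag m ((!) ?l1) + mat_diag m ((!) (rev ?l2)) = mat_diag m ((!) l1) + mat_diag m ((!) (rev l2))"
      by (intro eq_matI) (auto simp: mat_diag_def nth(1) nth')
    show "mat_diag m ((!) ?l1) * mat_diag m ((!) (rev ?l2)) = mat_diag m ((!) l1) * mat_diag m ((!) (rev l2))"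
      unfolding mat_diag_diag by (intro eq_matI) (auto simp: mat_diag_def nth(1) nth')
  qed (rule mat_diag_dim)+
  then have "diag_pair m ?l1 ?l2 = cross_swap m (diag_pair m l1 l2)"
    using cross_swap_correct[OF m dom] diag_pair_in_cross_domain[OF m l']
    by (intro factor_product_determines[of _ m])
      (auto simp: cross_domain_def cross_swap_def diag_pair_def intro: Ubar_power_set)
  then show ?thesis by simp
qed

definition cross_map :: "nat \<Rightarrow> (complex mat \<times> complex list) list \<rightharpoonup> (complex mat \<times> complex list) list" where
  "cross_map m = (Some \<circ> cross_swap m) |` {xs \<in> cross_domain m. cross_swap m xs \<in> cross_domain m}"

lemma inverse_pair_cross_map:
  assumes m: "m \<ge> 1"
  shows "inverse_pair (Ubar_power m 2) (cross_map m) (cross_map m)"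
proof -
  define l1 l2 where "l1 = map (of_nat :: nat \<Rightarrow> complex) [0..<m]"
    and "l2 = map (of_nat :: nat \<Rightarrow> complex) [m..<2 * m]"
  have l: "length l1 = m" "length l2 = m" "distinct (l1 @ l2)"
    unfolding l1_def l2_def by (auto simp: distinct_map inj_on_def)
  note dom = diag_pair_in_cross_domain[OF m l]
  have ne: "l1 \<noteq> []" "l2 \<noteq> []" using l m by auto
  have "mset ((butlast l1 @ [hd l2]) @ (last l1 # tl l2)) = mset (l1 @ l2)"
    using ne by (cases l1 rule: rev_cases; cases l2) auto
  then have "distinct ((butlast l1 @ [hd l2]) @ (last l1 # tl l2))"
    using l(3) mset_eq_imp_distinct_iff by blast
  then have "cross_swap m (diag_pair m l1 l2) \<in> cross_domain m"
    unfolding cross_swap_diag_pair[OF m l] using l m by (intro diag_pair_in_cross_domain) auto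
  then show ?thesis
    unfolding cross_map_def
    using partial_involution_inverse_pair[OF irreducible_Ubar_power pts_Ubar_power_nonempty
        regular_map_on_cross_swap[OF m] cross_swap_involution[OF m] dom] by blast
qed

section \<open>Reordering the eigenvalues of one matrix\<close>

definition inner_swap ::
  "nat \<Rightarrow> (complex mat \<times> complex list) list \<Rightarrow> (complex mat \<times> complex list) list" where
  "inner_swap j xs =
     [(fst (xs ! 0), permute_list (Transposition.transpose j (Suc j)) (snd (xs ! 0)))]"

definition inner_map ::
  "nat \<Rightarrow> nat \<Rightarrow> (complex mat \<times> complex list) list \<rightharpoonup> (complex mat \<times> complex list) list" where
  "inner_map m j =
     (Some \<circ> inner_swap j) |` {xs \<in> pts (Ubar_power m 1). inner_swap j xs \<in> pts (Ubar_power m 1)}"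

lemma transpose_permutes_lessThan:
  "i < n \<Longrightarrow> j < n \<Longrightarrow> Transposition.transpose i j permutes {..<n}"
  by (rule permutes_swap_id) auto

lemma inner_swap_in:
  assumes xs: "xs \<in> pts (Ubar_power m 1)" and j: "Suc j < m"
  shows "inner_swap j xs \<in> pts (Ubar_power m 1)"
proof -
  have "(fst (xs ! 0), snd (xs ! 0)) \<in> pts (Ubar m)" using Ubar_power_nth(4)[OF xs] by simp
  moreover have "Transposition.transpose j (Suc j) permutes {..<length (snd (xs ! 0))}"
    using Ubar_power_nth(2)[OF xs] j by (intro transpose_permutes_lessThan) auto
  ultimately have "(fst (xs ! 0), permute_list (Transposition.transpose j (Suc j)) (snd (xs ! 0))) \<in> pts (Ubar m)"
    unfolding pts_Ubar by simp
  then show ?thesis unfolding pts_var_power inner_swap_def by simp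
qed

lemma inverse_pair_inner_map:
  assumes j: "Suc j < m"
  shows "inverse_pair (Ubar_power m 1) (inner_map m j) (inner_map m j)"
proof -
  let ?X = "Ubar_power m 1" and ?t = "Transposition.transpose j (Suc j)"
  have perm: "?t permutes {..<m}" using j by (intro transpose_permutes_lessThan) auto
  have "regular_map_on ?X (pts ?X) ?X (inner_swap j)"
  proof (rule regular_map_on_UbarI[OF openin_zariski_pts])
    show "inner_swap j xs \<in> pts ?X" if "xs \<in> pts ?X" for xs by (rule inner_swap_in[OF that j])
    show "regular_on ?X (pts ?X) (\<lambda>xs. fst (inner_swap j xs ! k) $$ (i, i'))"
      if "k < 1" "i < m" "i' < m" for k i i'
      using regular_on_entry[OF openin_zariski_pts, of 0 1 i m i'] that
      by (simp add: inner_swap_def)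
    show "regular_on ?X (pts ?X) (\<lambda>xs. snd (inner_swap j xs ! k) ! i)" if "k < 1" "i < m" for k i
    proof (rule regular_on_cong)
      have "?t i < m" using permutes_in_image[OF perm, of i] that by simp
      then show "regular_on ?X (pts ?X) (\<lambda>xs. snd (xs ! 0) ! ?t i)"
        by (intro regular_on_eigenvalue openin_zariski_pts) auto
      fix xs assume xs: "xs \<in> pts ?X"
      have "length (snd (xs ! 0)) = m" using Ubar_power_nth(2)[OF xs, of 0] by simp
      then show "snd (inner_swap j xs ! k) ! i = snd (xs ! 0) ! ?t i"
        using that perm by (simp add: inner_swap_def permute_list_nth)
    qed
  qed
  moreover have "inner_swap j (inner_swap j xs) = xs" if xs: "xs \<in> pts ?X" for xs
  proof -
    have l: "length (snd (xs ! 0)) = m" "length xs = 1"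
      using Ubar_power_nth(2)[OF xs, of 0] xs unfolding pts_var_power by auto
    have "permute_list ?t (permute_list ?t (snd (xs ! 0))) = permute_list (?t \<circ> ?t) (snd (xs ! 0))"
      using l perm by (intro permute_list_compose[symmetric]) auto
    then have "inner_swap j (inner_swap j xs) = [xs ! 0]"
      unfolding inner_swap_def by simp
    also have "\<dots> = xs" using l(2) by (intro nth_equalityI) auto
    finally show ?thesis .
  qed
  moreover obtain x0 where "x0 \<in> pts ?X" using pts_Ubar_power_nonempty by blast
  ultimately show ?thesis
    unfolding inner_map_def
    using partial_involution_inverse_pair[OF irreducible_Ubar_power pts_Ubar_power_nonempty] inner_swap_in[OF _ j]
    by blast
qed

section \<open>Refactorizations and permutations\<close>

lemma nth_permute_list: "i < length l \<Longrightarrow> permute_list f l ! i = l ! f i"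
  by (simp add: permute_list_def)

lemma refactors_inner_map:
  assumes "Suc j < m" "inner_map m j xs = Some ys"
  shows "refactors m 1 (Transposition.transpose j (Suc j)) xs ys"
proof -
  have ys: "ys = inner_swap j xs" and xs: "xs \<in> pts (Ubar_power m 1)"
    and ysX: "inner_swap j xs \<in> pts (Ubar_power m 1)"
    using assms(2) unfolding inner_map_def by (auto simp: restrict_map_def split: if_splits)
  have "length xs = 1" using xs unfolding pts_var_power by blast
  then obtain x where x: "xs = [x]" by (auto simp: length_Suc_conv)
  show ?thesis
    unfolding refactors_def ys using ysX
    by (simp add: x inner_swap_def factor_product_Cons eigenvalue_list_def)
qed

lemma refactors_cross_map:
  assumes m: "m \<ge> 1" and xs: "cross_map m xs = Some ys"
  shows "refactors m 2 (Transposition.transpose (m - 1) m) xs ys"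
proof -
  have ys: "ys = cross_swap m xs" and xs: "xs \<in> cross_domain m"
    using xs unfolding cross_map_def by (auto simp: restrict_map_def split: if_splits)
  have X: "xs \<in> pts (Ubar_power m 2)" using xs unfolding cross_domain_def by auto
  have "length xs = 2" using X unfolding pts_var_power by blast
  then obtain x y where xy: "xs = [x, y]" by (auto simp: length_Suc_conv numeral_2_eq_2)
  have l: "length (snd x) = m" "length (snd y) = m"
    using Ubar_power_nth(2)[OF X, of 0] Ubar_power_nth(2)[OF X, of 1] xy by auto
  have ne: "snd x \<noteq> []" "snd y \<noteq> []" using l m by auto
  obtain a as b bs where ab: "snd x = as @ [a]" "snd y = b # bs"
    using ne by (metis list.exhaust rev_exhaust)
  have la: "length as = m - 1" "length bs = m - 1" using l ab by auto
  have "permute_list (Transposition.transpose (m - 1) m) (as @ [a, b] @ bs) = as @ [b, a] @ bs"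
  proof (intro nth_equalityI)
    fix i assume "i < length (permute_list (Transposition.transpose (m - 1) m) (as @ [a, b] @ bs))"
    then have i: "i < length (as @ [a, b] @ bs)" by simp
    have "permute_list (Transposition.transpose (m - 1) m) (as @ [a, b] @ bs) ! i =
        (as @ [a, b] @ bs) ! Transposition.transpose (m - 1) m i"
      by (rule nth_permute_list[OF i])
    also have "\<dots> = (as @ [b, a] @ bs) ! i"
      using i la m by (auto simp: Transposition.transpose_def nth_append nth_Cons' )
    finally show "permute_list (Transposition.transpose (m - 1) m) (as @ [a, b] @ bs) ! i = (as @ [b, a] @ bs) ! i" .
  qed simp
  then have "eigenvalue_list ys = permute_list (inv_into UNIV (Transposition.transpose (m - 1) m)) (eigenvalue_list xs)"
    unfolding ys eigenvalue_list_def map_snd_cross_swap by (simp add: xy ab)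
  then show ?thesis
    unfolding refactors_def using cross_swap_correct[OF m xs] ys by simp
qed

lemma permute_list_transpose_append:
  assumes "length A = a" "i < length B" "j < length B"
  shows "permute_list (Transposition.transpose (a + i) (a + j)) (A @ B @ C) =
    A @ permute_list (Transposition.transpose i j) B @ C"
proof (intro nth_equalityI)
  fix x assume "x < length (permute_list (Transposition.transpose (a + i) (a + j)) (A @ B @ C))"
  then have x: "x < length (A @ B @ C)" by simp
  have "permute_list (Transposition.transpose (a + i) (a + j)) (A @ B @ C) ! x =
      (A @ B @ C) ! Transposition.transpose (a + i) (a + j) x"
    by (rule nth_permute_list[OF x])
  also have "\<dots> = (A @ permute_list (Transposition.transpose i j) B @ C) ! x"
  proof -
    consider "x < a" | y where "x = a + y" "y < length B" | "x \<ge> a + length B"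
      by (metis le_add_diff_inverse nat_add_left_cancel_less not_le)
    then show ?thesis
    proof cases
      case 1
      then show ?thesis using assms by (simp add: Transposition.transpose_def nth_append)
    next
      case (2 y)
      have "Transposition.transpose (a + i) (a + j) x = a + Transposition.transpose i j y"
        using 2 by (simp add: Transposition.transpose_def)
      moreover have "Transposition.transpose i j y < length B"
        using 2 assms by (simp add: Transposition.transpose_def)
      ultimately show ?thesis
        using 2 assms by (simp add: nth_append nth_permute_list)
    next
      case 3
      then have "\<not> x < a" "\<not> x - a < length B" by auto
      moreover have "x \<noteq> a + i" "x \<noteq> a + j" using 3 assms by auto
      ultimately show ?thesis using assms(1) by (simp add: Transposition.transpose_def nth_append)
    qed
  qed
  finally show "permute_list (Transposition.transpose (a + i) (a + j)) (A @ B @ C) ! x =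
      (A @ permute_list (Transposition.transpose i j) B @ C) ! x" .
qed simp

lemma replace_window:
  assumes kr: "k + r \<le> N" and xs: "xs \<in> pts (Ubar_power m N)" and zs: "zs \<in> pts (Ubar_power m r)"
    and F: "factor_product m zs = factor_product m (take r (drop k xs))"
  shows "take k xs @ zs @ drop (k + r) xs \<in> pts (Ubar_power m N)"
    and "factor_product m (take k xs @ zs @ drop (k + r) xs) = factor_product m xs"
proof -
  have len: "length xs = N" "length zs = r" using xs zs unfolding pts_var_power by auto
  show "take k xs @ zs @ drop (k + r) xs \<in> pts (Ubar_power m N)"
    using xs zs kr len unfolding pts_var_power by (auto simp: nth_append)
  have in1: "x \<in> pts (Ubar m)" if "x \<in> set (take k xs)" for x
    using that Ubar_power_set[OF xs] by (meson in_set_takeD)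
  have in2: "x \<in> pts (Ubar m)" if "x \<in> set (drop (k + r) xs)" for x
    using that Ubar_power_set[OF xs] by (meson in_set_dropD)
  have in3: "x \<in> pts (Ubar m)" if "x \<in> set (take r (drop k xs))" for x
    using that Ubar_power_set[OF xs] by (meson in_set_dropD in_set_takeD)
  note in4 = Ubar_power_set[OF zs]
  have split: "xs = take k xs @ take r (drop k xs) @ drop (k + r) xs"
    by (metis append_take_drop_id drop_drop add.commute)
  have cat: "factor_product m (take k xs @ ws @ drop (k + r) xs) =
      factor_product m (take k xs) * (factor_product m ws * factor_product m (drop (k + r) xs))"
    if ws: "\<And>x. x \<in> set ws \<Longrightarrow> x \<in> pts (Ubar m)" for ws
  proof -
    have "factor_product m (ws @ drop (k + r) xs) = factor_product m ws * factor_product m (drop (k + r) xs)"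
      by (rule factor_product_append) (use ws in2 in auto)
    moreover have "factor_product m (take k xs @ (ws @ drop (k + r) xs)) =
        factor_product m (take k xs) * factor_product m (ws @ drop (k + r) xs)"
      by (rule factor_product_append) (use in1 ws in2 in auto)
    ultimately show ?thesis by simp
  qed
  show "factor_product m (take k xs @ zs @ drop (k + r) xs) = factor_product m xs"
  proof -
    have "factor_product m (take k xs @ zs @ drop (k + r) xs) =
        factor_product m (take k xs @ take r (drop k xs) @ drop (k + r) xs)"
      by (simp only: cat[OF in4] cat[OF in3] F)
    also have "\<dots> = factor_product m xs"
      by (rule arg_cong[OF split[symmetric]])
    finally show ?thesis .
  qed
qed

lemma refactors_window:
  assumes kr: "k + r \<le> N" and xs: "xs \<in> pts (Ubar_power m N)"
    and ref: "refactors m r (Transposition.transpose i j) (take r (drop k xs)) zs"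
    and ij: "i < m * r" "j < m * r"
  shows "refactors m N (Transposition.transpose (k * m + i) (k * m + j)) xs (take k xs @ zs @ drop (k + r) xs)"
proof -
  have len: "length xs = N" using xs unfolding pts_var_power by auto
  have wX: "take r (drop k xs) \<in> pts (Ubar_power m r)" and tX: "take k xs \<in> pts (Ubar_power m k)"
    using xs kr unfolding pts_var_power by auto
  have zs: "zs \<in> pts (Ubar_power m r)" "factor_product m zs = factor_product m (take r (drop k xs))"
    "eigenvalue_list zs = permute_list (Transposition.transpose i j) (eigenvalue_list (take r (drop k xs)))"
    using ref unfolding refactors_def by auto
  have split: "xs = take k xs @ take r (drop k xs) @ drop (k + r) xs"
    by (metis append_take_drop_id drop_drop add.commute)
  have cat: "eigenvalue_list (as @ bs @ cs) = eigenvalue_list as @ eigenvalue_list bs @ eigenvalue_list cs" for as bs cs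
    unfolding eigenvalue_list_def by simp
  have "eigenvalue_list (take k xs @ zs @ drop (k + r) xs) =
      permute_list (Transposition.transpose (k * m + i) (k * m + j))
        (eigenvalue_list (take k xs) @ eigenvalue_list (take r (drop k xs)) @ eigenvalue_list (drop (k + r) xs))"
    unfolding cat zs(3)
    by (rule permute_list_transpose_append[symmetric])
      (use length_eigenvalue_list[OF tX] length_eigenvalue_list[OF wX] ij in \<open>auto simp: mult.commute\<close>)
  also have "eigenvalue_list (take k xs) @ eigenvalue_list (take r (drop k xs)) @ eigenvalue_list (drop (k + r) xs) =
      eigenvalue_list xs"
    using cat split by metis
  finally show ?thesis
    unfolding refactors_def using replace_window[OF kr xs zs(1,2)] by simp
qed

text \<open>
  The inverse in the action on lists makes this a left action: \<open>\<tau>\<close> is applied first.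
\<close>

lemma refactors_comp:
  assumes xs: "xs \<in> pts (Ubar_power m N)"
    and \<sigma>: "\<sigma> permutes {..<m * N}" and \<tau>: "\<tau> permutes {..<m * N}"
    and 1: "refactors m N \<tau> xs ys" and 2: "refactors m N \<sigma> ys zs"
  shows "refactors m N (\<sigma> \<circ> \<tau>) xs zs"
proof -
  have "inv_into UNIV \<sigma> permutes {..<length (eigenvalue_list xs)}"
    unfolding length_eigenvalue_list[OF xs] by (rule permutes_inv[OF \<sigma>])
  from permute_list_compose[OF this, of "inv_into UNIV \<tau>"]
  have "eigenvalue_list zs = permute_list (inv_into UNIV \<tau> \<circ> inv_into UNIV \<sigma>) (eigenvalue_list xs)"
    using 1 2 unfolding refactors_def by simp
  also have "inv_into UNIV \<tau> \<circ> inv_into UNIV \<sigma> = inv_into UNIV (\<sigma> \<circ> \<tau>)"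
    using permutes_bij[OF \<sigma>] permutes_bij[OF \<tau>] by (simp add: o_inv_distrib)
  finally show ?thesis using 1 2 unfolding refactors_def by simp
qed

text \<open>
  All ordered spectra have length \<open>m\<close>, so their concatenation loses no information.
\<close>

lemma map_snd_determined:
  assumes "xs \<in> pts (Ubar_power m N)" "ys \<in> pts (Ubar_power m N)" "eigenvalue_list xs = eigenvalue_list ys"
  shows "map snd xs = map snd ys"
proof (rule nth_equalityI)
  have len: "length xs = N" "length ys = N" using assms unfolding pts_var_power by auto
  then show "length (map snd xs) = length (map snd ys)" by simp
  fix k assume "k < length (map snd xs)"
  then have k: "k < N" using len by simp
  have "snd (xs ! k) = snd (ys ! k)"
  proof (rule nth_equalityI)
    show "length (snd (xs ! k)) = length (snd (ys ! k))"
      using Ubar_power_nth(2)[OF assms(1) k] Ubar_power_nth(2)[OF assms(2) k] by simp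
    fix j assume "j < length (snd (xs ! k))"
    then have "j < m" using Ubar_power_nth(2)[OF assms(1) k] by simp
    then show "snd (xs ! k) ! j = snd (ys ! k) ! j"
      using eigenvalue_list_nth[OF assms(1) k] eigenvalue_list_nth[OF assms(2) k] assms(3) by metis
  qed
  then show "map snd xs ! k = map snd ys ! k" using k len by simp
qed

lemma refactors_unique:
  assumes xs: "xs \<in> pts (Ubar_power m N)" "distinct (eigenvalue_list xs)"
    and \<sigma>: "\<sigma> permutes {..<m * N}"
    and 1: "refactors m N \<sigma> xs ys" and 2: "refactors m N \<sigma> xs zs"
  shows "ys = zs"
proof -
  have X: "ys \<in> pts (Ubar_power m N)" "zs \<in> pts (Ubar_power m N)"
    and F: "factor_product m ys = factor_product m zs"
    and E: "eigenvalue_list ys = eigenvalue_list zs"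
    and Ey: "eigenvalue_list ys = permute_list (inv_into UNIV \<sigma>) (eigenvalue_list xs)"
    using 1 2 unfolding refactors_def by auto
  have "inv_into UNIV \<sigma> permutes {..<length (eigenvalue_list xs)}"
    unfolding length_eigenvalue_list[OF xs(1)] by (rule permutes_inv[OF \<sigma>])
  then have "distinct (eigenvalue_list ys)" using xs(2) unfolding Ey by simp
  then show ?thesis
    using factor_product_determines[OF _ _ map_snd_determined[OF X E] F]
      Ubar_power_set[OF X(1)] Ubar_power_set[OF X(2)] by blast
qed

section \<open>Birational refactorization maps\<close>

text \<open>
  Eigenvalues of different matrices may coincide on the domain, because such a map also acts inside a
  larger product, where the remaining factors are arbitrary.
\<close>

definition refactoring_map ::
  "nat \<Rightarrow> nat \<Rightarrow> (nat \<Rightarrow> nat) \<Rightarrow> ((complex mat \<times> complex list) list \<rightharpoonup> (complex mat \<times> complex list) list) \<Rightarrow> bool" where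
  "refactoring_map m N \<sigma> f \<longleftrightarrow> (\<exists>g. inverse_pair (Ubar_power m N) f g) \<and>
     (\<forall>xs ys. f xs = Some ys \<longrightarrow> refactors m N \<sigma> xs ys)"

text \<open>
  Kept apart from the previous notion because a composite inherits it from its inner map, and because for
  the comparison of two maps it is enough that one of them has it.
\<close>

definition simple_on_dom ::
  "((complex mat \<times> complex list) list \<rightharpoonup> 'b) \<Rightarrow> bool" where
  "simple_on_dom f \<longleftrightarrow> (\<forall>xs \<in> dom f. distinct (eigenvalue_list xs))"

lemma inverse_pair_dom:
  assumes "inverse_pair (Ubar_power m N) f g"
  shows "dense_open (Ubar_power m N) (dom f)" "openin (zariski (Ubar_power m N)) (dom f)" "dom f \<noteq> {}"
    "dom f \<subseteq> pts (Ubar_power m N)"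
proof -
  show *: "dense_open (Ubar_power m N) (dom f)"
    using assms unfolding inverse_pair_def rational_map_def by blast
  then show "openin (zariski (Ubar_power m N)) (dom f)" "dom f \<noteq> {}"
    unfolding dense_open_irreducible[OF irreducible_Ubar_power pts_Ubar_power_nonempty] by auto
  then show "dom f \<subseteq> pts (Ubar_power m N)" using openin_zariski_subset by blast
qed

lemma dense_open_Int:
  assumes "dense_open (Ubar_power m N) U" "dense_open (Ubar_power m N) V"
  shows "dense_open (Ubar_power m N) (U \<inter> V)"
  using assms irreducible_Ubar_power[of m N]
  unfolding dense_open_irreducible[OF irreducible_Ubar_power pts_Ubar_power_nonempty] irreducible_variety_def
  by (meson openin_Int)

lemma refactoring_map_comp:
  assumes \<sigma>: "\<sigma> permutes {..<m * N}" and \<tau>: "\<tau> permutes {..<m * N}"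
    and f: "refactoring_map m N \<sigma> f" and h: "refactoring_map m N \<tau> h"
  shows "refactoring_map m N (\<sigma> \<circ> \<tau>) (f \<circ>\<^sub>m h)"
proof -
  obtain f' h' where inv: "inverse_pair (Ubar_power m N) f f'" "inverse_pair (Ubar_power m N) h h'"
    using f h unfolding refactoring_map_def by blast
  have "inverse_pair (Ubar_power m N) (f \<circ>\<^sub>m h) (h' \<circ>\<^sub>m f')"
    by (rule inverse_pair_comp[OF irreducible_Ubar_power pts_Ubar_power_nonempty inv(2,1)])
  moreover have "refactors m N (\<sigma> \<circ> \<tau>) xs zs" if "(f \<circ>\<^sub>m h) xs = Some zs" for xs zs
  proof -
    obtain ys where ys: "h xs = Some ys" "f ys = Some zs" using \<open>(f \<circ>\<^sub>m h) xs = Some zs\<close> unfolding map_comp_Some_iff by blast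
    then have "xs \<in> pts (Ubar_power m N)" using inverse_pair_dom(4)[OF inv(2)] by blast
    then show ?thesis using refactors_comp[OF _ \<sigma> \<tau>] ys f h unfolding refactoring_map_def by blast
  qed
  ultimately show ?thesis unfolding refactoring_map_def by blast
qed

lemma simple_on_dom_comp: "simple_on_dom h \<Longrightarrow> simple_on_dom (f \<circ>\<^sub>m h)"
  unfolding simple_on_dom_def dom_map_comp by blast

lemma refactoring_map_unique:
  assumes \<sigma>: "\<sigma> permutes {..<m * N}"
    and f: "refactoring_map m N \<sigma> f" "simple_on_dom f" and g: "refactoring_map m N \<sigma> g"
  shows "rat_eq (Ubar_power m N) f g"
proof -
  obtain f' g' where inv: "inverse_pair (Ubar_power m N) f f'" "inverse_pair (Ubar_power m N) g g'"
    using f(1) g unfolding refactoring_map_def by blast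
  have "f xs = g xs" if xs: "xs \<in> dom f \<inter> dom g" for xs
  proof -
    obtain ys zs where yz: "f xs = Some ys" "g xs = Some zs" using xs by blast
    have "xs \<in> pts (Ubar_power m N)" using xs inverse_pair_dom(4)[OF inv(1)] by blast
    then have "ys = zs"
      using refactors_unique[OF _ _ \<sigma>] f g yz xs unfolding refactoring_map_def simple_on_dom_def by blast
    then show ?thesis using yz by simp
  qed
  then show ?thesis
    unfolding rat_eq_def
    using dense_open_Int[OF inverse_pair_dom(1)[OF inv(1)] inverse_pair_dom(1)[OF inv(2)]]
    by (intro exI[of _ "dom f \<inter> dom g"]) auto
qed

lemma refactoring_map_act_inside:
  assumes kr: "k + r \<le> N" and ij: "i < m * r" "j < m * r"
    and f: "refactoring_map m r (Transposition.transpose i j) f"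
  shows "refactoring_map m N (Transposition.transpose (k * m + i) (k * m + j)) (act_inside (Ubar m) N k r f)"
proof -
  obtain g where g: "inverse_pair (Ubar_power m r) f g" using f unfolding refactoring_map_def by blast
  have "inverse_pair (Ubar_power m N) (act_inside (Ubar m) N k r f) (act_inside (Ubar m) N k r g)"
    by (rule inverse_pair_act_inside[OF irreducible_Ubar_power irreducible_Ubar_power pts_Ubar_nonempty kr g])
  moreover have "refactors m N (Transposition.transpose (k * m + i) (k * m + j)) xs ys"
    if "act_inside (Ubar m) N k r f xs = Some ys" for xs ys
    using that refactors_window[OF kr _ _ ij] f
    unfolding act_inside_eq_Some[OF kr] refactoring_map_def by blast
  ultimately show ?thesis unfolding refactoring_map_def by blast
qed

lemma refactoring_map_inner:
  assumes "Suc j < m"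
  shows "refactoring_map m 1 (Transposition.transpose j (Suc j)) (inner_map m j)"
  using inverse_pair_inner_map[OF assms] refactors_inner_map[OF assms] unfolding refactoring_map_def by blast

lemma refactoring_map_cross:
  assumes "m \<ge> 1"
  shows "refactoring_map m 2 (Transposition.transpose (m - 1) m) (cross_map m)"
  using inverse_pair_cross_map[OF assms] refactors_cross_map[OF assms] unfolding refactoring_map_def by blast

lemma refactoring_map_adjacent_inner:
  assumes "k < N" "Suc j < m"
  shows "refactoring_map m N (Transposition.transpose (k * m + j) (k * m + Suc j))
    (act_inside (Ubar m) N k 1 (inner_map m j))"
  by (rule refactoring_map_act_inside[OF _ _ _ refactoring_map_inner]) (use assms in auto)

lemma refactoring_map_adjacent_cross:
  assumes "Suc k < N" "m \<ge> 1"
  shows "refactoring_map m N (Transposition.transpose (k * m + (m - 1)) (k * m + m))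
    (act_inside (Ubar m) N k 2 (cross_map m))"
  by (rule refactoring_map_act_inside[OF _ _ _ refactoring_map_cross]) (use assms in auto)

lemma refactoring_map_adjacent:
  assumes m: "m \<ge> 1" and i: "Suc i < m * N"
  shows "\<exists>f. refactoring_map m N (Transposition.transpose i (Suc i)) f"
proof -
  define k j where "k = i div m" and "j = i mod m"
  have ikj: "i = k * m + j" and j: "j < m" using m unfolding k_def j_def by auto
  show ?thesis
  proof (cases "Suc j < m")
    case True
    have "k < N"
    proof (rule ccontr)
      assume "\<not> k < N"
      then have "N * m \<le> k * m" by (intro mult_le_mono1) simp
      moreover have "Suc i < N * m" using i by (simp add: mult.commute)
      ultimately show False using ikj by linarith
    qed
    from refactoring_map_adjacent_inner[OF this True] show ?thesis unfolding ikj by auto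
  next
    case False
    then have jm: "j = m - 1" using j by simp
    have "Suc k < N"
    proof (rule ccontr)
      assume "\<not> Suc k < N"
      then have "N \<le> Suc k" by simp
      then have "N * m \<le> Suc k * m" by (rule mult_le_mono1)
      moreover have "Suc i = Suc k * m" using ikj jm m by simp
      moreover have "Suc i < N * m" using i by (simp add: mult.commute)
      ultimately show False by linarith
    qed
    moreover have "Suc i = k * m + m" "i = k * m + (m - 1)" using ikj jm m by auto
    ultimately show ?thesis using refactoring_map_adjacent_cross[of k N m] m by metis
  qed
qed

text \<open>
  Every permutation is a product of adjacent transpositions. The induction starts from the identity on the
  open set of points with \<open>mN\<close> different eigenvalues, which contains the domains of all later composites.
\<close>

lemma simple_refactoring_map_exists:
  assumes m: "m \<ge> 1" and \<sigma>: "\<sigma> permutes {..<m * N}"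
  shows "\<exists>f. refactoring_map m N \<sigma> f \<and> simple_on_dom f"
proof -
  let ?P = "\<lambda>\<sigma>. \<exists>f. refactoring_map m N \<sigma> f \<and> simple_on_dom f"
  have step: "?P (Transposition.transpose i (Suc i) \<circ> p)"
    if i: "Suc i < m * N" and p: "p permutes {..<m * N}" "?P p" for i p
  proof -
    obtain f h where "refactoring_map m N (Transposition.transpose i (Suc i)) f"
      "refactoring_map m N p h" "simple_on_dom h"
      using refactoring_map_adjacent[OF m i] p(2) by blast
    moreover have "Transposition.transpose i (Suc i) permutes {..<m * N}"
      using i by (intro transpose_permutes_lessThan) auto
    ultimately show ?thesis using refactoring_map_comp[OF _ p(1)] simple_on_dom_comp by blast
  qed
  have seq: "?P (apply_adj_transps js \<circ> p)"
    if "\<forall>i \<in> set js. Suc i < m * N" and p: "p permutes {..<m * N}" "?P p" for js p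
    using that(1)
  proof (induction js)
    case Nil
    then show ?case using p by simp
  next
    case (Cons i js)
    have "apply_adj_transps js \<circ> p permutes {..<m * N}"
      using Cons.prems p(1) by (intro permutes_compose permutes_apply_adj_transps) auto
    moreover have "?P (apply_adj_transps js \<circ> p)"
      by (rule Cons.IH) (use Cons.prems in simp)
    moreover have "Suc i < m * N" using Cons.prems by simp
    ultimately have "?P (Transposition.transpose i (Suc i) \<circ> (apply_adj_transps js \<circ> p))"
      by (intro step)
    then show ?case unfolding apply_adj_transps_Cons Suc_eq_plus1 comp_assoc .
  qed
  have less: "?P (Transposition.transpose a b \<circ> p)"
    if ab: "a < b" "b < m * N" and p: "p permutes {..<m * N}" "?P p" for a b p
  proof -
    have "\<forall>i \<in> set (adj_transp_seq a b). Suc i < m * N"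
      using ab by (auto simp: set_adj_transp_seq)
    from seq[OF this p] show ?thesis unfolding adj_transp_seq_correct[OF ab(1)] .
  qed
  show ?thesis
    using \<sigma> finite_lessThan
  proof (induction rule: permutes_induct)
    case id
    let ?W = "{xs \<in> pts (Ubar_power m N). distinct (eigenvalue_list xs)}"
    have "?W \<noteq> {}" using distinct_point by blast
    then have "inverse_pair (Ubar_power m N) (Some |` ?W) (Some |` ?W)"
      by (rule inverse_pair_open_id[OF irreducible_Ubar_power pts_Ubar_power_nonempty openin_distinct_eigenvalues])
    moreover have "refactors m N id xs ys" if "(Some |` ?W) xs = Some ys" for xs ys
      using that unfolding refactors_def by (auto simp: restrict_map_def split: if_splits)
    moreover have "simple_on_dom (Some |` ?W)" unfolding simple_on_dom_def by auto
    ultimately show ?case unfolding refactoring_map_def by blast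
  next
    case (swap a b p)
    have ab: "a < m * N" "b < m * N" "a \<noteq> b" and p: "p permutes {..<m * N}" using swap by auto
    have P: "?P p" using swap by blast
    show ?case
    proof (cases "a < b")
      case True
      show ?thesis by (rule less[OF True ab(2) p P])
    next
      case False
      then have "b < a" using ab(3) by simp
      from less[OF this ab(1) p P] show ?thesis unfolding transpose_commute[of b a] .
    qed
  qed
qed

section \<open>The exchange of two blocks\<close>

text \<open>
  Formulated for an arbitrary list of disjoint transpositions, so that the induction applies.
\<close>

lemma block_swap_foldr:
  fixes m :: nat
  assumes "set js \<subseteq> {..<m}" "distinct js"
  shows "foldr (\<lambda>i \<pi>. Transposition.transpose i (m + i) \<circ> \<pi>) js id x =
    (if x \<in> set js then m + x else if m \<le> x \<and> x - m \<in> set js then x - m else x)"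
  using assms
proof (induction js)
  case (Cons a js)
  have a: "a < m" "a \<notin> set js" and js: "\<And>y. y \<in> set js \<Longrightarrow> y < m" using Cons.prems by auto
  let ?f = "foldr (\<lambda>i \<pi>. Transposition.transpose i (m + i) \<circ> \<pi>) js id x"
  have IH: "?f = (if x \<in> set js then m + x else if m \<le> x \<and> x - m \<in> set js then x - m else x)"
    by (rule Cons.IH) (use Cons.prems in auto)
  consider "x \<in> set js" | "m \<le> x" "x \<notin> set js" "x - m \<in> set js"
    | "x \<notin> set js" "\<not> (m \<le> x \<and> x - m \<in> set js)" by blast
  then have "Transposition.transpose a (m + a) ?f =
    (if x \<in> set (a # js) then m + x else if m \<le> x \<and> x - m \<in> set (a # js) then x - m else x)"
  proof cases
    case 1
    then have "?f = m + x" "x \<noteq> a" using IH a by auto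
    then show ?thesis using 1 a by (auto simp: Transposition.transpose_def)
  next
    case 2
    then have "?f = x - m" "x - m \<noteq> a" "x - m < m" using IH a js by auto
    then show ?thesis using 2 a by (auto simp: Transposition.transpose_def)
  next
    case 3
    then have "?f = x" using IH by auto
    then show ?thesis using 3 a by (auto simp: Transposition.transpose_def)
  qed
  moreover
  define F where "F = (\<lambda>i (\<pi> :: nat \<Rightarrow> nat). Transposition.transpose i (m + i) \<circ> \<pi>)"
  have "F i \<pi> y = Transposition.transpose i (m + i) (\<pi> y)" for i \<pi> y
    unfolding F_def by simp
  then have "foldr F (a # js) id x = Transposition.transpose a (m + a) (foldr F js id x)"
    by simp
  ultimately show ?case unfolding F_def by (rule trans[rotated])
qed simp

lemma block_swap_apply:
  "block_swap m x = (if x < m then m + x else if x < m + m then x - m else x)"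
  unfolding block_swap_def by (subst block_swap_foldr) auto

lemma block_swap_involution: "block_swap m \<circ> block_swap m = id"
  by (auto simp: block_swap_apply fun_eq_iff)

lemma inv_block_swap: "inv_into UNIV (block_swap m) = block_swap m"
  using block_swap_involution by (rule inv_unique_comp) (rule block_swap_involution)

lemma block_swap_permutes: "block_swap m permutes {..<m * 2}"
proof (rule bij_imp_permutes)
  show "bij_betw (block_swap m) {..<m * 2} {..<m * 2}"
    by (rule bij_betw_byWitness[of _ "block_swap m"]) (auto simp: block_swap_apply)
qed (simp add: block_swap_apply)

lemma permute_list_block_swap:
  assumes "length l1 = m" "length l2 = m"
  shows "permute_list (block_swap m) (l1 @ l2) = l2 @ l1"
  using assms by (intro nth_equalityI) (auto simp: permute_list_def block_swap_apply nth_append)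

lemma block_swap_refactors_snd:
  assumes X: "[x, y] \<in> pts (Ubar_power m 2)" and ref: "refactors m 2 (block_swap m) [x, y] zs"
  shows "map snd zs = [snd y, snd x]"
proof -
  have l: "length (snd x) = m" "length (snd y) = m"
    using Ubar_power_nth(2)[OF X, of 0] Ubar_power_nth(2)[OF X, of 1] by auto
  have zs: "zs \<in> pts (Ubar_power m 2)" using ref unfolding refactors_def by blast
  have E: "eigenvalue_list zs = snd y @ snd x"
    using ref permute_list_block_swap[OF l] unfolding refactors_def inv_block_swap
    by (simp add: eigenvalue_list_def)
  have "[y, x] \<in> pts (Ubar_power m 2)"
    using X unfolding pts_var_power by (auto simp: less_2_cases_iff)
  from map_snd_determined[OF zs this] show ?thesis using E by (simp add: eigenvalue_list_def)
qed

lemma block_exchange_inside: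
  assumes \<mu>: "refactoring_map m 2 (block_swap m) \<mu>" and k: "k \<le> 1"
    and xs: "act_inside (Ubar m) 3 k 2 \<mu> xs = Some ys"
  shows "xs \<in> pts (Ubar_power m 3)" "ys \<in> pts (Ubar_power m 3)"
    "factor_product m ys = factor_product m xs"
    "\<exists>a b c. map snd xs = [a, b, c] \<and> map snd ys = (if k = 0 then [b, a, c] else [a, c, b])"
proof -
  have k3: "k + 2 \<le> 3" using k by simp
  obtain zs where zs: "xs \<in> pts (Ubar_power m 3)" "\<mu> (take 2 (drop k xs)) = Some zs"
    "ys = take k xs @ zs @ drop (k + 2) xs"
    using xs unfolding act_inside_eq_Some[OF k3] by blast
  have ref: "refactors m 2 (block_swap m) (take 2 (drop k xs)) zs"
    using \<mu> zs(2) unfolding refactoring_map_def by blast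
  then have z: "zs \<in> pts (Ubar_power m 2)" "factor_product m zs = factor_product m (take 2 (drop k xs))"
    unfolding refactors_def by auto
  show "xs \<in> pts (Ubar_power m 3)" by fact
  show "ys \<in> pts (Ubar_power m 3)" "factor_product m ys = factor_product m xs"
    unfolding zs(3) using replace_window[OF k3 zs(1) z] by auto
  have w: "take 2 (drop k xs) \<in> pts (Ubar_power m 2)"
    using zs(1) k3 unfolding pts_var_power by auto
  have "length xs = 3" using zs(1) unfolding pts_var_power by blast
  then obtain x y z where xyz: "xs = [x, y, z]" by (auto simp: length_Suc_conv numeral_3_eq_3)
  have "k = 0 \<or> k = 1" using k by auto
  then show "\<exists>a b c. map snd xs = [a, b, c] \<and> map snd ys = (if k = 0 then [b, a, c] else [a, c, b])"
  proof
    assume k: "k = 0"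
    have "map snd zs = [snd y, snd x]"
      using block_swap_refactors_snd[of x y m zs] w ref by (simp add: xyz k)
    then show ?thesis unfolding zs(3) by (simp add: xyz k)
  next
    assume k: "k = 1"
    have "map snd zs = [snd z, snd y]"
      using block_swap_refactors_snd[of y z m zs] w ref by (simp add: xyz k)
    then show ?thesis unfolding zs(3) by (simp add: xyz k)
  qed
qed

text \<open>
  Here the permutation is recorded only through its effect \<open>\<pi>\<close> on the ordered spectra as blocks, which
  saves computing with permutations of single positions when whole blocks are exchanged.
\<close>

lemma rat_eq_by_eigenvalues:
  assumes f: "inverse_pair (Ubar_power m N) f f'" and g: "inverse_pair (Ubar_power m N) g g'"
    and f2: "\<And>xs ys. f xs = Some ys \<Longrightarrow> ys \<in> pts (Ubar_power m N) \<and>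
      factor_product m ys = factor_product m xs \<and> map snd ys = \<pi> (map snd xs)"
    and g2: "\<And>xs ys. g xs = Some ys \<Longrightarrow> ys \<in> pts (Ubar_power m N) \<and>
      factor_product m ys = factor_product m xs \<and> map snd ys = \<pi> (map snd xs)"
    and \<pi>: "\<And>ls. distinct (concat ls) \<Longrightarrow> length ls = N \<Longrightarrow> distinct (concat (\<pi> ls))"
  shows "rat_eq (Ubar_power m N) f g"
proof -
  let ?W = "{xs \<in> pts (Ubar_power m N). distinct (eigenvalue_list xs)}"
  have "dense_open (Ubar_power m N) ?W"
    unfolding dense_open_irreducible[OF irreducible_Ubar_power pts_Ubar_power_nonempty]
    using openin_distinct_eigenvalues distinct_point by blast
  then have "dense_open (Ubar_power m N) (dom f \<inter> dom g \<inter> ?W)"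
    by (intro dense_open_Int inverse_pair_dom(1)[OF f] inverse_pair_dom(1)[OF g])
  moreover have "f xs = g xs" if xs: "xs \<in> dom f \<inter> dom g \<inter> ?W" for xs
  proof -
    obtain ys zs where yz: "f xs = Some ys" "g xs = Some zs" using xs by blast
    have "length (map snd xs) = N" using xs unfolding pts_var_power by simp
    moreover have "distinct (concat (map snd xs))" using xs unfolding eigenvalue_list_def by simp
    ultimately have "distinct (eigenvalue_list ys)"
      unfolding eigenvalue_list_def using f2[OF yz(1)] \<pi> by metis
    moreover have X: "ys \<in> pts (Ubar_power m N)" "zs \<in> pts (Ubar_power m N)"
      and "map snd ys = map snd zs" "factor_product m ys = factor_product m zs"
      using f2[OF yz(1)] g2[OF yz(2)] by auto
    ultimately have "ys = zs"
      using factor_product_determines[of ys m zs] Ubar_power_set[OF X(1)] Ubar_power_set[OF X(2)] by blast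
    then show ?thesis using yz by simp
  qed
  ultimately show ?thesis unfolding rat_eq_def by (intro exI[of _ "dom f \<inter> dom g \<inter> ?W"]) auto
qed

text \<open>
  On the three ordered spectra the two maps act as the transpositions of neighbouring blocks, which satisfy
  the braid relation, and a map that preserves the product is determined by its effect on the spectra.
\<close>

lemma twisted_transposition_block_swap:
  assumes \<mu>: "refactoring_map m 2 (block_swap m) \<mu>"
  shows "twisted_transposition (Ubar m) \<mu>"
proof -
  let ?X = "Ubar_power m 3"
  obtain \<nu> where inv: "inverse_pair (Ubar_power m 2) \<mu> \<nu>"
    using \<mu> unfolding refactoring_map_def by blast
  define s1 s2 where "s1 = act_inside (Ubar m) 3 0 2 \<mu>" and "s2 = act_inside (Ubar m) 3 1 2 \<mu>"
  have ip: "\<exists>g. inverse_pair ?X s1 g" "\<exists>g. inverse_pair ?X s2 g"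
    unfolding s1_def s2_def
    using inverse_pair_act_inside[OF irreducible_Ubar_power irreducible_Ubar_power pts_Ubar_nonempty _ inv, where n = 3 and k = 0]
      inverse_pair_act_inside[OF irreducible_Ubar_power irreducible_Ubar_power pts_Ubar_nonempty _ inv, where n = 3 and k = 1]
    by auto
  have comp: "\<exists>g. inverse_pair ?X (f \<circ>\<^sub>m h) g"
    if "\<exists>g. inverse_pair ?X f g" "\<exists>g. inverse_pair ?X h g" for f h
    using that inverse_pair_comp[OF irreducible_Ubar_power pts_Ubar_power_nonempty] by blast
  have id: "\<exists>g. inverse_pair ?X (Some |` pts ?X) g"
    using inverse_pair_open_id[OF irreducible_Ubar_power pts_Ubar_power_nonempty openin_zariski_pts pts_Ubar_power_nonempty]
    by blast
  define sw1 sw2 :: "complex list list \<Rightarrow> complex list list"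
    where "sw1 ls = [ls ! 1, ls ! 0, ls ! 2]" and "sw2 ls = [ls ! 0, ls ! 2, ls ! 1]" for ls
  define moves where "moves f \<pi> \<longleftrightarrow> (\<forall>xs ys. f xs = Some ys \<longrightarrow> ys \<in> pts ?X \<and>
      factor_product m ys = factor_product m xs \<and> map snd ys = \<pi> (map snd xs))"
    for f and \<pi> :: "complex list list \<Rightarrow> complex list list"
  have mv: "moves s1 sw1" "moves s2 sw2"
    unfolding moves_def
  proof (intro allI impI)
    fix xs ys assume xs: "s1 xs = Some ys"
    show "ys \<in> pts ?X \<and> factor_product m ys = factor_product m xs \<and> map snd ys = sw1 (map snd xs)"
      using block_exchange_inside[OF \<mu> _ xs[unfolded s1_def]] unfolding sw1_def by auto
  next
    show "\<forall>xs ys. s2 xs = Some ys \<longrightarrow> ys \<in> pts ?X \<and>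
      factor_product m ys = factor_product m xs \<and> map snd ys = sw2 (map snd xs)"
    proof (intro allI impI)
      fix xs ys assume xs: "s2 xs = Some ys"
      show "ys \<in> pts ?X \<and> factor_product m ys = factor_product m xs \<and> map snd ys = sw2 (map snd xs)"
        using block_exchange_inside[OF \<mu> _ xs[unfolded s2_def]] unfolding sw2_def by auto
    qed
  qed
  have mv_comp: "moves (f \<circ>\<^sub>m h) (\<lambda>ls. \<pi> (\<pi>' ls))" if "moves f \<pi>" "moves h \<pi>'" for f h \<pi> \<pi>'
    using that unfolding moves_def map_comp_Some_iff by metis
  have three: "\<exists>a b c. ls = [a, b, c]" if "length ls = 3" for ls :: "complex list list"
    using that by (auto simp: length_Suc_conv numeral_3_eq_3)
  have eq: "rat_eq ?X f g"
    if f: "\<exists>f'. inverse_pair ?X f f'" "moves f \<pi>" and g: "\<exists>g'. inverse_pair ?X g g'" "moves g \<pi>'"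
      and \<pi>: "\<And>a b c. \<pi>' [a, b, c] = \<pi> [a, b, c]"
      and d: "\<And>a b c. distinct (concat [a, b, c]) \<Longrightarrow> distinct (concat (\<pi> [a, b, c]))"
    for f g \<pi> \<pi>'
  proof -
    obtain f' g' where i: "inverse_pair ?X f f'" "inverse_pair ?X g g'" using f(1) g(1) by blast
    have g2: "map snd ys = \<pi> (map snd xs)" if "g xs = Some ys" for xs ys
    proof -
      have "xs \<in> pts ?X" using inverse_pair_dom(4)[OF i(2)] that by blast
      then have "length (map snd xs) = 3" unfolding pts_var_power by simp
      then show ?thesis using three \<pi> g(2) that unfolding moves_def by metis
    qed
    show ?thesis
    proof (rule rat_eq_by_eigenvalues[OF i])
      show "ys \<in> pts ?X \<and> factor_product m ys = factor_product m xs \<and> map snd ys = \<pi> (map snd xs)"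
        if "f xs = Some ys" for xs ys using f(2) that unfolding moves_def by blast
      show "ys \<in> pts ?X \<and> factor_product m ys = factor_product m xs \<and> map snd ys = \<pi> (map snd xs)"
        if "g xs = Some ys" for xs ys using g(2) g2[OF that] that unfolding moves_def by blast
      show "distinct (concat (\<pi> ls))" if "distinct (concat ls)" "length ls = 3" for ls
        using three[OF that(2)] that(1) d by blast
    qed
  qed
  have mv_id: "moves (Some |` pts ?X) (\<lambda>ls. ls)"
    unfolding moves_def by (auto simp: restrict_map_def split: if_splits)
  have to_Some: "rat_eq ?X f Some" if f: "rat_eq ?X f (Some |` pts ?X)" for f
  proof -
    obtain V where V: "dense_open ?X V" "\<forall>xs\<in>V. f xs \<noteq> None \<and> f xs = (Some |` pts ?X) xs"
      using f unfolding rat_eq_def by blast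
    moreover have "V \<subseteq> pts ?X" using V(1) openin_zariski_subset unfolding dense_open_def by blast
    ultimately show ?thesis unfolding rat_eq_def by (intro exI[of _ V]) auto
  qed
  have "rat_eq ?X (s1 \<circ>\<^sub>m s1) Some"
    by (rule to_Some[OF eq[OF comp[OF ip(1,1)] mv_comp[OF mv(1,1)] id mv_id]]) (auto simp: sw1_def)
  moreover have "rat_eq ?X (s2 \<circ>\<^sub>m s2) Some"
    by (rule to_Some[OF eq[OF comp[OF ip(2,2)] mv_comp[OF mv(2,2)] id mv_id]]) (auto simp: sw2_def)
  moreover have "rat_eq ?X (s1 \<circ>\<^sub>m s2 \<circ>\<^sub>m s1) (s2 \<circ>\<^sub>m s1 \<circ>\<^sub>m s2)"
    by (rule eq[OF comp[OF comp[OF ip(1,2)] ip(1)] mv_comp[OF mv_comp[OF mv(1,2)] mv(1)]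
          comp[OF comp[OF ip(2,1)] ip(2)] mv_comp[OF mv_comp[OF mv(2,1)] mv(2)]])
      (auto simp: sw1_def sw2_def)
  ultimately show ?thesis
    unfolding twisted_transposition_def Let_def s1_def s2_def using inverse_pair_birational[OF inv] by blast
qed

section \<open>The action of the symmetric group\<close>

lemma generic_dense_open:
  assumes "dense_open (Ubar_power m N) V" "\<And>xs. xs \<in> V \<Longrightarrow> P xs"
  shows "generic (Ubar_power m N) P"
proof -
  have V: "openin (zariski (Ubar_power m N)) V" "V \<noteq> {}"
    using assms(1) unfolding dense_open_irreducible[OF irreducible_Ubar_power pts_Ubar_power_nonempty] by auto
  have "closedin (zariski (Ubar_power m N)) (pts (Ubar_power m N) - V)"
    using V(1) openin_zariski_subset[OF V(1)]
    unfolding closedin_def topspace_zariski by (simp add: double_diff)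
  moreover have "pts (Ubar_power m N) - V \<noteq> pts (Ubar_power m N)"
    using V openin_zariski_subset[OF V(1)] by blast
  ultimately show ?thesis
    unfolding generic_def using assms(2) by (intro exI[of _ "pts (Ubar_power m N) - V"]) auto
qed

theorem mainTheorem2:
  fixes m N :: nat
  assumes "m \<ge> 1" and "N \<ge> 1"
  shows
    "\<exists>\<rho> :: (nat \<Rightarrow> nat) \<Rightarrow>
        ((complex mat \<times> complex list) list \<rightharpoonup> (complex mat \<times> complex list) list).
      \<comment> \<open>the birational automorphisms defined by refactorization\<close>
      (\<forall>\<sigma>. \<sigma> permutes {..<m * N} \<longrightarrow>
         birational_automorphism (var_power (Ubar m) N) (\<rho> \<sigma>) \<and>
         generic (var_power (Ubar m) N)
           (\<lambda>bs. (\<exists>!bs'. refactors m N \<sigma> bs bs') \<and>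
                 (\<exists>bs'. refactors m N \<sigma> bs bs' \<and> \<rho> \<sigma> bs = Some bs'))) \<and>
      \<comment> \<open>they form an action\<close>
      rat_eq (var_power (Ubar m) N) (\<rho> id) Some \<and>
      (\<forall>\<sigma> \<tau>. \<sigma> permutes {..<m * N} \<longrightarrow> \<tau> permutes {..<m * N} \<longrightarrow>
         rat_eq (var_power (Ubar m) N) (\<rho> (\<sigma> \<circ> \<tau>)) (\<rho> \<sigma> \<circ>\<^sub>m \<rho> \<tau>)) \<and>
      \<comment> \<open>locality; \<open>i\<close> counts positions from 1\<close>
      (\<forall>\<alpha> i. \<alpha> \<le> N - 1 \<longrightarrow> \<alpha> * m < i \<longrightarrow> i < (\<alpha> + 1) * m \<longrightarrow>
         (\<exists>\<phi>. birational_automorphism (var_power (Ubar m) 1) \<phi> \<and>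
           rat_eq (var_power (Ubar m) N)
             (\<rho> (Transposition.transpose (i - 1) i)) (act_inside (Ubar m) N \<alpha> 1 \<phi>))) \<and>
      (\<forall>\<alpha>. 1 \<le> \<alpha> \<longrightarrow> \<alpha> \<le> N - 1 \<longrightarrow>
         (\<exists>\<phi>. birational_automorphism (var_power (Ubar m) 2) \<phi> \<and>
           rat_eq (var_power (Ubar m) N)
             (\<rho> (Transposition.transpose (\<alpha> * m - 1) (\<alpha> * m))) (act_inside (Ubar m) N (\<alpha> - 1) 2 \<phi>))) \<and>
      (N = 2 \<longrightarrow> twisted_transposition (Ubar m) (\<rho> (block_swap m)))"
proof -
  note m = assms(1)
  \<comment> \<open>Different choices agree as rational maps, by uniqueness of refactorizations.\<close>
  define \<rho> where "\<rho> \<sigma> = (SOME f. refactoring_map m N \<sigma> f \<and> simple_on_dom f)" for \<sigma>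
  have \<rho>: "refactoring_map m N \<sigma> (\<rho> \<sigma>)" "simple_on_dom (\<rho> \<sigma>)" if "\<sigma> permutes {..<m * N}" for \<sigma>
    using someI_ex[OF simple_refactoring_map_exists[OF m that]] unfolding \<rho>_def by blast+
  have gen: "birational_automorphism (Ubar_power m N) (\<rho> \<sigma>) \<and>
      generic (Ubar_power m N)
         (\<lambda>bs. (\<exists>!bs'. refactors m N \<sigma> bs bs') \<and> (\<exists>bs'. refactors m N \<sigma> bs bs' \<and> \<rho> \<sigma> bs = Some bs'))"
    if \<sigma>: "\<sigma> permutes {..<m * N}" for \<sigma>
  proof
    obtain g where g: "inverse_pair (Ubar_power m N) (\<rho> \<sigma>) g"
      using \<rho>(1)[OF \<sigma>] unfolding refactoring_map_def by blast
    show "birational_automorphism (Ubar_power m N) (\<rho> \<sigma>)" by (rule inverse_pair_birational[OF g])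
    show "generic (Ubar_power m N)
       (\<lambda>bs. (\<exists>!bs'. refactors m N \<sigma> bs bs') \<and> (\<exists>bs'. refactors m N \<sigma> bs bs' \<and> \<rho> \<sigma> bs = Some bs'))"
    proof (rule generic_dense_open[OF inverse_pair_dom(1)[OF g]])
      fix bs assume bs: "bs \<in> dom (\<rho> \<sigma>)"
      then obtain bs' where bs': "\<rho> \<sigma> bs = Some bs'" by blast
      then have ref: "refactors m N \<sigma> bs bs'" using \<rho>(1)[OF \<sigma>] unfolding refactoring_map_def by blast
      have "bs \<in> pts (Ubar_power m N)" "distinct (eigenvalue_list bs)"
        using bs inverse_pair_dom(4)[OF g] \<rho>(2)[OF \<sigma>] unfolding simple_on_dom_def by auto
      then show "(\<exists>!bs'. refactors m N \<sigma> bs bs') \<and> (\<exists>bs'. refactors m N \<sigma> bs bs' \<and> \<rho> \<sigma> bs = Some bs')"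
        using ref bs' refactors_unique[OF _ _ \<sigma>] by blast
    qed
  qed
  have unit: "rat_eq (Ubar_power m N) (\<rho> id) Some"
  proof -
    obtain g where g: "inverse_pair (Ubar_power m N) (\<rho> id) g"
      using \<rho>(1)[OF permutes_id] unfolding refactoring_map_def by blast
    have "\<rho> id bs = Some bs" if bs: "bs \<in> dom (\<rho> id)" for bs
    proof -
      obtain bs' where bs': "\<rho> id bs = Some bs'" using bs by blast
      then have ref: "refactors m N id bs bs'" using \<rho>(1)[OF permutes_id] unfolding refactoring_map_def by blast
      have X: "bs \<in> pts (Ubar_power m N)" "distinct (eigenvalue_list bs)"
        using bs inverse_pair_dom(4)[OF g] \<rho>(2)[OF permutes_id] unfolding simple_on_dom_def by auto
      have "refactors m N id bs bs" using X(1) unfolding refactors_def by simp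
      then show ?thesis using refactors_unique[OF X permutes_id ref] bs' by blast
    qed
    then show ?thesis
      unfolding rat_eq_def using inverse_pair_dom(1)[OF g] by (intro exI[of _ "dom (\<rho> id)"]) auto
  qed
  have mult: "rat_eq (Ubar_power m N) (\<rho> (\<sigma> \<circ> \<tau>)) (\<rho> \<sigma> \<circ>\<^sub>m \<rho> \<tau>)"
    if \<sigma>: "\<sigma> permutes {..<m * N}" and \<tau>: "\<tau> permutes {..<m * N}" for \<sigma> \<tau>
    using refactoring_map_unique[OF _ \<rho> refactoring_map_comp[OF \<sigma> \<tau> \<rho>(1)[OF \<sigma>] \<rho>(1)[OF \<tau>]]]
      permutes_compose[OF \<tau> \<sigma>] by blast
  have adj: "rat_eq (Ubar_power m N) (\<rho> (Transposition.transpose i (Suc i))) g"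
    if i: "Suc i < m * N" and g: "refactoring_map m N (Transposition.transpose i (Suc i)) g" for i g
  proof -
    have "Transposition.transpose i (Suc i) permutes {..<m * N}"
      using i by (intro transpose_permutes_lessThan) auto
    then show ?thesis using refactoring_map_unique[OF _ \<rho> g] by blast
  qed
  have inside: "\<exists>\<phi>. birational_automorphism (Ubar_power m 1) \<phi> \<and>
      rat_eq (Ubar_power m N) (\<rho> (Transposition.transpose (i - 1) i)) (act_inside (Ubar m) N \<alpha> 1 \<phi>)"
    if i: "\<alpha> \<le> N - 1" "\<alpha> * m < i" "i < (\<alpha> + 1) * m" for \<alpha> i
  proof -
    obtain j where j: "i = \<alpha> * m + Suc j" using less_imp_Suc_add[OF i(2)] by auto
    have jm: "Suc j < m" using i(3) j by simp
    have "(\<alpha> + 1) * m \<le> N * m" using i(1) assms(2) by (intro mult_le_mono1) simp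
    then have "Suc (\<alpha> * m + j) < m * N" using i(3) j by (simp add: mult.commute)
    moreover have "refactoring_map m N (Transposition.transpose (\<alpha> * m + j) (Suc (\<alpha> * m + j)))
        (act_inside (Ubar m) N \<alpha> 1 (inner_map m j))"
      using refactoring_map_adjacent_inner[of \<alpha> N j m] i(1) assms(2) jm by simp
    ultimately have "rat_eq (Ubar_power m N) (\<rho> (Transposition.transpose (i - 1) i))
        (act_inside (Ubar m) N \<alpha> 1 (inner_map m j))"
      using adj[of "\<alpha> * m + j"] j by simp
    then show ?thesis using inverse_pair_birational[OF inverse_pair_inner_map[OF jm]] by blast
  qed
  have across: "\<exists>\<phi>. birational_automorphism (Ubar_power m 2) \<phi> \<and>
      rat_eq (Ubar_power m N) (\<rho> (Transposition.transpose (\<alpha> * m - 1) (\<alpha> * m)))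
        (act_inside (Ubar m) N (\<alpha> - 1) 2 \<phi>)"
    if \<alpha>: "1 \<le> \<alpha>" "\<alpha> \<le> N - 1" for \<alpha>
  proof -
    obtain k where k: "\<alpha> = Suc k" using \<alpha>(1) by (cases \<alpha>) auto
    have kN: "Suc k < N" using \<alpha>(2) k assms(2) by simp
    have pos: "Suc (\<alpha> * m - 1) = \<alpha> * m" "\<alpha> * m - 1 = k * m + (m - 1)" "\<alpha> * m = k * m + m"
      using k m by auto
    have "\<alpha> * m < N * m" using kN k m by (intro mult_less_mono1) auto
    then have "Suc (\<alpha> * m - 1) < m * N" unfolding pos(1) by (simp add: mult.commute)
    moreover have "refactoring_map m N (Transposition.transpose (\<alpha> * m - 1) (Suc (\<alpha> * m - 1)))
        (act_inside (Ubar m) N k 2 (cross_map m))"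
      using refactoring_map_adjacent_cross[OF kN m]
      by (simp only: pos(1) pos(2)[symmetric] pos(3)[symmetric])
    ultimately have "rat_eq (Ubar_power m N) (\<rho> (Transposition.transpose (\<alpha> * m - 1) (Suc (\<alpha> * m - 1))))
        (act_inside (Ubar m) N k 2 (cross_map m))"
      by (rule adj)
    then have "rat_eq (Ubar_power m N) (\<rho> (Transposition.transpose (\<alpha> * m - 1) (\<alpha> * m)))
        (act_inside (Ubar m) N (\<alpha> - 1) 2 (cross_map m))"
      unfolding pos(1) using k by simp
    then show ?thesis using inverse_pair_birational[OF inverse_pair_cross_map[OF m]] by blast
  qed
  have twist: "twisted_transposition (Ubar m) (\<rho> (block_swap m))" if "N = 2"
    using twisted_transposition_block_swap \<rho>(1)[of "block_swap m"] block_swap_permutes that by simp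
  show ?thesis
    by (intro exI[of _ \<rho>] conjI allI impI) (use gen unit mult inside across twist in blast)+
qed

end
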